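(* Let $G$ be a finitely generated group, $n\ge0$ an integer, and $A$ a (left) $\mathbb{Z}G$-module of type $\mathtt{FP}_n$. Suppose $H\le G$ is a subgroup of finite index and write $\iota:H\hookrightarrow G$ for the inclusion. If $r_0(G_{ab})=r_0(H_{ab})$, then $\iota^\ast:S(G)\to S(H)$, $[\chi]\mapsto[\chi|_H]$, is a well-defined homeomorphism, and $$\iota^\ast(\Sigma^n(G,A))=\Sigma^n(H,A),$$ where on the right $A$ is regarded as a $\mathbb{Z}H$-module by restriction.
   Context: For a finitely generated group $G$, $G_{ab}$ is its abelianisation and $r_0(G_{ab})$ is the torsion-free rank of $G_{ab}$ (i.e. $\dim_{\mathbb{Q}}(G_{ab}\otimes_{\mathbb{Z}}\mathbb{Q})$). A character of $G$ is a homomorphism $\chi:G\to\mathbb{R}$. Nonzero characters $\chi,\chi'$ are equivalent if $\chi=a\chi'$ for some real $a>0$; $[\chi]$ denotes the class of $\chi$, and the character sphere $S(G)$ is the set of classes of nonzero characters, with the quotient topology from $\mathrm{Hom}(G,\mathbb{R})\setminus\{0\}$. Well-definedness of $\iota^\ast$ on $S(G)$ includes the claim that $\chi|_H\ne0$ whenever $\chi\neq0$. A left module $A$ over a unital ring $R$ is of type $\mathtt{FP}_n$ over $R$ if it has a resolution $\cdots\to P_1\to P_0\to A\to0$ by free left $R$-modules with $P_i$ finitely generated for $i\le n$. For a left $\mathbb{Z}G$-module $A$ of type $\mathtt{FP}_n$ (over $\mathbb{Z}G$), the set $\Sigma^n(G,A)\subseteq S(G)$ is defined by: $[\chi]\in\Sigma^n(G,A)$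 if and only if $A$ is of type $\mathtt{FP}_n$ over the monoid ring $\mathbb{Z}G_\chi\subseteq\mathbb{Z}G$, where $G_\chi=\{g\in G\mid\chi(g)\ge0\}$. *)

theory Defs
  imports
    "HOL-Analysis.Analysis"
    "HOL-Algebra.Algebra"
    "Jordan_Normal_Form.VS_Connect"
begin

section \<open>Finitely generated groups and the torsion-free rank\<close>

definition finitely_generated_group :: "('g, 'b) monoid_scheme \<Rightarrow> bool" where
  "finitely_generated_group G \<longleftrightarrow>
     group G \<and> (\<exists>S. finite S \<and> S \<subseteq> carrier G \<and> generate G S = carrier G)"

definition abelianisation :: "('g, 'b) monoid_scheme \<Rightarrow> 'g set monoid" where
  "abelianisation G = G Mod derived G (carrier G)"

text \<open>
  The tensor product of an abelian group \<open>A\<close> (written multiplicatively) with the rationals over the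
  integers: the free abelian group on the pairs \<open>(a, q)\<close> modulo the bilinearity relations.  It is a
  vector space over the rationals through \<open>p (a \<otimes> q) = a \<otimes> (p q)\<close>.
\<close>

definition tensor_rat_relations ::
    "('a, 'b) monoid_scheme \<Rightarrow> (('a \<times> rat) \<Rightarrow>\<^sub>0 int) set" where
  "tensor_rat_relations A =
     {frag_of (a \<otimes>\<^bsub>A\<^esub> b, q) - frag_of (a, q) - frag_of (b, q) | a b q.
        a \<in> carrier A \<and> b \<in> carrier A} \<union>
     {frag_of (a, q + r) - frag_of (a, q) - frag_of (a, r) | a q r. a \<in> carrier A}"

definition tensor_rat_free :: "('a, 'b) monoid_scheme \<Rightarrow> (('a \<times> rat) \<Rightarrow>\<^sub>0 int) monoid" where
  "tensor_rat_free A = free_Abelian_group (carrier A \<times> UNIV)"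

definition tensor_rat_kernel :: "('a, 'b) monoid_scheme \<Rightarrow> (('a \<times> rat) \<Rightarrow>\<^sub>0 int) set" where
  "tensor_rat_kernel A = generate (tensor_rat_free A) (tensor_rat_relations A)"

text \<open>The fields \<open>mult\<close> and \<open>one\<close>, which the type of modules inherits from rings, play no role in a
  module.\<close>

definition tensor_rat ::
    "('a, 'b) monoid_scheme \<Rightarrow> (rat, (('a \<times> rat) \<Rightarrow>\<^sub>0 int) set) module" where
  "tensor_rat A =
     \<lparr>carrier = carrier (tensor_rat_free A Mod tensor_rat_kernel A),
      monoid.mult = undefined,
      monoid.one = undefined,
      ring.zero = \<one>\<^bsub>tensor_rat_free A Mod tensor_rat_kernel A\<^esub>,
      ring.add = monoid.mult (tensor_rat_free A Mod tensor_rat_kernel A),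
      module.smult = (\<lambda>p C. \<Union>x\<in>C. tensor_rat_kernel A #>\<^bsub>tensor_rat_free A\<^esub>
                 frag_extend (\<lambda>(a, q). frag_of (a, p * q)) x)\<rparr>"

text \<open>\<^const>\<open>vectorspace.dim\<close> is meaningful only in finite dimension; for finitely generated \<open>A\<close>, the
  only case used, the tensor product is finite-dimensional.\<close>

definition torsion_free_rank :: "('a, 'b) monoid_scheme \<Rightarrow> nat" where
  "torsion_free_rank A = vectorspace.dim class_ring (tensor_rat A)"


section \<open>Left modules over a ring that need not be commutative, and type FP\<close>

text \<open>The library's locale \<^locale>\<open>module\<close> assumes a commutative ring; this is the same locale over
  an arbitrary unital ring.  A module is passed to a subring by keeping the record \<open>M\<close> and changing
  \<open>R\<close>.\<close>

locale left_module = R?: ring R + M?: abelian_group M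
  for R :: "('r, 'c) ring_scheme" (structure) and M :: "('r, 'm, 'd) module_scheme" (structure) +
  assumes smult_closed:
      "\<lbrakk>a \<in> carrier R; x \<in> carrier M\<rbrakk> \<Longrightarrow> a \<odot>\<^bsub>M\<^esub> x \<in> carrier M"
    and smult_l_distr:
      "\<lbrakk>a \<in> carrier R; b \<in> carrier R; x \<in> carrier M\<rbrakk> \<Longrightarrow>
        (a \<oplus>\<^bsub>R\<^esub> b) \<odot>\<^bsub>M\<^esub> x = a \<odot>\<^bsub>M\<^esub> x \<oplus>\<^bsub>M\<^esub> b \<odot>\<^bsub>M\<^esub> x"
    and smult_r_distr:
      "\<lbrakk>a \<in> carrier R; x \<in> carrier M; y \<in> carrier M\<rbrakk> \<Longrightarrow>
        a \<odot>\<^bsub>M\<^esub> (x \<oplus>\<^bsub>M\<^esub> y) = a \<odot>\<^bsub>M\<^esub> x \<oplus>\<^bsub>M\<^esub> a \<odot>\<^bsub>M\<^esub> y"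
    and smult_assoc:
      "\<lbrakk>a \<in> carrier R; b \<in> carrier R; x \<in> carrier M\<rbrakk> \<Longrightarrow>
        (a \<otimes>\<^bsub>R\<^esub> b) \<odot>\<^bsub>M\<^esub> x = a \<odot>\<^bsub>M\<^esub> (b \<odot>\<^bsub>M\<^esub> x)"
    and smult_one:
      "x \<in> carrier M \<Longrightarrow> \<one>\<^bsub>R\<^esub> \<odot>\<^bsub>M\<^esub> x = x"

text \<open>\<open>B\<close> is a basis if every element is, uniquely, a combination of elements of \<open>B\<close> with a finitely
  supported family of coefficients.  The sum is taken over the support because \<^const>\<open>finsum\<close> over
  an infinite set is a dummy value.\<close>

definition module_basis :: "('r, 'c) ring_scheme \<Rightarrow> ('r, 'm) module \<Rightarrow> 'm set \<Rightarrow> bool" where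
  "module_basis R M B \<longleftrightarrow>
     B \<subseteq> carrier M \<and>
     (\<forall>x\<in>carrier M. \<exists>!c. c \<in> B \<rightarrow>\<^sub>E carrier R \<and> finite {b \<in> B. c b \<noteq> \<zero>\<^bsub>R\<^esub>} \<and>
        x = (\<Oplus>\<^bsub>M\<^esub>b\<in>{b \<in> B. c b \<noteq> \<zero>\<^bsub>R\<^esub>}. c b \<odot>\<^bsub>M\<^esub> b))"

definition free_module :: "('r, 'c) ring_scheme \<Rightarrow> ('r, 'm) module \<Rightarrow> bool" where
  "free_module R M \<longleftrightarrow> left_module R M \<and> (\<exists>B. module_basis R M B)"

definition finitely_generated_module :: "('r, 'c) ring_scheme \<Rightarrow> ('r, 'm) module \<Rightarrow> bool" where
  "finitely_generated_module R M \<longleftrightarrow>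
     left_module R M \<and>
     (\<exists>S. finite S \<and> S \<subseteq> carrier M \<and>
        (\<forall>x\<in>carrier M. \<exists>c \<in> S \<rightarrow> carrier R. x = (\<Oplus>\<^bsub>M\<^esub>s\<in>S. c s \<odot>\<^bsub>M\<^esub> s)))"

definition left_module_hom ::
    "('r, 'c) ring_scheme \<Rightarrow> ('r, 'm) module \<Rightarrow> ('r, 'n) module \<Rightarrow> ('m \<Rightarrow> 'n) set" where
  "left_module_hom R M N =
     {f \<in> hom (add_monoid M) (add_monoid N).
        \<forall>a\<in>carrier R. \<forall>x\<in>carrier M. f (a \<odot>\<^bsub>M\<^esub> x) = a \<odot>\<^bsub>N\<^esub> f x}"

text \<open>\<open>\<dots> \<rightarrow> P 2 \<rightarrow> P 1 \<rightarrow> P 0 \<rightarrow> M \<rightarrow> 0\<close> with augmentation \<open>e : P 0 \<rightarrow> M\<close> and differentials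
  \<open>d i : P (i + 1) \<rightarrow> P i\<close>.\<close>

definition free_resolution ::
    "('r, 'c) ring_scheme \<Rightarrow> ('r, 'm) module \<Rightarrow>
     (nat \<Rightarrow> ('r, 'p) module) \<Rightarrow> (nat \<Rightarrow> 'p \<Rightarrow> 'p) \<Rightarrow> ('p \<Rightarrow> 'm) \<Rightarrow> bool" where
  "free_resolution R M P d e \<longleftrightarrow>
     (\<forall>i. free_module R (P i)) \<and>
     e \<in> left_module_hom R (P 0) M \<and>
     (\<forall>i. d i \<in> left_module_hom R (P (Suc i)) (P i)) \<and>
     e ` carrier (P 0) = carrier M \<and>
     {x \<in> carrier (P 0). e x = \<zero>\<^bsub>M\<^esub>} = d 0 ` carrier (P 1) \<and>
     (\<forall>i. {x \<in> carrier (P (Suc i)). d i x = \<zero>\<^bsub>P i\<^esub>} = d (Suc i) ` carrier (P (Suc (Suc i))))"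

text \<open>
  HOL cannot quantify over types inside a formula, so the modules of a resolution are taken on
  subsets of the single type \<^typ>\<open>('r + 'm) list \<Rightarrow> 'r\<close>.  This loses nothing.  If \<open>M\<close> has a
  resolution in some other universe, with \<open>P i\<close> finitely generated for \<open>i \<le> n\<close>, replace \<open>P i\<close> for
  \<open>i \<le> n\<close> by finitely supported functions on a finite index set and then resolve the kernel of the
  last map by free modules on its elements and so on.  All these modules have at most as many
  elements as \<^typ>\<open>('r + 'm) list\<close>, so they are modules of finitely supported \<open>R\<close>-valued functions on
  subsets of that type.
\<close>

definition fp_type :: "nat \<Rightarrow> ('r, 'c) ring_scheme \<Rightarrow> ('r, 'm) module \<Rightarrow> bool" where
  "fp_type n R M \<longleftrightarrow>
     left_module R M \<and>
     (\<exists>(P :: nat \<Rightarrow> ('r, ('r + 'm) list \<Rightarrow> 'r) module) d e.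
        free_resolution R M P d e \<and> (\<forall>i\<le>n. finitely_generated_module R (P i)))"

text \<open>The integral monoid ring: finitely supported integer-valued functions on the monoid, with
  convolution as product.\<close>

definition monoid_ring :: "('g, 'b) monoid_scheme \<Rightarrow> ('g \<Rightarrow>\<^sub>0 int) ring" where
  "monoid_ring G =
     \<lparr>carrier = {x. Poly_Mapping.keys x \<subseteq> carrier G},
      monoid.mult = (\<lambda>x y. frag_extend (\<lambda>g. frag_extend (\<lambda>h. frag_of (g \<otimes>\<^bsub>G\<^esub> h)) y) x),
      monoid.one = frag_of \<one>\<^bsub>G\<^esub>,
      ring.zero = 0,
      ring.add = (+)\<rparr>"


section \<open>Characters, the character sphere and the Sigma-invariants\<close>

definition real_group :: "real monoid" where
  "real_group = \<lparr>carrier = UNIV, mult = (+), one = 0\<rparr>"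

text \<open>Characters are made \<^const>\<open>extensional\<close> so that equality of characters means equality on the
  group.\<close>

definition characters :: "('g, 'b) monoid_scheme \<Rightarrow> ('g \<Rightarrow> real) set" where
  "characters G = hom G real_group \<inter> extensional (carrier G)"

definition nonzero_characters :: "('g, 'b) monoid_scheme \<Rightarrow> ('g \<Rightarrow> real) set" where
  "nonzero_characters G = {\<xi> \<in> characters G. \<exists>g\<in>carrier G. \<xi> g \<noteq> 0}"

definition character_class :: "('g, 'b) monoid_scheme \<Rightarrow> ('g \<Rightarrow> real) \<Rightarrow> ('g \<Rightarrow> real) set" where
  "character_class G \<xi> =
     {\<xi>' \<in> nonzero_characters G. \<exists>a>0. \<forall>g\<in>carrier G. \<xi> g = a * \<xi>' g}"

definition character_sphere :: "('g, 'b) monoid_scheme \<Rightarrow> ('g \<Rightarrow> real) set set" where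
  "character_sphere G = character_class G ` nonzero_characters G"

text \<open>For finitely generated \<open>G\<close>, the topology of pointwise convergence is the usual topology of
  the finite-dimensional real vector space of characters.\<close>

definition character_topology :: "('g, 'b) monoid_scheme \<Rightarrow> ('g \<Rightarrow> real) topology" where
  "character_topology G =
     subtopology (product_topology (\<lambda>_. euclideanreal) (carrier G)) (characters G)"

definition sphere_topology :: "('g, 'b) monoid_scheme \<Rightarrow> (('g \<Rightarrow> real) set) topology" where
  "sphere_topology G =
     topology (\<lambda>U. U \<subseteq> character_sphere G \<and>
       openin (subtopology (character_topology G) (nonzero_characters G))
         {\<xi> \<in> nonzero_characters G. character_class G \<xi> \<in> U})"

lemma openin_sphere_topology:
  "openin (sphere_topology G) U \<longleftrightarrow>
     U \<subseteq> character_sphere G \<and>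
     openin (subtopology (character_topology G) (nonzero_characters G))
       {\<xi> \<in> nonzero_characters G. character_class G \<xi> \<in> U}"
proof -
  let ?T = "subtopology (character_topology G) (nonzero_characters G)"
  let ?pre = "\<lambda>U. {\<xi> \<in> nonzero_characters G. character_class G \<xi> \<in> U}"
  have int: "?pre (S \<inter> S') = ?pre S \<inter> ?pre S'" for S S'
    by auto
  have un: "?pre (\<Union>\<K>) = (\<Union>K\<in>\<K>. ?pre K)" for \<K>
    by auto
  have "istopology (\<lambda>U. U \<subseteq> character_sphere G \<and> openin ?T (?pre U))"
    unfolding istopology_def int un by (auto intro!: openin_Int openin_Union)
  then show ?thesis
    by (simp add: sphere_topology_def topology_inverse')
qed

lemma quotient_map_character_class:
  "quotient_map (subtopology (character_topology G) (nonzero_characters G)) (sphere_topology G)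
     (character_class G)"
proof -
  let ?T = "subtopology (character_topology G) (nonzero_characters G)"
  have nz: "topspace ?T = nonzero_characters G"
    by (auto simp: character_topology_def nonzero_characters_def characters_def PiE_def)
  have "{\<xi> \<in> nonzero_characters G. character_class G \<xi> \<in> character_sphere G}
      = nonzero_characters G"
    by (auto simp: character_sphere_def)
  then have "openin (sphere_topology G) (character_sphere G)"
    using openin_topspace[of ?T] unfolding nz by (simp add: openin_sphere_topology)
  then have "topspace (sphere_topology G) = character_sphere G"
    using openin_subset[of "sphere_topology G"] openin_topspace[of "sphere_topology G"]
    unfolding openin_sphere_topology by blast
  then show ?thesis
    unfolding quotient_map_def nz
    by (simp add: openin_sphere_topology character_sphere_def)
qed

definition nonneg_submonoid ::
    "('g, 'b) monoid_scheme \<Rightarrow> ('g \<Rightarrow> real) \<Rightarrow> ('g, 'b) monoid_scheme" where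
  "nonneg_submonoid G \<xi> = G\<lparr>carrier := {g \<in> carrier G. \<xi> g \<ge> 0}\<rparr>"

definition Sigma_invariant ::
    "nat \<Rightarrow> ('g, 'b) monoid_scheme \<Rightarrow> ('g \<Rightarrow>\<^sub>0 int, 'm) module \<Rightarrow> ('g \<Rightarrow> real) set set" where
  "Sigma_invariant n G A =
     {character_class G \<xi> | \<xi>.
        \<xi> \<in> nonzero_characters G \<and> fp_type n (monoid_ring (nonneg_submonoid G \<xi>)) A}"

text \<open>The map induced by restriction sends a class to the common class of the restrictions of its
  members; \<^const>\<open>the_elem\<close> has a specified value only if these classes agree.\<close>

definition sphere_restriction ::
    "('g, 'b) monoid_scheme \<Rightarrow> 'g set \<Rightarrow> ('g \<Rightarrow> real) set \<Rightarrow> ('g \<Rightarrow> real) set" where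
  "sphere_restriction G H c =
     the_elem ((\<lambda>\<xi>. character_class (G\<lparr>carrier := H\<rparr>) (restrict \<xi> H)) ` c)"

end

theory Submission
  imports Defs "HOL-Library.Function_Algebras"
begin

text \<open>
  The proof treats characters and finiteness properties separately.

  \<^emph>\<open>Characters.\<close>  Every \<open>g\<close> in \<open>G\<close> has a power \<open>g\<^sup>k\<close>, \<open>k > 0\<close>, in \<open>H\<close>, so a character \<open>\<xi>\<close> of
  \<open>G\<close> is determined by its restriction through \<open>\<xi> g = \<xi> (g\<^sup>k) / k\<close>.  Restriction is therefore
  injective, and it respects and reflects positive proportionality.  For a character \<open>\<eta>\<close> of \<open>H\<close> the
  same formula is the only possible extension to \<open>G\<close>; the point is that it is additive.  If the
  \<open>k\<close>-th powers of \<open>g\<close>, \<open>h\<close> and \<open>gh\<close> lie in \<open>H\<close>, then \<open>(gh)\<^sup>k\<close> and \<open>g\<^sup>k h\<^sup>k\<close> have the same image in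
  the abelianisation of \<open>G\<close>.  The map from \<open>H\<^sub>a\<^sub>b \<otimes> \<rat>\<close> to \<open>G\<^sub>a\<^sub>b \<otimes> \<rat>\<close> is surjective, again because of
  powers, and the hypothesis on the ranks makes it injective; so the two elements already agree in
  \<open>H\<^sub>a\<^sub>b \<otimes> \<rat>\<close>, through which \<open>\<eta>\<close> factors (\<open>root_extension_character\<close>).  Restriction and extension
  are continuous for pointwise convergence and pass to the quotients by positive scaling.

  \<^emph>\<open>Finiteness.\<close>  It remains to compare type \<open>FP\<^sub>n\<close> over the monoid rings of
  \<open>{h \<in> H. \<xi> h \<ge> 0}\<close> and \<open>{g \<in> G. \<xi> g \<ge> 0}\<close>, for a nonzero character \<open>\<xi>\<close> of \<open>G\<close>.  Fix a free
  resolution \<open>F\<close> of \<open>A\<close> over \<open>\<int>G\<close> which is finitely generated up to degree \<open>n\<close>, and filter \<open>F\<^sub>i\<close>, a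
  free module of finite rank, by the vectors supported in \<open>{\<xi> \<ge> r}\<close>.  For every subgroup \<open>K\<close> of
  finite index, \<open>A\<close> is of type \<open>FP\<^sub>n\<close> over the monoid ring of \<open>{k \<in> K. \<xi> k \<ge> 0}\<close> if and only if this
  filtration is essentially acyclic: cycles of level \<open>r\<close> in degree below \<open>n\<close> bound in level \<open>r - c\<close>,
  with \<open>c\<close> independent of \<open>r\<close>, and every level of \<open>F\<^sub>0\<close> maps onto \<open>A\<close> (\<open>resolves_iff_essentially_acyclic\<close>).  This condition does not mention
  \<open>K\<close>, so that it can be used for \<open>H\<close> and for \<open>G\<close> itself (\<open>fp_type_nonneg_finite_index\<close>).

  The criterion is a variant of those of Bieri--Renz and Brown.  The levels of the filtration need not
  be projective over the small ring, but they lie within bounded distance of free submodules of finite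
  rank obtained by measuring \<open>\<xi>\<close> relative to coset representatives.  Given essential acyclicity, a
  finitely generated partial resolution \<open>P\<close> is extended by one degree at a time: chain maps
  \<open>P \<rightarrow> F \<rightarrow> P\<close> exhibit the cycles of \<open>P\<close> as a sum of two images of finitely generated modules.
  Conversely, a comparison of \<open>F\<close> with a finitely generated \<open>P\<close> fills cycles of one level in a bounded
  way, and translation by elements of \<open>G\<close> carries this to all levels.
\<close>

section \<open>Finitely generated projective modules over subrings\<close>

(* Below, the dot denotes the action of scalars on vectors, and X is a variable. *)
no_notation Polynomials.var (\<open>X\<index>\<close>)
no_notation Ideal_Product.ideal_prod (infixl \<open>\<cdot>\<index>\<close> 80)

lemmas pointwise = plus_fun_apply zero_fun_apply minus_apply uminus_apply

(* Vectors are functions; identities between them are to be simplified without passing to values. *)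
declare pointwise [simp del]

text \<open>
  A ring carried by a subset \<open>L\<close> of a type, with the group structure of the type.  The product is
  additive on the whole type but associative and unital on \<open>L\<close> only, as for the convolution of
  finitely supported functions on a type of which the group is a subset.
  All modules are sets of vectors over \<open>L\<close>, regarded as modules over varying subrings of \<open>L\<close>.
\<close>

locale coefficient_ring =
  fixes mul :: "'r::ab_group_add \<Rightarrow> 'r \<Rightarrow> 'r" and one :: 'r and L :: "'r set"
  assumes mul_add_left: "mul (a + b) c = mul a c + mul b c"
    and mul_add_right: "mul a (b + c) = mul a b + mul a c"
    and L_zero: "0 \<in> L"
    and L_add: "a \<in> L \<Longrightarrow> b \<in> L \<Longrightarrow> a + b \<in> L"
    and L_uminus: "a \<in> L \<Longrightarrow> - a \<in> L"
    and L_mul: "a \<in> L \<Longrightarrow> b \<in> L \<Longrightarrow> mul a b \<in> L"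
    and L_one: "one \<in> L"
    and mul_assoc: "a \<in> L \<Longrightarrow> b \<in> L \<Longrightarrow> c \<in> L \<Longrightarrow> mul (mul a b) c = mul a (mul b c)"
    and mul_one_left: "a \<in> L \<Longrightarrow> mul one a = a"
    and mul_one_right: "a \<in> L \<Longrightarrow> mul a one = a"
begin

lemma mul_zero_left [simp]: "mul 0 c = 0"
  using mul_add_left[of 0 0 c] by simp

lemma mul_zero_right [simp]: "mul c 0 = 0"
  using mul_add_right[of c 0 0] by simp

lemma mul_uminus_left: "mul (- a) c = - mul a c"
  using mul_add_left[of a "- a" c] by (simp add: eq_neg_iff_add_eq_0 add.commute)

lemma mul_uminus_right: "mul c (- a) = - mul c a"
  using mul_add_right[of c a "- a"] by (simp add: eq_neg_iff_add_eq_0 add.commute)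

lemma mul_diff_right: "mul c (a - b) = mul c a - mul c b"
  using mul_add_right[of c a "- b"] by (simp add: mul_uminus_right)

definition act :: "'r \<Rightarrow> ('i \<Rightarrow> 'r) \<Rightarrow> 'i \<Rightarrow> 'r"  (infixr \<open>\<cdot>\<close> 75)
  where "act a f = (\<lambda>i. mul a (f i))"

definition vec :: "('i \<Rightarrow> 'r) set"
  where "vec = {f. \<forall>i. f i \<in> L}"

definition subring :: "'r set \<Rightarrow> bool"
  where "subring R \<longleftrightarrow> R \<subseteq> L \<and> 0 \<in> R \<and> one \<in> R \<and> (\<forall>a\<in>R. - a \<in> R)
     \<and> (\<forall>a\<in>R. \<forall>b\<in>R. a + b \<in> R \<and> mul a b \<in> R)"

definition submod :: "'r set \<Rightarrow> ('i \<Rightarrow> 'r) set \<Rightarrow> bool"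
  where "submod R X \<longleftrightarrow> X \<subseteq> vec \<and> 0 \<in> X \<and> (\<forall>x\<in>X. \<forall>y\<in>X. x + y \<in> X) \<and> (\<forall>a\<in>R. \<forall>x\<in>X. a \<cdot> x \<in> X)"

definition linear_on :: "'r set \<Rightarrow> ('i \<Rightarrow> 'r) set \<Rightarrow> (('i \<Rightarrow> 'r) \<Rightarrow> 'j \<Rightarrow> 'r) \<Rightarrow> bool"
  where "linear_on R X f \<longleftrightarrow>
     (\<forall>x\<in>X. \<forall>y\<in>X. f (x + y) = f x + f y) \<and> (\<forall>a\<in>R. \<forall>x\<in>X. f (a \<cdot> x) = a \<cdot> f x)"

lemma act_add_left: "(a + b) \<cdot> x = a \<cdot> x + b \<cdot> x"
  by (auto simp: act_def fun_eq_iff pointwise mul_add_left)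

lemma act_add_right: "a \<cdot> (x + y) = a \<cdot> x + a \<cdot> y"
  by (auto simp: act_def fun_eq_iff pointwise mul_add_right)

lemma act_zero_left [simp]: "0 \<cdot> x = 0"
  by (auto simp: act_def fun_eq_iff pointwise)

lemma act_zero_right [simp]: "a \<cdot> 0 = 0"
  by (auto simp: act_def fun_eq_iff pointwise)

lemma act_uminus_left: "(- a) \<cdot> x = - (a \<cdot> x)"
  by (auto simp: act_def fun_eq_iff pointwise mul_uminus_left)

lemma act_diff_right: "a \<cdot> (x - y) = a \<cdot> x - a \<cdot> y"
  by (auto simp: act_def fun_eq_iff pointwise mul_diff_right)

lemma act_sum_right: "a \<cdot> (\<Sum>i\<in>I. f i) = (\<Sum>i\<in>I. a \<cdot> f i)"
  by (induction I rule: infinite_finite_induct) (auto simp: act_add_right)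

lemma act_act: "a \<in> L \<Longrightarrow> b \<in> L \<Longrightarrow> x \<in> vec \<Longrightarrow> (mul a b) \<cdot> x = a \<cdot> b \<cdot> x"
  by (auto simp: act_def vec_def mul_assoc)

lemma act_one [simp]: "x \<in> vec \<Longrightarrow> one \<cdot> x = x"
  by (auto simp: act_def vec_def mul_one_left)

lemma subring_L: "subring L"
  by (auto simp: subring_def L_zero L_one L_add L_mul L_uminus)

lemma subringD:
  assumes "subring R"
  shows "R \<subseteq> L" "0 \<in> R" "one \<in> R" "a \<in> R \<Longrightarrow> - a \<in> R"
    "a \<in> R \<Longrightarrow> b \<in> R \<Longrightarrow> a + b \<in> R" "a \<in> R \<Longrightarrow> b \<in> R \<Longrightarrow> mul a b \<in> R"
  using assms by (auto simp: subring_def)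

lemma submodD:
  assumes "submod R X"
  shows "X \<subseteq> vec" "0 \<in> X" "x \<in> X \<Longrightarrow> y \<in> X \<Longrightarrow> x + y \<in> X" "a \<in> R \<Longrightarrow> x \<in> X \<Longrightarrow> a \<cdot> x \<in> X"
  using assms by (auto simp: submod_def)

lemma submod_uminus:
  assumes "subring R" "submod R X" "x \<in> X" shows "- x \<in> X"
proof -
  have "(- one) \<cdot> x \<in> X"
    using assms by (intro submodD(4)[of R]) (auto intro: subringD)
  then show ?thesis
    using assms submodD(1)[OF assms(2)] by (auto simp: act_uminus_left)
qed

lemma submod_diff:
  assumes "subring R" "submod R X" "x \<in> X" "y \<in> X" shows "x - y \<in> X"
  using submodD(3)[OF assms(2), of x "- y"] submod_uminus[OF assms(1,2)] assms by auto

lemma submod_sum: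
  assumes "submod R X" "\<And>i. i \<in> I \<Longrightarrow> f i \<in> X" shows "sum f I \<in> X"
  using assms(2)
  by (induction I rule: infinite_finite_induct) (auto intro: submodD[OF assms(1)])

lemma submod_subring: "submod R X \<Longrightarrow> R' \<subseteq> R \<Longrightarrow> submod R' X"
  by (auto simp: submod_def)

lemma submod_Int: "submod R X \<Longrightarrow> submod R Y \<Longrightarrow> submod R (X \<inter> Y)"
  by (auto simp: submod_def)

lemma linear_subring: "linear_on R X f \<Longrightarrow> R' \<subseteq> R \<Longrightarrow> X' \<subseteq> X \<Longrightarrow> linear_on R' X' f"
  by (auto simp: linear_on_def subset_iff)

lemma linear_zero:
  assumes "linear_on R X f" "submod R X" shows "f 0 = 0"
proof -
  have "f (0 + 0) = f 0 + f 0"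
    using assms unfolding linear_on_def by (blast intro: submodD)
  then show ?thesis by simp
qed

lemma linear_diff:
  assumes "subring R" "linear_on R X f" "submod R X" "x \<in> X" "y \<in> X"
  shows "f (x - y) = f x - f y"
proof -
  have "f ((x - y) + y) = f (x - y) + f y"
    using assms submod_diff[of R X x y] unfolding linear_on_def by blast
  then show ?thesis by (simp add: algebra_simps)
qed

lemma linear_compose:
  assumes "linear_on R X f" "linear_on R Y g" "f ` X \<subseteq> Y"
  shows "linear_on R X (\<lambda>x. g (f x))"
  using assms by (auto simp: linear_on_def image_subset_iff)

lemma linear_minus:
  assumes "linear_on R X f" "linear_on R X g"
  shows "linear_on R X (\<lambda>x. f x - g x)"
  using assms by (auto simp: linear_on_def act_diff_right)

lemma linear_ident: "linear_on R X (\<lambda>x. x)"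
  by (auto simp: linear_on_def)

lemma submod_kernel:
  assumes "linear_on R X f" "submod R X"
  shows "submod R {x \<in> X. f x = 0}"
  using assms by (auto simp: submod_def linear_on_def linear_zero[OF assms])

lemma submod_preimage:
  assumes "linear_on R X f" "submod R X" "submod R Y"
  shows "submod R {x \<in> X. f x \<in> Y}"
  using assms linear_zero[OF assms(1,2)] by (auto simp: submod_def linear_on_def)

lemma submod_image:
  assumes "linear_on R X f" "submod R X" "f ` X \<subseteq> vec"
  shows "submod R (f ` X)"
  unfolding submod_def
proof (intro conjI ballI)
  show "0 \<in> f ` X"
    using linear_zero[OF assms(1,2)] submodD(2)[OF assms(2)] by force
next
  fix x y assume "x \<in> f ` X" "y \<in> f ` X"
  then obtain u v where "u \<in> X" "v \<in> X" "x = f u" "y = f v" by auto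
  then show "x + y \<in> f ` X"
    using assms(1) submodD(3)[OF assms(2)] by (intro image_eqI[of _ _ "u + v"]) (auto simp: linear_on_def)
next
  fix a x assume "a \<in> R" "x \<in> f ` X"
  then obtain u where "u \<in> X" "x = f u" by auto
  then show "a \<cdot> x \<in> f ` X"
    using assms(1) submodD(4)[OF assms(2) \<open>a \<in> R\<close>] \<open>a \<in> R\<close>
    by (intro image_eqI[of _ _ "a \<cdot> u"]) (auto simp: linear_on_def)
qed (use assms in auto)

text \<open>Over a free module this is a basis with its coordinate functions; in general, the expansion
  of the elements in the \<open>b i\<close> need not be unique, and the existence of a finite dual basis
  characterises the finitely generated projective modules.\<close>

definition dual_basis :: "'r set \<Rightarrow> (nat \<Rightarrow> 'r) set \<Rightarrow> 'i set \<Rightarrow> ('i \<Rightarrow> nat \<Rightarrow> 'r) \<Rightarrow>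
    ('i \<Rightarrow> (nat \<Rightarrow> 'r) \<Rightarrow> 'r) \<Rightarrow> bool"
  where "dual_basis R X I b \<phi> \<longleftrightarrow> finite I \<and>
     (\<forall>i\<in>I. b i \<in> X \<and> (\<forall>x\<in>X. \<phi> i x \<in> R) \<and>
        (\<forall>x\<in>X. \<forall>y\<in>X. \<phi> i (x + y) = \<phi> i x + \<phi> i y) \<and>
        (\<forall>a\<in>R. \<forall>x\<in>X. \<phi> i (a \<cdot> x) = mul a (\<phi> i x))) \<and>
     (\<forall>x\<in>X. x = (\<Sum>i\<in>I. \<phi> i x \<cdot> b i))"

definition projective :: "'r set \<Rightarrow> (nat \<Rightarrow> 'r) set \<Rightarrow> bool"
  where "projective R X \<longleftrightarrow> submod R X \<and> (\<exists>(I :: nat set) b \<phi>. dual_basis R X I b \<phi>)"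

lemma dual_basisD:
  assumes "dual_basis R X I b \<phi>"
  shows "finite I" "i \<in> I \<Longrightarrow> b i \<in> X" "i \<in> I \<Longrightarrow> x \<in> X \<Longrightarrow> \<phi> i x \<in> R"
    "i \<in> I \<Longrightarrow> x \<in> X \<Longrightarrow> y \<in> X \<Longrightarrow> \<phi> i (x + y) = \<phi> i x + \<phi> i y"
    "i \<in> I \<Longrightarrow> a \<in> R \<Longrightarrow> x \<in> X \<Longrightarrow> \<phi> i (a \<cdot> x) = mul a (\<phi> i x)"
    "x \<in> X \<Longrightarrow> (\<Sum>i\<in>I. \<phi> i x \<cdot> b i) = x"
  using assms by (simp_all add: dual_basis_def)

lemma projectiveI:
  assumes "submod R X" "dual_basis R X I b \<phi>" shows "projective R X"
proof -
  obtain h where h: "bij_betw h {..<card I} I"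
    using ex_bij_betw_nat_finite[OF dual_basisD(1)[OF assms(2)]] by (auto simp: lessThan_atLeast0)
  have hI: "h l \<in> I" if "l < card I" for l using h that by (auto simp: bij_betw_def)
  have "(\<Sum>l<card I. \<phi> (h l) x \<cdot> b (h l)) = x" if "x \<in> X" for x
    using dual_basisD(6)[OF assms(2) that] sum.reindex_bij_betw[OF h, of "\<lambda>i. \<phi> i x \<cdot> b i"] by simp
  then have "dual_basis R X {..<card I} (b \<circ> h) (\<phi> \<circ> h)"
    using dual_basisD(2-5)[OF assms(2)] hI by (simp add: dual_basis_def)
  then show ?thesis using assms(1) unfolding projective_def by blast
qed

text \<open>The relation \<open>W\<close> stands for an \<open>R\<close>-linear map whose values are prescribed only up to a submodule
  of \<open>Y\<close>.  Once values are chosen at the elements of a dual basis, the coordinate functions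
  extend them linearly, and the result is compatible with \<open>W\<close> because \<open>W\<close> is a submodule of
  \<open>X \<times> Y\<close>.\<close>

lemma projective_lift:
  assumes "subring R" "projective R X" "submod R Y"
    and W0: "W 0 0"
    and Wadd: "\<And>x x' y y'. x \<in> X \<Longrightarrow> x' \<in> X \<Longrightarrow> y \<in> Y \<Longrightarrow> y' \<in> Y \<Longrightarrow> W x y \<Longrightarrow> W x' y' \<Longrightarrow> W (x + x') (y + y')"
    and Wact: "\<And>a x y. a \<in> R \<Longrightarrow> x \<in> X \<Longrightarrow> y \<in> Y \<Longrightarrow> W x y \<Longrightarrow> W (a \<cdot> x) (a \<cdot> y)"
    and ex: "\<And>x. x \<in> X \<Longrightarrow> \<exists>y\<in>Y. W x y"
  obtains f where "linear_on R X f" "f ` X \<subseteq> Y" "\<And>x. x \<in> X \<Longrightarrow> W x (f x)"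
proof -
  obtain I :: "nat set" and b \<phi> where X: "submod R X" and I: "dual_basis R X I b \<phi>"
    using assms(2) unfolding projective_def by blast
  note finI = dual_basisD(1)[OF I] and b = dual_basisD(2)[OF I] and \<phi> = dual_basisD(3)[OF I]
    and \<phi>_add = dual_basisD(4)[OF I] and \<phi>_act = dual_basisD(5)[OF I] and expand = dual_basisD(6)[OF I]
  have "\<forall>l\<in>I. \<exists>y. y \<in> Y \<and> W (b l) y" using ex b by blast
  then obtain c where c: "\<And>l. l \<in> I \<Longrightarrow> c l \<in> Y" "\<And>l. l \<in> I \<Longrightarrow> W (b l) (c l)"
    by (metis bchoice)
  define f where "f = (\<lambda>x. \<Sum>l\<in>I. \<phi> l x \<cdot> c l)"
  have fY: "f x \<in> Y" if "x \<in> X" for x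
    unfolding f_def using that c \<phi> by (intro submod_sum[OF assms(3)]) (auto intro: submodD[OF assms(3)])
  have "linear_on R X f"
    unfolding linear_on_def
  proof (intro conjI ballI)
    fix x y assume "x \<in> X" "y \<in> X"
    then show "f (x + y) = f x + f y"
      by (simp add: f_def \<phi>_add act_add_left sum.distrib)
  next
    fix a x assume a: "a \<in> R" "x \<in> X"
    have "f (a \<cdot> x) = (\<Sum>l\<in>I. a \<cdot> \<phi> l x \<cdot> c l)"
      unfolding f_def using a c \<phi> subringD(1)[OF assms(1)] submodD(1)[OF assms(3)]
      by (intro sum.cong) (auto simp: \<phi>_act act_act subset_iff)
    then show "f (a \<cdot> x) = a \<cdot> f x" by (simp add: f_def act_sum_right)
  qed
  moreover have "W x (f x)" if x: "x \<in> X" for x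
  proof -
    have "W (\<Sum>l\<in>J. \<phi> l x \<cdot> b l) (\<Sum>l\<in>J. \<phi> l x \<cdot> c l) \<and>
        (\<Sum>l\<in>J. \<phi> l x \<cdot> b l) \<in> X \<and> (\<Sum>l\<in>J. \<phi> l x \<cdot> c l) \<in> Y"
      if "finite J" "J \<subseteq> I" for J
      using that
    proof (induction rule: finite_induct)
      case empty
      then show ?case using W0 submodD(2)[OF X] submodD(2)[OF assms(3)] by simp
    next
      case (insert l J)
      then have l: "l \<in> I" by auto
      have "\<phi> l x \<cdot> b l \<in> X" "\<phi> l x \<cdot> c l \<in> Y"
        using l x b c \<phi> submodD(4)[OF X] submodD(4)[OF assms(3)] by auto
      moreover have "W (\<phi> l x \<cdot> b l) (\<phi> l x \<cdot> c l)"
        using l x b c \<phi> by (intro Wact) auto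
      ultimately show ?case
        using insert submodD(3)[OF X] submodD(3)[OF assms(3)] by (auto intro!: Wadd)
    qed
    from this[OF finI order_refl] show ?thesis
      using expand[OF x] by (simp add: f_def)
  qed
  ultimately show ?thesis using fY that by blast
qed

text \<open>Generation is expressed through submodules instead of linear combinations, so that images, sums
  and bounds on generators can be handled by exhibiting a suitable submodule.\<close>

definition fin_gen :: "'r set \<Rightarrow> (nat \<Rightarrow> 'r) set \<Rightarrow> bool"
  where "fin_gen R X \<longleftrightarrow> (\<exists>B. finite B \<and> B \<subseteq> X \<and> (\<forall>Y. submod R Y \<and> B \<subseteq> Y \<longrightarrow> X \<subseteq> Y))"

lemma fin_genE:
  assumes "fin_gen R X"
  obtains B where "finite B" "B \<subseteq> X" "\<forall>Y. submod R Y \<longrightarrow> B \<subseteq> Y \<longrightarrow> X \<subseteq> Y"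
proof -
  from assms obtain B where "finite B" "B \<subseteq> X" "\<forall>Y. submod R Y \<and> B \<subseteq> Y \<longrightarrow> X \<subseteq> Y"
    unfolding fin_gen_def by (elim conjE exE)
  then show ?thesis by (intro that[of B]) auto
qed

lemma projective_fin_gen:
  assumes "projective R X" shows "fin_gen R X"
proof -
  obtain I :: "nat set" and b \<phi> where X: "submod R X" and I: "dual_basis R X I b \<phi>"
    using assms unfolding projective_def by blast
  note finI = dual_basisD(1)[OF I] and b = dual_basisD(2)[OF I] and \<phi> = dual_basisD(3)[OF I]
    and \<phi>_add = dual_basisD(4)[OF I] and \<phi>_act = dual_basisD(5)[OF I] and expand = dual_basisD(6)[OF I]
  have "X \<subseteq> Y" if "submod R Y" "b ` I \<subseteq> Y" for Y
  proof
    fix x assume "x \<in> X"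
    moreover have "(\<Sum>l\<in>I. \<phi> l x \<cdot> b l) \<in> Y"
      using that \<phi> \<open>x \<in> X\<close> by (intro submod_sum[OF that(1)] submodD(4)[OF that(1)]) auto
    ultimately show "x \<in> Y" using expand by simp
  qed
  then show ?thesis unfolding fin_gen_def using b finI by (intro exI[of _ "b ` I"]) auto
qed

lemma fin_gen_image:
  assumes "fin_gen R X" "submod R X" "linear_on R X f" "f ` X \<subseteq> vec"
  shows "fin_gen R (f ` X)"
proof -
  obtain B where B: "finite B" "B \<subseteq> X" "\<forall>Y. submod R Y \<longrightarrow> B \<subseteq> Y \<longrightarrow> X \<subseteq> Y"
    by (rule fin_genE[OF assms(1)])
  have "f ` X \<subseteq> Y" if "submod R Y" "f ` B \<subseteq> Y" for Y
    using B(3)[rule_format, OF submod_preimage[OF assms(3,2) that(1)]] that B(2) by blast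
  then show ?thesis unfolding fin_gen_def using B by (intro exI[of _ "f ` B"]) auto
qed

lemma fin_gen_sum:
  assumes "fin_gen R X" "fin_gen R Y" "submod R X" "submod R Y"
  shows "fin_gen R {x + y |x y. x \<in> X \<and> y \<in> Y}"
proof -
  obtain B where B: "finite B" "B \<subseteq> X" "\<forall>Z. submod R Z \<longrightarrow> B \<subseteq> Z \<longrightarrow> X \<subseteq> Z"
    by (rule fin_genE[OF assms(1)])
  obtain C where C: "finite C" "C \<subseteq> Y" "\<forall>Z. submod R Z \<longrightarrow> C \<subseteq> Z \<longrightarrow> Y \<subseteq> Z"
    by (rule fin_genE[OF assms(2)])
  have "B \<union> C \<subseteq> {x + y |x y. x \<in> X \<and> y \<in> Y}"
  proof
    fix z assume "z \<in> B \<union> C"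
    then have "z = z + 0 \<and> z \<in> X \<or> z = 0 + z \<and> z \<in> Y" using B C by auto
    then show "z \<in> {x + y |x y. x \<in> X \<and> y \<in> Y}"
      using submodD(2)[OF assms(3)] submodD(2)[OF assms(4)] by blast
  qed
  moreover have "{x + y |x y. x \<in> X \<and> y \<in> Y} \<subseteq> Z" if "submod R Z" "B \<union> C \<subseteq> Z" for Z
    using B(3)[rule_format, OF that(1)] C(3)[rule_format, OF that(1)] that by (auto intro!: submodD(3)[OF that(1)])
  ultimately show ?thesis unfolding fin_gen_def using B C by (intro exI[of _ "B \<union> C"]) auto
qed

text \<open>Each of the finitely many generators is mapped into some member of the decreasing filtration, and
  the smallest of their indices serves for all of them.\<close>

lemma fin_gen_linear_bounded:
  fixes Fil :: "real \<Rightarrow> (nat \<Rightarrow> 'r) set"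
  assumes "fin_gen R X" "submod R X" "linear_on R X f"
    and Fil: "\<And>r. submod R (Fil r)" "\<And>r s. r \<le> s \<Longrightarrow> Fil s \<subseteq> Fil r"
    and "f ` X \<subseteq> (\<Union>r. Fil r)"
  obtains c where "f ` X \<subseteq> Fil c"
proof -
  obtain B where B: "finite B" "B \<subseteq> X" "\<forall>Z. submod R Z \<longrightarrow> B \<subseteq> Z \<longrightarrow> X \<subseteq> Z"
    by (rule fin_genE[OF assms(1)])
  have "\<exists>c. f ` B' \<subseteq> Fil c" if "finite B'" "B' \<subseteq> B" for B'
    using that
  proof (induction rule: finite_induct)
    case (insert b B')
    then obtain c where c: "f ` B' \<subseteq> Fil c" by auto
    have "f b \<in> (\<Union>r. Fil r)" using insert.prems assms(6) B(2) by blast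
    then obtain r where "f b \<in> Fil r" by auto
    then have "f ` insert b B' \<subseteq> Fil (min r c)"
      using c Fil(2)[of "min r c" r] Fil(2)[of "min r c" c] by auto
    then show ?case ..
  qed simp
  then obtain c where "f ` B \<subseteq> Fil c" using B by blast
  then have "B \<subseteq> {x \<in> X. f x \<in> Fil c}" using B by auto
  then have "X \<subseteq> {x \<in> X. f x \<in> Fil c}"
    using submod_preimage[OF assms(3,2) Fil(1)] by (intro B(3)[rule_format])
  then show ?thesis using that by auto
qed

definition free_mod :: "'r set \<Rightarrow> nat \<Rightarrow> (nat \<Rightarrow> 'r) set"
  where "free_mod R m = {f. (\<forall>i<m. f i \<in> R) \<and> (\<forall>i\<ge>m. f i = 0)}"

lemma submod_free_mod: "subring R \<Longrightarrow> submod R (free_mod R m)"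
  unfolding submod_def free_mod_def vec_def act_def
  using subringD[of R] L_zero by (auto simp: pointwise subset_iff not_le) (metis not_le)

lemma sum_fun_apply: "(sum f I) i = (\<Sum>j\<in>I. f j i)" for f :: "'i \<Rightarrow> 'j \<Rightarrow> 'r"
  by (induction I rule: infinite_finite_induct) (auto simp: pointwise)

lemma projective_free_mod:
  assumes "subring R" shows "projective R (free_mod R m)"
proof (rule projectiveI[OF submod_free_mod[OF assms]])
  have "x = (\<Sum>l<m. x l \<cdot> (\<lambda>i. if i = l then one else 0))" if x: "x \<in> free_mod R m" for x
  proof
    fix i
    have "(\<Sum>l<m. x l \<cdot> (\<lambda>i. if i = l then one else 0)) i = (\<Sum>l<m. if i = l then mul (x l) one else 0)"
      unfolding sum_fun_apply by (intro sum.cong) (auto simp: act_def)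
    also have "\<dots> = (if i < m then mul (x i) one else 0)" by (simp add: sum.delta)
    also have "\<dots> = x i"
      using x subringD(1)[OF assms] by (auto simp: free_mod_def mul_one_right)
    finally show "x i = (\<Sum>l<m. x l \<cdot> (\<lambda>i. if i = l then one else 0)) i" by simp
  qed
  then show "dual_basis R (free_mod R m) {..<m} (\<lambda>l i. if i = l then one else 0) (\<lambda>l x. x l)"
    using subringD[OF assms] by (auto simp: dual_basis_def free_mod_def act_def pointwise)
qed

lemma fin_gen_presented:
  assumes R: "subring R" and X: "submod R X" "fin_gen R X"
  obtains m f where "linear_on R (free_mod R m) f" "f ` free_mod R m = X"
proof -
  obtain B where B: "finite B" "B \<subseteq> X" "\<forall>Z. submod R Z \<longrightarrow> B \<subseteq> Z \<longrightarrow> X \<subseteq> Z"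
    by (rule fin_genE[OF X(2)])
  obtain h where h: "bij_betw h {..<card B} B"
    using ex_bij_betw_nat_finite[OF B(1)] by (auto simp: lessThan_atLeast0)
  have hX: "h l \<in> X" if "l < card B" for l
    using h that B by (auto simp: bij_betw_def)
  define f where "f = (\<lambda>x. \<Sum>l<card B. x l \<cdot> h l)"
  have FX: "f x \<in> X" if "x \<in> free_mod R (card B)" for x
    unfolding f_def using that hX by (intro submod_sum[OF X(1)] submodD(4)[OF X(1)]) (auto simp: free_mod_def)
  have lin: "linear_on R (free_mod R (card B)) f"
    unfolding linear_on_def
  proof (intro conjI ballI)
    fix x y show "f (x + y) = f x + f y"
      by (simp add: f_def act_add_left sum.distrib pointwise)
  next
    fix a x assume a: "a \<in> R" "x \<in> free_mod R (card B)"
    have "f (a \<cdot> x) = (\<Sum>l<card B. a \<cdot> x l \<cdot> h l)"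
      unfolding f_def act_def[of a x]
      using a hX subringD(1)[OF R] submodD(1)[OF X(1)]
      by (intro sum.cong) (auto simp: act_act subset_iff free_mod_def)
    then show "f (a \<cdot> x) = a \<cdot> f x" by (simp add: f_def act_sum_right)
  qed
  have "B \<subseteq> f ` free_mod R (card B)"
  proof
    fix b assume "b \<in> B"
    then obtain l where l: "l < card B" "b = h l" using h by (auto simp: bij_betw_def)
    define e where "e = (\<lambda>i. if i = l then one else 0)"
    have "e \<in> free_mod R (card B)"
      using l subringD[OF R] by (auto simp: e_def free_mod_def)
    moreover have "f e = (\<Sum>j<card B. if j = l then one \<cdot> h l else 0)"
      unfolding f_def e_def by (intro sum.cong) auto
    then have "f e = h l"
      using l hX[OF l(1)] submodD(1)[OF X(1)] by (auto simp: sum.delta)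
    ultimately show "b \<in> f ` free_mod R (card B)" using l by force
  qed
  then have "X \<subseteq> f ` free_mod R (card B)"
    using FX submodD(1)[OF X(1)]
    by (intro B(3)[rule_format] submod_image[OF lin submod_free_mod[OF R]]) auto
  then show ?thesis using that[OF lin] FX by blast
qed

end

section \<open>Comparison of complexes\<close>

context coefficient_ring
begin

text \<open>The differential \<open>D i\<close> goes from degree \<open>i + 1\<close> to degree \<open>i\<close>.  The set \<open>Z\<close> of cycles of degree \<open>0\<close> is
  prescribed: it plays the role of the kernel of an augmentation, so that the augmented module is
  \<open>X 0\<close> modulo \<open>Z\<close> and does not have to be represented by vectors.\<close>

definition cycles :: "(nat \<Rightarrow> (nat \<Rightarrow> 'r) set) \<Rightarrow> (nat \<Rightarrow> (nat \<Rightarrow> 'r) \<Rightarrow> nat \<Rightarrow> 'r) \<Rightarrow>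
    (nat \<Rightarrow> 'r) set \<Rightarrow> nat \<Rightarrow> (nat \<Rightarrow> 'r) set"
  where "cycles X D Z i = (case i of 0 \<Rightarrow> Z | Suc j \<Rightarrow> {x \<in> X (Suc j). D j x = 0})"

definition complex :: "'r set \<Rightarrow> nat \<Rightarrow> (nat \<Rightarrow> (nat \<Rightarrow> 'r) set) \<Rightarrow>
    (nat \<Rightarrow> (nat \<Rightarrow> 'r) \<Rightarrow> nat \<Rightarrow> 'r) \<Rightarrow> (nat \<Rightarrow> 'r) set \<Rightarrow> bool"
  where "complex R n X D Z \<longleftrightarrow> (\<forall>i\<le>n. submod R (X i)) \<and> submod R Z \<and> Z \<subseteq> X 0 \<and>
     (\<forall>i<n. linear_on R (X (Suc i)) (D i) \<and> D i ` X (Suc i) \<subseteq> cycles X D Z i)"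

definition exact :: "nat \<Rightarrow> (nat \<Rightarrow> (nat \<Rightarrow> 'r) set) \<Rightarrow>
    (nat \<Rightarrow> (nat \<Rightarrow> 'r) \<Rightarrow> nat \<Rightarrow> 'r) \<Rightarrow> (nat \<Rightarrow> 'r) set \<Rightarrow> bool"
  where "exact n X D Z \<longleftrightarrow> (\<forall>i<n. cycles X D Z i \<subseteq> D i ` X (Suc i))"

definition chain_map :: "'r set \<Rightarrow> nat \<Rightarrow> (nat \<Rightarrow> (nat \<Rightarrow> 'r) set) \<Rightarrow>
    (nat \<Rightarrow> (nat \<Rightarrow> 'r) \<Rightarrow> nat \<Rightarrow> 'r) \<Rightarrow> (nat \<Rightarrow> 'r) set \<Rightarrow> (nat \<Rightarrow> (nat \<Rightarrow> 'r) set) \<Rightarrow>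
    (nat \<Rightarrow> (nat \<Rightarrow> 'r) \<Rightarrow> nat \<Rightarrow> 'r) \<Rightarrow> (nat \<Rightarrow> 'r) set \<Rightarrow> (nat \<Rightarrow> (nat \<Rightarrow> 'r) \<Rightarrow> nat \<Rightarrow> 'r) \<Rightarrow> bool"
  where "chain_map R n S E ZS X D Z f \<longleftrightarrow>
     (\<forall>i\<le>n. linear_on R (S i) (f i) \<and> f i ` S i \<subseteq> X i) \<and> f 0 ` ZS \<subseteq> Z \<and>
     (\<forall>i<n. \<forall>x\<in>S (Suc i). D i (f (Suc i) x) = f i (E i x))"

lemma cycles_0 [simp]: "cycles X D Z 0 = Z"
  by (simp add: cycles_def)

lemma cycles_Suc [simp]: "cycles X D Z (Suc j) = {x \<in> X (Suc j). D j x = 0}"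
  by (simp add: cycles_def)

lemma complexD:
  assumes "complex R n X D Z"
  shows "i \<le> n \<Longrightarrow> submod R (X i)" "submod R Z" "Z \<subseteq> X 0" "i < n \<Longrightarrow> linear_on R (X (Suc i)) (D i)"
    "i < n \<Longrightarrow> x \<in> X (Suc i) \<Longrightarrow> D i x \<in> cycles X D Z i"
  using assms unfolding complex_def by blast+

lemma cycles_subset: "complex R n X D Z \<Longrightarrow> cycles X D Z i \<subseteq> X i"
  by (cases i) (auto dest: complexD(3))

lemma complex_mono: "complex R n X D Z \<Longrightarrow> m \<le> n \<Longrightarrow> complex R m X D Z"
  unfolding complex_def by auto

lemma submod_cycles:
  assumes "complex R n X D Z" "i \<le> n" shows "submod R (cycles X D Z i)"
proof (cases i)
  case (Suc j)
  then have "linear_on R (X (Suc j)) (D j)" "submod R (X (Suc j))"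
    using complexD(4)[OF assms(1), of j] complexD(1)[OF assms(1), of i] assms(2) by auto
  then show ?thesis using submod_kernel Suc by simp
qed (use complexD(2)[OF assms(1)] in simp)

lemma boundary_mem:
  assumes "complex R n X D Z" "i < n" "x \<in> X (Suc i)" shows "D i x \<in> X i"
  using complexD(5)[OF assms] cycles_subset[OF assms(1)] by blast

lemma chain_mapD:
  assumes "chain_map R n S E ZS X D Z f"
  shows "i \<le> n \<Longrightarrow> linear_on R (S i) (f i)" "i \<le> n \<Longrightarrow> x \<in> S i \<Longrightarrow> f i x \<in> X i"
    "x \<in> ZS \<Longrightarrow> f 0 x \<in> Z" "i < n \<Longrightarrow> x \<in> S (Suc i) \<Longrightarrow> D i (f (Suc i) x) = f i (E i x)"
  using assms unfolding chain_map_def by blast+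

lemma chain_map_cycles:
  assumes "complex R n S E ZS" "chain_map R n S E ZS X D Z f" "i \<le> n" "x \<in> cycles S E ZS i"
  shows "f i x \<in> cycles X D Z i"
proof (cases i)
  case 0
  then show ?thesis using chain_mapD(3)[OF assms(2)] assms(4) by simp
next
  case (Suc j)
  then have x: "x \<in> S (Suc j)" "E j x = 0" and j: "j < n" using assms by auto
  have "D j (f (Suc j) x) = f j 0"
    using chain_mapD(4)[OF assms(2) j x(1)] x(2) by simp
  also have "\<dots> = 0"
    using linear_zero[OF chain_mapD(1)[OF assms(2)] complexD(1)[OF assms(1)], of j] j by simp
  finally show ?thesis
    using Suc chain_mapD(2)[OF assms(2), of "Suc j" x] x(1) j by simp
qed

lemma projective_lift_linear:
  assumes "subring R" "projective R X" "submod R X" "submod R M" "submod R Y" "Y \<subseteq> M" "linear_on R M D"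
    "linear_on R X u" "u ` X \<subseteq> D ` Y"
  obtains f where "linear_on R X f" "f ` X \<subseteq> Y" "\<And>x. x \<in> X \<Longrightarrow> D (f x) = u x"
proof (rule projective_lift[OF assms(1,2,5), of "\<lambda>x y. D y = u x"])
  show "D 0 = u 0"
    using linear_zero[OF assms(7,4)] linear_zero[OF assms(8,3)] by simp
  fix x assume "x \<in> X"
  then show "\<exists>y\<in>Y. D y = u x" using assms(9) by (metis imageE image_subset_iff)
next
  fix x x' y y' assume *: "x \<in> X" "x' \<in> X" "y \<in> Y" "y' \<in> Y" "D y = u x" "D y' = u x'"
  have "D (y + y') = D y + D y'" using assms(6,7) * unfolding linear_on_def by blast
  moreover have "u (x + x') = u x + u x'" using assms(8) * unfolding linear_on_def by blast
  ultimately show "D (y + y') = u (x + x')" using * by simp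
next
  fix a x y assume *: "a \<in> R" "x \<in> X" "y \<in> Y" "D y = u x"
  have "D (a \<cdot> y) = a \<cdot> D y" using assms(6,7) * unfolding linear_on_def by blast
  moreover have "u (a \<cdot> x) = a \<cdot> u x" using assms(8) * unfolding linear_on_def by blast
  ultimately show "D (a \<cdot> y) = u (a \<cdot> x)" using * by simp
qed (use that in auto)

text \<open>The comparison theorem with control of the values.  The \<open>Y i\<close> are not assumed to form a subcomplex:
  a cycle in \<open>Y i\<close> is a boundary of an element of \<open>Y (i + 1)\<close>, which is what the construction of
  a lift degree by degree uses.  With \<open>Y i\<close> a level of a filtration that drops as \<open>i\<close> grows, the
  chain map stays as deep in the filtration as desired.\<close>

lemma chain_map_exists:
  assumes R: "subring R"
    and S: "complex R n S E ZS" "\<And>i. i \<le> n \<Longrightarrow> projective R (S i)"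
    and X: "complex R n X D Z"
    and Y: "\<And>i. i \<le> n \<Longrightarrow> submod R (Y i)" "\<And>i. i \<le> n \<Longrightarrow> Y i \<subseteq> X i"
      "\<And>i. i < n \<Longrightarrow> cycles X D Z i \<inter> Y i \<subseteq> D i ` Y (Suc i)"
    and u: "linear_on R (S 0) u" "u ` S 0 \<subseteq> Y 0" "u ` ZS \<subseteq> Z"
  obtains f where "f 0 = u" "chain_map R n S E ZS X D Z f" "\<forall>i\<le>n. f i ` S i \<subseteq> Y i"
proof -
  have "\<exists>f. f 0 = u \<and> chain_map R k S E ZS X D Z f \<and> (\<forall>i\<le>k. f i ` S i \<subseteq> Y i)" if "k \<le> n" for k
    using that
  proof (induction k)
    case 0
    have "u ` S 0 \<subseteq> X 0" using u(2) Y(2)[of 0] by auto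
    then show ?case using u by (intro exI[of _ "\<lambda>_. u"]) (auto simp: chain_map_def)
  next
    case (Suc k)
    then obtain f where f: "f 0 = u" "chain_map R k S E ZS X D Z f" "\<forall>i\<le>k. f i ` S i \<subseteq> Y i" by auto
    have k: "k < n" "Suc k \<le> n" "k \<le> n" using Suc by auto
    have Sk: "complex R k S E ZS" using complex_mono[OF S(1) k(3)] .
    have "(\<lambda>x. f k (E k x)) ` S (Suc k) \<subseteq> D k ` Y (Suc k)"
    proof
      fix y assume "y \<in> (\<lambda>x. f k (E k x)) ` S (Suc k)"
      then obtain x where x: "x \<in> S (Suc k)" "y = f k (E k x)" by auto
      have "E k x \<in> cycles S E ZS k" using complexD(5)[OF S(1) k(1) x(1)] .
      then have "y \<in> cycles X D Z k"
        using chain_map_cycles[OF Sk f(2), of k "E k x"] x(2) by simp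
      moreover have "y \<in> Y k"
        using f(3) boundary_mem[OF S(1) k(1) x(1)] x(2) by auto
      ultimately show "y \<in> D k ` Y (Suc k)" using Y(3)[OF k(1)] by auto
    qed
    moreover have "linear_on R (S (Suc k)) (\<lambda>x. f k (E k x))"
      using linear_compose[OF complexD(4)[OF S(1) k(1)] chain_mapD(1)[OF f(2)]] boundary_mem[OF S(1) k(1)]
      by auto
    ultimately obtain g where g: "linear_on R (S (Suc k)) g" "g ` S (Suc k) \<subseteq> Y (Suc k)"
        "\<And>x. x \<in> S (Suc k) \<Longrightarrow> D k (g x) = f k (E k x)"
      using projective_lift_linear[OF R S(2)[OF k(2)] complexD(1)[OF S(1) k(2)] complexD(1)[OF X k(2)]
          Y(1)[OF k(2)] Y(2)[OF k(2)] complexD(4)[OF X k(1)]] by blast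
    have "g ` S (Suc k) \<subseteq> X (Suc k)" using g(2) Y(2)[OF k(2)] by auto
    then have "chain_map R (Suc k) S E ZS X D Z (f(Suc k := g))"
      using f(2) g by (auto simp: chain_map_def le_Suc_eq less_Suc_eq)
    moreover have "\<forall>i\<le>Suc k. (f(Suc k := g)) i ` S i \<subseteq> Y i"
      using f(3) g(2) by (auto simp: le_Suc_eq)
    moreover have "(f(Suc k := g)) 0 = u" using f(1) by simp
    ultimately show ?case by blast
  qed
  then show ?thesis using that by blast
qed

text \<open>The hypothesis on \<open>h 0\<close> says that \<open>h\<close> induces zero on the augmented modules, so that \<open>h\<close> is
  null-homotopic through degree \<open>k - 1\<close>.  If \<open>s\<close> is the part of the homotopy in degree \<open>k - 1\<close>, then
  \<open>\<theta> = h k - s \<circ> E\<close> takes values in cycles, and \<open>s \<circ> E\<close> vanishes on cycles.\<close>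

lemma chain_map_homotopic_to_cycles:
  assumes R: "subring R"
    and S: "complex R n S E ZS" "\<And>i. i \<le> n \<Longrightarrow> projective R (S i)"
    and X: "complex R n X D Z" "exact n X D Z"
    and h: "chain_map R n S E ZS X D Z h" "h 0 ` S 0 \<subseteq> Z"
    and "k \<le> n"
  obtains \<theta> where "linear_on R (S k) \<theta>" "\<theta> ` S k \<subseteq> cycles X D Z k"
    "\<forall>z\<in>cycles S E ZS k. \<theta> z = h k z"
proof -
  have "\<exists>\<theta>. linear_on R (S k) \<theta> \<and> \<theta> ` S k \<subseteq> cycles X D Z k \<and> (\<forall>z\<in>cycles S E ZS k. \<theta> z = h k z)"
    using \<open>k \<le> n\<close>
  proof (induction k)
    case 0
    show ?case using h chain_mapD(1)[OF h(1), of 0] by (intro exI[of _ "h 0"]) auto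
  next
    case (Suc k)
    then obtain \<theta> where \<theta>: "linear_on R (S k) \<theta>" "\<theta> ` S k \<subseteq> cycles X D Z k"
      "\<forall>z\<in>cycles S E ZS k. \<theta> z = h k z" by auto
    have k: "k < n" "Suc k \<le> n" "k \<le> n" using Suc by auto
    have "\<theta> ` S k \<subseteq> D k ` X (Suc k)" using \<theta>(2) X(2) k(1) unfolding exact_def by blast
    then obtain s where s: "linear_on R (S k) s" "s ` S k \<subseteq> X (Suc k)" "\<And>x. x \<in> S k \<Longrightarrow> D k (s x) = \<theta> x"
      using projective_lift_linear[OF R S(2)[OF k(3)] complexD(1)[OF S(1) k(3)] complexD(1)[OF X(1) k(2)]
          complexD(1)[OF X(1) k(2)] subset_refl complexD(4)[OF X(1) k(1)] \<theta>(1)] by metis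
    define \<theta>' where "\<theta>' = (\<lambda>x. h (Suc k) x - s (E k x))"
    have E: "E k x \<in> S k" if "x \<in> S (Suc k)" for x using boundary_mem[OF S(1) k(1) that] .
    have "linear_on R (S (Suc k)) \<theta>'"
      unfolding \<theta>'_def using E
      by (intro linear_minus chain_mapD(1)[OF h(1) k(2)] linear_compose[OF complexD(4)[OF S(1) k(1)] s(1)]) auto
    moreover have "\<theta>' x \<in> cycles X D Z (Suc k)" if x: "x \<in> S (Suc k)" for x
    proof -
      have hx: "h (Suc k) x \<in> X (Suc k)" using chain_mapD(2)[OF h(1) k(2) x] .
      have sx: "s (E k x) \<in> X (Suc k)" using s(2) E[OF x] by auto
      have "D k (\<theta>' x) = D k (h (Suc k) x) - D k (s (E k x))"
        unfolding \<theta>'_def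
        by (rule linear_diff[OF R complexD(4)[OF X(1) k(1)] complexD(1)[OF X(1) k(2)] hx sx])
      also have "\<dots> = h k (E k x) - \<theta> (E k x)"
        using chain_mapD(4)[OF h(1) k(1) x] s(3)[OF E[OF x]] by simp
      also have "\<dots> = 0" using \<theta>(3) complexD(5)[OF S(1) k(1) x] by simp
      finally show ?thesis
        using submod_diff[OF R complexD(1)[OF X(1) k(2)] hx sx] by (simp add: \<theta>'_def)
    qed
    moreover have "\<theta>' z = h (Suc k) z" if "z \<in> cycles S E ZS (Suc k)" for z
      using that linear_zero[OF s(1) complexD(1)[OF S(1) k(3)]] by (simp add: \<theta>'_def)
    ultimately show ?case by blast
  qed
  then show ?thesis using that by blast
qed

text \<open>A resolution of \<open>F0 / Z\<close> by free modules of rank \<open>p i\<close>, exact in degrees below \<open>n\<close>.  The augmentation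
  is represented by a lift \<open>\<pi>\<close> to \<open>F0\<close>, which exists because the module in degree \<open>0\<close> is free.\<close>

definition resolves :: "'r set \<Rightarrow> nat \<Rightarrow> (nat \<Rightarrow> 'r) set \<Rightarrow> (nat \<Rightarrow> 'r) set \<Rightarrow> (nat \<Rightarrow> nat) \<Rightarrow>
    (nat \<Rightarrow> (nat \<Rightarrow> 'r) \<Rightarrow> nat \<Rightarrow> 'r) \<Rightarrow> ((nat \<Rightarrow> 'r) \<Rightarrow> nat \<Rightarrow> 'r) \<Rightarrow> bool"
  where "resolves R n F0 Z p D \<pi> \<longleftrightarrow>
     linear_on R (free_mod R (p 0)) \<pi> \<and> \<pi> ` free_mod R (p 0) \<subseteq> F0 \<and>
     (\<forall>x\<in>F0. \<exists>y\<in>free_mod R (p 0). \<pi> y - x \<in> Z) \<and>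
     complex R n (\<lambda>i. free_mod R (p i)) D {y \<in> free_mod R (p 0). \<pi> y \<in> Z} \<and>
     exact n (\<lambda>i. free_mod R (p i)) D {y \<in> free_mod R (p 0). \<pi> y \<in> Z}"

lemma resolvesD:
  assumes "resolves R n F0 Z p D \<pi>"
  shows "linear_on R (free_mod R (p 0)) \<pi>" "\<pi> ` free_mod R (p 0) \<subseteq> F0"
     "\<forall>x\<in>F0. \<exists>y\<in>free_mod R (p 0). \<pi> y - x \<in> Z"
     "complex R n (\<lambda>i. free_mod R (p i)) D {y \<in> free_mod R (p 0). \<pi> y \<in> Z}"
     "exact n (\<lambda>i. free_mod R (p i)) D {y \<in> free_mod R (p 0). \<pi> y \<in> Z}"
  using assms unfolding resolves_def by blast+

end

section \<open>Finiteness by essential acyclicity of a filtration\<close>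

text \<open>
  In the application, \<open>F\<close> is a complex of finitely generated free modules over a large ring, regarded
  over a smaller ring \<open>R\<close>, over which it is far from finitely generated.  It is exhausted by
  a decreasing filtration and contains a subcomplex \<open>F'\<close> of finitely generated projective
  \<open>R\<close>-modules which contains some level of the filtration.
\<close>

locale filtered_resolution = coefficient_ring +
  fixes R and n :: nat and F dd Z and Fil :: "nat \<Rightarrow> real \<Rightarrow> (nat \<Rightarrow> 'a) set" and F'
  assumes subring: "subring R"
    and F: "complex R n F dd Z" "exact n F dd Z"
    and Fil: "i \<le> n \<Longrightarrow> submod R (Fil i r)" "i \<le> n \<Longrightarrow> Fil i r \<subseteq> F i" "r \<le> s \<Longrightarrow> Fil i s \<subseteq> Fil i r"
      "i \<le> n \<Longrightarrow> F i \<subseteq> (\<Union>r. Fil i r)"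
    and F': "i \<le> n \<Longrightarrow> projective R (F' i)" "i \<le> n \<Longrightarrow> F' i \<subseteq> F i" "i < n \<Longrightarrow> dd i ` F' (Suc i) \<subseteq> F' i"
      "\<exists>c. \<forall>i\<le>n. Fil i c \<subseteq> F' i"
begin

text \<open>The first condition is the one in the degree of the augmented module: each of its elements has
  representatives in every level.\<close>

definition essentially_acyclic :: bool
  where "essentially_acyclic \<longleftrightarrow> (\<exists>c\<ge>0. (\<forall>r. \<forall>x\<in>F 0. \<exists>y\<in>Fil 0 r. y - x \<in> Z) \<and>
    (\<forall>i<n. \<forall>r. cycles F dd Z i \<inter> Fil i r \<subseteq> dd i ` Fil (Suc i) (r - c)))"

lemma submod_F': "i \<le> n \<Longrightarrow> submod R (F' i)"
  using F'(1) unfolding projective_def by blast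

lemma complex_F': "complex R n F' dd (Z \<inter> F' 0)"
proof -
  have "dd i ` F' (Suc i) \<subseteq> cycles F' dd (Z \<inter> F' 0) i" if i: "i < n" for i
  proof
    fix y assume "y \<in> dd i ` F' (Suc i)"
    then obtain x where x: "x \<in> F' (Suc i)" "y = dd i x" by auto
    have "y \<in> cycles F dd Z i" using complexD(5)[OF F(1) i, of x] x F'(2)[of "Suc i"] i by auto
    moreover have "y \<in> F' i" using F'(3)[OF i] x by auto
    ultimately show "y \<in> cycles F' dd (Z \<inter> F' 0) i" by (cases i) auto
  qed
  moreover have "linear_on R (F' (Suc i)) (dd i)" if "i < n" for i
    using linear_subring[OF complexD(4)[OF F(1) that] subset_refl F'(2)[of "Suc i"]] that by auto
  ultimately show ?thesis
    unfolding complex_def using submod_F' submod_Int[OF complexD(2)[OF F(1)] submod_F'[of 0]] by auto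
qed

lemma cycles_F': "i \<le> n \<Longrightarrow> cycles F' dd (Z \<inter> F' 0) i = cycles F dd Z i \<inter> F' i"
  using F'(2) by (cases i) auto

text \<open>The identity of the augmented module, restricted to the image of \<open>F' 0\<close>, lifts to a
  chain map from \<open>F'\<close> to any resolution.\<close>

lemma lift_to_resolution:
  assumes "resolves R k (F 0) Z p D \<pi>" "k \<le> n"
  obtains g where "chain_map R k F' dd (Z \<inter> F' 0) (\<lambda>i. free_mod R (p i)) D {y \<in> free_mod R (p 0). \<pi> y \<in> Z} g"
    "\<forall>x\<in>F' 0. \<pi> (g 0 x) - x \<in> Z"
proof -
  note P = resolvesD[OF assms(1)]
  have Z: "submod R Z" using complexD(2)[OF F(1)] .
  have add: "\<pi> (x + y) = \<pi> x + \<pi> y" if "x \<in> free_mod R (p 0)" "y \<in> free_mod R (p 0)" for x y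
    using P(1) that unfolding linear_on_def by blast
  have act: "\<pi> (a \<cdot> x) = a \<cdot> \<pi> x" if "a \<in> R" "x \<in> free_mod R (p 0)" for a x
    using P(1) that unfolding linear_on_def by blast
  obtain g0 where g0: "linear_on R (F' 0) g0" "g0 ` F' 0 \<subseteq> free_mod R (p 0)"
    "\<And>x. x \<in> F' 0 \<Longrightarrow> \<pi> (g0 x) - x \<in> Z"
  proof (rule projective_lift[OF subring F'(1)[of 0] submod_free_mod[OF subring, of "p 0"], of "\<lambda>x y. \<pi> y - x \<in> Z"])
    show "\<pi> 0 - 0 \<in> Z"
      using linear_zero[OF P(1) submod_free_mod[OF subring]] submodD(2)[OF Z] by simp
    fix x assume "x \<in> F' 0"
    then show "\<exists>y\<in>free_mod R (p 0). \<pi> y - x \<in> Z" using P(3) F'(2)[of 0] by auto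
  next
    fix x x' y y' assume "y \<in> free_mod R (p 0)" "y' \<in> free_mod R (p 0)" "\<pi> y - x \<in> Z" "\<pi> y' - x' \<in> Z"
    then show "\<pi> (y + y') - (x + x') \<in> Z"
      using submodD(3)[OF Z, of "\<pi> y - x" "\<pi> y' - x'"] by (simp add: add algebra_simps)
  next
    fix a x y assume "a \<in> R" "y \<in> free_mod R (p 0)" "\<pi> y - x \<in> Z"
    then show "\<pi> (a \<cdot> y) - a \<cdot> x \<in> Z"
      using submodD(4)[OF Z, of a "\<pi> y - x"] by (simp add: act act_diff_right)
  qed auto
  have "g0 ` (Z \<inter> F' 0) \<subseteq> {y \<in> free_mod R (p 0). \<pi> y \<in> Z}"
  proof
    fix y assume "y \<in> g0 ` (Z \<inter> F' 0)"
    then obtain x where x: "x \<in> Z" "x \<in> F' 0" "y = g0 x" by auto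
    then have "(\<pi> (g0 x) - x) + x \<in> Z" using g0(3) submodD(3)[OF Z] by blast
    then show "y \<in> {y \<in> free_mod R (p 0). \<pi> y \<in> Z}" using x g0(2) by auto
  qed
  moreover have "projective R (F' i)" if "i \<le> k" for i using F'(1) that assms(2) by auto
  moreover have "cycles (\<lambda>i. free_mod R (p i)) D {y \<in> free_mod R (p 0). \<pi> y \<in> Z} i \<inter> free_mod R (p i)
      \<subseteq> D i ` free_mod R (p (Suc i))" if "i < k" for i
    using P(5) that unfolding exact_def by blast
  ultimately obtain g where "g 0 = g0"
    "chain_map R k F' dd (Z \<inter> F' 0) (\<lambda>i. free_mod R (p i)) D {y \<in> free_mod R (p 0). \<pi> y \<in> Z} g"
    using g0(1,2) submod_free_mod[OF subring]
    by (elim chain_map_exists[OF subring complex_mono[OF complex_F' assms(2)] _ P(4),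
        where Y = "\<lambda>i. free_mod R (p i)" and u = g0]) auto
  then show ?thesis using that g0(3) by blast
qed

text \<open>Let \<open>P\<close> be the given partial resolution.  The identity of the augmented module lifts to chain maps
  \<open>f\<close> from \<open>P\<close> to \<open>F\<close> and \<open>g\<close> from \<open>F'\<close> to \<open>P\<close>, and by essential acyclicity \<open>f\<close> can be chosen with values
  so deep in the filtration that they lie in \<open>F'\<close> and that \<open>f z\<close>, for a \<open>k\<close>-cycle \<open>z\<close>, is the boundary of
  some \<open>x\<close> in \<open>F' (k + 1)\<close>.  Then \<open>z = g (dd x) + (z - g (f z))\<close>, and on cycles
  the chain map \<open>id - g \<circ> f\<close>, which induces zero on the augmented module, agrees with a linear map from
  \<open>P k\<close> to the cycles.  Hence the cycles are the sum of the images of \<open>F' (k + 1)\<close> and of \<open>P k\<close>.\<close>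

theorem resolution_step:
  assumes "essentially_acyclic" "resolves R k (F 0) Z p D \<pi>" "k < n"
  shows "fin_gen R (cycles (\<lambda>i. free_mod R (p i)) D {y \<in> free_mod R (p 0). \<pi> y \<in> Z} k)"
proof -
  let ?P = "\<lambda>i. free_mod R (p i)" and ?ZP = "{y \<in> free_mod R (p 0). \<pi> y \<in> Z}"
  note P = resolvesD[OF assms(2)]
  have Z: "submod R Z" using complexD(2)[OF F(1)] .
  have k: "k \<le> n" "Suc k \<le> n" using assms(3) by auto
  obtain c where c: "c \<ge> 0" "\<And>r x. x \<in> F 0 \<Longrightarrow> \<exists>y\<in>Fil 0 r. y - x \<in> Z"
      "\<And>i r. i < n \<Longrightarrow> cycles F dd Z i \<inter> Fil i r \<subseteq> dd i ` Fil (Suc i) (r - c)"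
    using assms(1) unfolding essentially_acyclic_def by auto
  obtain c' where c': "\<And>i. i \<le> n \<Longrightarrow> Fil i c' \<subseteq> F' i" using F'(4) by auto
  \<comment> \<open>Filling a cycle costs \<open>c\<close> in each degree; the start is so high that level \<open>c'\<close>, which is
    contained in \<open>F'\<close>, is not left up to degree \<open>n\<close>.\<close>
  define Y where "Y = (\<lambda>i. Fil i (c' + real n * c - real i * c))"
  have Y: "submod R (Y i)" "Y i \<subseteq> F i" "Y i \<subseteq> F' i" if "i \<le> n" for i
  proof -
    have "real i * c \<le> real n * c" using that c(1) by (intro mult_right_mono) auto
    then have "Y i \<subseteq> Fil i c'" unfolding Y_def by (intro Fil(3)) auto
    then show "Y i \<subseteq> F' i" using c'[OF that] by auto
  qed (use Fil that in \<open>auto simp: Y_def\<close>)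
  have Y_bound: "cycles F dd Z i \<inter> Y i \<subseteq> dd i ` Y (Suc i)" if "i < n" for i
  proof -
    have "c' + real n * c - real i * c - c = c' + real n * c - real (Suc i) * c"
      by (simp add: algebra_simps)
    then show ?thesis using c(3)[OF that, of "c' + real n * c - real i * c"] unfolding Y_def by metis
  qed
  have add: "\<pi> (x + y) = \<pi> x + \<pi> y" if "x \<in> ?P 0" "y \<in> ?P 0" for x y
    using P(1) that unfolding linear_on_def by blast
  have act: "\<pi> (a \<cdot> x) = a \<cdot> \<pi> x" if "a \<in> R" "x \<in> ?P 0" for a x
    using P(1) that unfolding linear_on_def by blast
  obtain f0 where f0: "linear_on R (?P 0) f0" "f0 ` ?P 0 \<subseteq> Y 0" "\<And>x. x \<in> ?P 0 \<Longrightarrow> f0 x - \<pi> x \<in> Z"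
  proof (rule projective_lift[OF subring projective_free_mod[OF subring, of "p 0"] Y(1)[of 0],
        of "\<lambda>x y. y - \<pi> x \<in> Z"])
    show "0 - \<pi> 0 \<in> Z"
      using linear_zero[OF P(1) submod_free_mod[OF subring]] submodD(2)[OF Z] by simp
    fix x assume "x \<in> ?P 0"
    then have "\<pi> x \<in> F 0" using P(2) by auto
    then show "\<exists>y\<in>Y 0. y - \<pi> x \<in> Z" using c(2) unfolding Y_def by blast
  next
    fix x x' y y' assume "x \<in> ?P 0" "x' \<in> ?P 0" "y - \<pi> x \<in> Z" "y' - \<pi> x' \<in> Z"
    then show "y + y' - \<pi> (x + x') \<in> Z"
      using submodD(3)[OF Z, of "y - \<pi> x" "y' - \<pi> x'"] by (simp add: add algebra_simps)
  next
    fix a x y assume "a \<in> R" "x \<in> ?P 0" "y - \<pi> x \<in> Z"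
    then show "a \<cdot> y - \<pi> (a \<cdot> x) \<in> Z"
      using submodD(4)[OF Z, of a "y - \<pi> x"] by (simp add: act act_diff_right)
  qed auto
  have f0Z: "f0 ` ?ZP \<subseteq> Z"
  proof
    fix y assume "y \<in> f0 ` ?ZP"
    then obtain x where x: "x \<in> ?P 0" "\<pi> x \<in> Z" "y = f0 x" by auto
    then have "(f0 x - \<pi> x) + \<pi> x \<in> Z" using f0(3) submodD(3)[OF Z] by blast
    then show "y \<in> Z" using x by simp
  qed
  have Y_bound': "cycles F dd Z i \<inter> Y i \<subseteq> dd i ` Y (Suc i)" if "i < k" for i
    using Y_bound that k by auto
  obtain f where f: "f 0 = f0" "chain_map R k ?P D ?ZP F dd Z f" "\<forall>i\<le>k. f i ` ?P i \<subseteq> Y i"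
  proof (rule chain_map_exists[OF subring P(4) projective_free_mod[OF subring] complex_mono[OF F(1) k(1)],
        where Y = Y and u = f0])
    show "submod R (Y i)" "Y i \<subseteq> F i" if "i \<le> k" for i using Y(1,2)[of i] that k(1) by auto
  qed (use f0(1,2) f0Z Y_bound' that in auto)
  obtain g where g: "chain_map R k F' dd (Z \<inter> F' 0) ?P D ?ZP g" "\<forall>x\<in>F' 0. \<pi> (g 0 x) - x \<in> Z"
    using lift_to_resolution[OF assms(2) k(1)] .
  have fF': "f i x \<in> F' i" if "i \<le> k" "x \<in> ?P i" for i x
    using f(3) Y(3)[of i] that k by (metis image_subset_iff order_trans subsetD)
  define h where "h = (\<lambda>i x. x - g i (f i x))"
  have h: "chain_map R k ?P D ?ZP ?P D ?ZP h" and h0: "h 0 ` ?P 0 \<subseteq> ?ZP"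
  proof -
    have lin: "linear_on R (?P i) (h i)" if i: "i \<le> k" for i
      unfolding h_def using fF'[OF i]
      by (intro linear_minus linear_ident linear_compose[OF chain_mapD(1)[OF f(2) i] chain_mapD(1)[OF g(1) i]]) auto
    have gf: "g i (f i x) \<in> ?P i" if "i \<le> k" "x \<in> ?P i" for i x
      using chain_mapD(2)[OF g(1) that(1) fF'[OF that]] .
    have mem: "h i x \<in> ?P i" if "i \<le> k" "x \<in> ?P i" for i x
      unfolding h_def using submod_diff[OF subring submod_free_mod[OF subring] that(2) gf[OF that]] .
    have comm: "D i (h (Suc i) x) = h i (D i x)" if i: "i < k" and x: "x \<in> ?P (Suc i)" for i x
    proof -
      have i': "Suc i \<le> k" using i by simp
      have "D i (h (Suc i) x) = D i x - D i (g (Suc i) (f (Suc i) x))"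
        unfolding h_def
        by (rule linear_diff[OF subring complexD(4)[OF P(4) i] submod_free_mod[OF subring] x gf[OF i' x]])
      also have "D i (g (Suc i) (f (Suc i) x)) = g i (dd i (f (Suc i) x))"
        using chain_mapD(4)[OF g(1) i fF'[OF i' x]] .
      also have "dd i (f (Suc i) x) = f i (D i x)"
        using chain_mapD(4)[OF f(2) i x] .
      finally show ?thesis by (simp add: h_def)
    qed
    show h0: "h 0 ` ?P 0 \<subseteq> ?ZP"
    proof
      fix y assume "y \<in> h 0 ` ?P 0"
      then obtain x where x: "x \<in> ?P 0" "y = h 0 x" by auto
      have "\<pi> y = \<pi> x - \<pi> (g 0 (f 0 x))"
        unfolding x(2) h_def
        by (rule linear_diff[OF subring P(1) submod_free_mod[OF subring] x(1) gf[OF _ x(1)]]) simp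
      also have "\<dots> = - ((\<pi> (g 0 (f 0 x)) - f 0 x) + (f0 x - \<pi> x))" using f(1) by simp
      finally have "\<pi> y = - ((\<pi> (g 0 (f 0 x)) - f 0 x) + (f0 x - \<pi> x))" .
      moreover have "\<pi> (g 0 (f 0 x)) - f 0 x \<in> Z" using g(2) fF'[of 0, OF _ x(1)] by simp
      ultimately have "\<pi> y \<in> Z"
        using f0(3)[OF x(1)] submodD(3)[OF Z] submod_uminus[OF subring Z] by metis
      then show "y \<in> ?ZP" using mem[of 0, OF _ x(1)] x(2) by simp
    qed
    show "chain_map R k ?P D ?ZP ?P D ?ZP h"
      unfolding chain_map_def using lin mem comm h0 by blast
  qed
  obtain \<theta> where \<theta>: "linear_on R (?P k) \<theta>" "\<theta> ` ?P k \<subseteq> cycles ?P D ?ZP k"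
    "\<forall>z\<in>cycles ?P D ?ZP k. \<theta> z = h k z"
    using chain_map_homotopic_to_cycles[OF subring P(4) projective_free_mod[OF subring] P(4,5) h h0 order_refl] .
  define w where "w = (\<lambda>x. g k (dd k x))"
  have dd: "dd k x \<in> cycles F' dd (Z \<inter> F' 0) k" if "x \<in> F' (Suc k)" for x
    using complexD(5)[OF complex_F' assms(3) that] .
  have lin_w: "linear_on R (F' (Suc k)) w"
    unfolding w_def using dd cycles_subset[OF complex_F', of k]
    by (intro linear_compose[OF complexD(4)[OF complex_F' assms(3)] chain_mapD(1)[OF g(1) order_refl]]) auto
  have w: "w x \<in> cycles ?P D ?ZP k" if "x \<in> F' (Suc k)" for x
    unfolding w_def
    using chain_map_cycles[OF complex_mono[OF complex_F' k(1)] g(1) order_refl dd[OF that]] .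
  have sub: "submod R (cycles ?P D ?ZP k)" using submod_cycles[OF P(4) order_refl] .
  have "cycles ?P D ?ZP k = {x + y |x y. x \<in> w ` F' (Suc k) \<and> y \<in> \<theta> ` ?P k}"
  proof (intro equalityI subsetI)
    fix z assume z: "z \<in> cycles ?P D ?ZP k"
    then have zP: "z \<in> ?P k" using cycles_subset[OF P(4), of k] by auto
    have "f k z \<in> cycles F dd Z k \<inter> Y k"
      using chain_map_cycles[OF P(4) f(2) order_refl z] f(3) zP by auto
    then obtain x where x: "x \<in> Y (Suc k)" "f k z = dd k x" using Y_bound[OF assms(3)] by auto
    have "x \<in> F' (Suc k)" using x Y(3)[OF k(2)] by auto
    moreover have "z = w x + \<theta> z" using \<theta>(3) z x(2) by (simp add: w_def h_def)
    ultimately show "z \<in> {x + y |x y. x \<in> w ` F' (Suc k) \<and> y \<in> \<theta> ` ?P k}" using zP by blast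
  next
    fix z assume "z \<in> {x + y |x y. x \<in> w ` F' (Suc k) \<and> y \<in> \<theta> ` ?P k}"
    then show "z \<in> cycles ?P D ?ZP k" using w \<theta>(2) submodD(3)[OF sub] by blast
  qed
  moreover have vec: "w ` F' (Suc k) \<subseteq> vec" "\<theta> ` ?P k \<subseteq> vec"
    using w \<theta>(2) submodD(1)[OF sub] by blast+
  ultimately show ?thesis
    using fin_gen_sum[OF
        fin_gen_image[OF projective_fin_gen[OF F'(1)[OF k(2)]] submod_F'[OF k(2)] lin_w vec(1)]
        fin_gen_image[OF projective_fin_gen[OF projective_free_mod[OF subring]] submod_free_mod[OF subring] \<theta>(1) vec(2)]
        submod_image[OF lin_w submod_F'[OF k(2)] vec(1)]
        submod_image[OF \<theta>(1) submod_free_mod[OF subring] vec(2)]]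
    by simp
qed

theorem essentially_acyclic_imp_resolves:
  assumes "essentially_acyclic"
  shows "\<exists>p D \<pi>. resolves R n (F 0) Z p D \<pi>"
proof -
  have Z: "submod R Z" using complexD(2)[OF F(1)] .
  have "\<exists>p D \<pi>. resolves R k (F 0) Z p D \<pi>" if "k \<le> n" for k
    using that
  proof (induction k)
    case 0
    obtain c' where c': "\<And>i. i \<le> n \<Longrightarrow> Fil i c' \<subseteq> F' i" using F'(4) by auto
    obtain m \<pi> where \<pi>: "linear_on R (free_mod R m) \<pi>" "\<pi> ` free_mod R m = F' 0"
      using fin_gen_presented[OF subring submod_F' projective_fin_gen[OF F'(1)], of 0] by blast
    have "\<exists>y\<in>free_mod R m. \<pi> y - x \<in> Z" if x: "x \<in> F 0" for x
    proof -
      obtain y where "y \<in> Fil 0 c'" "y - x \<in> Z" using assms x unfolding essentially_acyclic_def by blast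
      then have "y \<in> \<pi> ` free_mod R m" using \<pi>(2) c'[of 0] by auto
      then show ?thesis using \<open>y - x \<in> Z\<close> by auto
    qed
    moreover have "submod R {y \<in> free_mod R m. \<pi> y \<in> Z}"
      using submod_preimage[OF \<pi>(1) submod_free_mod[OF subring] Z] .
    ultimately show ?case
      using \<pi> F'(2)[of 0] submod_free_mod[OF subring]
      by (intro exI[of _ "\<lambda>_. m"] exI[of _ "\<lambda>_ _. 0"] exI[of _ \<pi>]) (auto simp: resolves_def complex_def exact_def)
  next
    case (Suc k)
    then obtain p D \<pi> where P: "resolves R k (F 0) Z p D \<pi>" and k: "k < n" by auto
    let ?P = "\<lambda>i. free_mod R (p i)" and ?ZP = "{y \<in> free_mod R (p 0). \<pi> y \<in> Z}"
    note P' = resolvesD[OF P]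
    obtain m f where f: "linear_on R (free_mod R m) f" "f ` free_mod R m = cycles ?P D ?ZP k"
      using fin_gen_presented[OF subring submod_cycles[OF P'(4) order_refl] resolution_step[OF assms P k]] .
    define p' where "p' = p(Suc k := m)"
    define D' where "D' = D(k := f)"
    have p': "p' i = p i" if "i \<le> k" for i using that by (simp add: p'_def)
    have D': "D' i = D i" if "i < k" for i using that by (simp add: D'_def)
    have cyc: "cycles (\<lambda>i. free_mod R (p' i)) D' ?ZP i = cycles ?P D ?ZP i" if "i \<le> k" for i
      using that p' D' by (cases i) auto
    have "complex R (Suc k) (\<lambda>i. free_mod R (p' i)) D' ?ZP"
      unfolding complex_def
    proof (intro conjI allI impI)
      fix i assume "i < Suc k"
      then consider "i < k" | "i = k" by linarith
      then show "linear_on R (free_mod R (p' (Suc i))) (D' i)"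
        using complexD(4)[OF P'(4)] f(1) by cases (auto simp: p' D', auto simp: p'_def D'_def)
      have "D' i ` free_mod R (p' (Suc i)) \<subseteq> cycles ?P D ?ZP i"
        using \<open>i < Suc k\<close> complexD(5)[OF P'(4)] f(2) p'[of "Suc i"] D'[of i]
        by (cases "i = k") (auto simp: p'_def D'_def)
      then show "D' i ` free_mod R (p' (Suc i)) \<subseteq> cycles (\<lambda>i. free_mod R (p' i)) D' ?ZP i"
        using cyc[of i] \<open>i < Suc k\<close> by simp
    qed (use submod_free_mod[OF subring] complexD(2)[OF P'(4)] p'[of 0] in auto)
    moreover have "cycles (\<lambda>i. free_mod R (p' i)) D' ?ZP i \<subseteq> D' i ` free_mod R (p' (Suc i))" if "i < Suc k" for i
    proof (cases "i = k")
      case True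
      then show ?thesis using cyc[of k] f(2) by (simp add: p'_def D'_def)
    next
      case False
      then have "i < k" using that by simp
      then show ?thesis using cyc[of i] P'(5) p'[of "Suc i"] D'[of i] by (simp add: exact_def)
    qed
    ultimately have "resolves R (Suc k) (F 0) Z p' D' \<pi>"
      using P'(1-3) p'[of 0] by (simp add: resolves_def exact_def)
    then show ?case by blast
  qed
  then show ?thesis by blast
qed

text \<open>Lift the identity of the augmented module to chain maps \<open>f\<close> from the resolution to \<open>F\<close> and \<open>g\<close>
  from \<open>F'\<close> to the resolution, and let \<open>s\<close> be a homotopy for \<open>id - f \<circ> g\<close>.  If \<open>z\<close> is a cycle in \<open>F'\<close>
  and \<open>y\<close> is a filling of \<open>g z\<close>, then \<open>f y + s z\<close> is a filling of \<open>z\<close>.  As \<open>f\<close> and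
  \<open>s\<close> are linear on finitely generated modules, their values lie in a fixed level.\<close>

theorem resolves_imp_bounded_filling:
  assumes "resolves R n (F 0) Z p D \<pi>"
  shows "\<exists>c. (\<forall>x\<in>F 0. \<exists>y\<in>Fil 0 c. y - x \<in> Z) \<and>
    (\<forall>i<n. cycles F dd Z i \<inter> F' i \<subseteq> dd i ` Fil (Suc i) c)"
proof -
  let ?P = "\<lambda>i. free_mod R (p i)" and ?ZP = "{y \<in> free_mod R (p 0). \<pi> y \<in> Z}"
  note P = resolvesD[OF assms]
  have Z: "submod R Z" using complexD(2)[OF F(1)] .
  have F_exact: "cycles F dd Z i \<inter> F i \<subseteq> dd i ` F (Suc i)" if "i < n" for i
    using F(2) that unfolding exact_def by blast
  obtain f where f: "f 0 = \<pi>" "chain_map R n ?P D ?ZP F dd Z f"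
  proof (rule chain_map_exists[OF subring P(4) projective_free_mod[OF subring] F(1),
        where Y = F and u = \<pi>])
    show "submod R (F i)" if "i \<le> n" for i using complexD(1)[OF F(1) that] .
  qed (use P(1,2) F_exact that in auto)
  obtain g where g: "chain_map R n F' dd (Z \<inter> F' 0) ?P D ?ZP g" "\<forall>x\<in>F' 0. \<pi> (g 0 x) - x \<in> Z"
    using lift_to_resolution[OF assms order_refl] .
  define h where "h = (\<lambda>i x. x - f i (g i x))"
  have gP: "g i x \<in> ?P i" if "i \<le> n" "x \<in> F' i" for i x
    using chain_mapD(2)[OF g(1) that] .
  have fg: "f i (g i x) \<in> F i" if "i \<le> n" "x \<in> F' i" for i x
    using chain_mapD(2)[OF f(2) that(1) gP[OF that]] .
  have h0: "h 0 ` F' 0 \<subseteq> Z"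
  proof
    fix y assume "y \<in> h 0 ` F' 0"
    then obtain x where x: "x \<in> F' 0" "y = h 0 x" by auto
    then have "y = - (\<pi> (g 0 x) - x)" by (simp add: h_def f(1))
    then show "y \<in> Z" using g(2) x submod_uminus[OF subring Z] by blast
  qed
  have h: "chain_map R n F' dd (Z \<inter> F' 0) F dd Z h"
    unfolding chain_map_def
  proof (intro conjI allI impI ballI)
    fix i assume i: "i \<le> n"
    show "linear_on R (F' i) (h i)"
      unfolding h_def using gP[OF i]
      by (intro linear_minus linear_ident linear_compose[OF chain_mapD(1)[OF g(1) i] chain_mapD(1)[OF f(2) i]]) auto
    show "h i ` F' i \<subseteq> F i"
      unfolding h_def using submod_diff[OF subring complexD(1)[OF F(1) i]] F'(2)[OF i] fg[OF i] by blast
  next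
    fix i x assume i: "i < n" and x: "x \<in> F' (Suc i)"
    have i': "Suc i \<le> n" using i by simp
    have "dd i (h (Suc i) x) = dd i x - dd i (f (Suc i) (g (Suc i) x))"
      unfolding h_def
      using F'(2)[OF i'] x
      by (intro linear_diff[OF subring complexD(4)[OF F(1) i] complexD(1)[OF F(1) i'] _ fg[OF i' x]]) auto
    also have "dd i (f (Suc i) (g (Suc i) x)) = f i (D i (g (Suc i) x))"
      using chain_mapD(4)[OF f(2) i gP[OF i' x]] .
    also have "D i (g (Suc i) x) = g i (dd i x)"
      using chain_mapD(4)[OF g(1) i x] .
    finally show "dd i (h (Suc i) x) = h i (dd i x)" by (simp add: h_def)
  next
    show "h 0 ` (Z \<inter> F' 0) \<subseteq> Z" using h0 by blast
  qed
  have bounded: "\<exists>c. u ` X \<subseteq> Fil i c"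
    if "i \<le> n" "projective R X" "linear_on R X u" "u ` X \<subseteq> F i" for X i u
  proof (rule fin_gen_linear_bounded[OF projective_fin_gen[OF that(2)] _ that(3), of "Fil i"])
    show "submod R X" using that(2) unfolding projective_def by blast
    show "u ` X \<subseteq> (\<Union>r. Fil i r)" using that(4) Fil(4)[OF that(1)] by blast
  qed (use Fil that(1) in auto)
  have fill: "\<exists>c. cycles F dd Z i \<inter> F' i \<subseteq> dd i ` Fil (Suc i) c" if i: "i < n" for i
  proof -
    have i': "Suc i \<le> n" "i \<le> n" using i by auto
    obtain \<theta> where \<theta>: "linear_on R (F' i) \<theta>" "\<theta> ` F' i \<subseteq> cycles F dd Z i"
      "\<forall>z\<in>cycles F' dd (Z \<inter> F' 0) i. \<theta> z = h i z"
      using chain_map_homotopic_to_cycles[OF subring complex_F' F'(1) F h h0 i'(2)] .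
    have "\<theta> ` F' i \<subseteq> dd i ` F (Suc i)" using \<theta>(2) F(2) i unfolding exact_def by blast
    then obtain s where s: "linear_on R (F' i) s" "s ` F' i \<subseteq> F (Suc i)" "\<And>x. x \<in> F' i \<Longrightarrow> dd i (s x) = \<theta> x"
      using projective_lift_linear[OF subring F'(1)[OF i'(2)] submod_F'[OF i'(2)] complexD(1)[OF F(1) i'(1)]
          complexD(1)[OF F(1) i'(1)] subset_refl complexD(4)[OF F(1) i] \<theta>(1)] by metis
    obtain c1 where c1: "s ` F' i \<subseteq> Fil (Suc i) c1"
      using bounded[OF i'(1) F'(1)[OF i'(2)] s(1,2)] by blast
    obtain c2 where c2: "f (Suc i) ` ?P (Suc i) \<subseteq> Fil (Suc i) c2"
      using bounded[OF i'(1) projective_free_mod[OF subring] chain_mapD(1)[OF f(2) i'(1)]]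
        chain_mapD(2)[OF f(2) i'(1)] by blast
    have "z \<in> dd i ` Fil (Suc i) (min c1 c2)" if z: "z \<in> cycles F dd Z i" "z \<in> F' i" for z
    proof -
      have z': "z \<in> cycles F' dd (Z \<inter> F' 0) i" using z cycles_F'[OF i'(2)] by auto
      have "g i z \<in> cycles ?P D ?ZP i" using chain_map_cycles[OF complex_F' g(1) i'(2) z'] .
      then obtain y where y: "y \<in> ?P (Suc i)" "g i z = D i y" using P(5) i unfolding exact_def by blast
      have fy: "f (Suc i) y \<in> Fil (Suc i) (min c1 c2)" "s z \<in> Fil (Suc i) (min c1 c2)"
        using c1 c2 y(1) z(2) Fil(3)[of "min c1 c2" c2 "Suc i"] Fil(3)[of "min c1 c2" c1 "Suc i"] by auto
      have "z = f i (g i z) + \<theta> z" using \<theta>(3) z' by (simp add: h_def)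
      also have "f i (g i z) = dd i (f (Suc i) y)" using y chain_mapD(4)[OF f(2) i y(1)] by simp
      also have "\<theta> z = dd i (s z)" using s(3)[OF z(2)] by simp
      also have "dd i (f (Suc i) y) + dd i (s z) = dd i (f (Suc i) y + s z)"
        using complexD(4)[OF F(1) i] fy Fil(2)[OF i'(1), of "min c1 c2"] unfolding linear_on_def
        by (metis subsetD)
      finally show ?thesis using submodD(3)[OF Fil(1)[OF i'(1)] fy] by blast
    qed
    then show ?thesis by blast
  qed
  have "\<exists>c. \<forall>i<k. cycles F dd Z i \<inter> F' i \<subseteq> dd i ` Fil (Suc i) c" if "k \<le> n" for k
    using that
  proof (induction k)
    case (Suc k)
    then obtain c where c: "\<forall>i<k. cycles F dd Z i \<inter> F' i \<subseteq> dd i ` Fil (Suc i) c" by auto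
    obtain c' where c': "cycles F dd Z k \<inter> F' k \<subseteq> dd k ` Fil (Suc k) c'" using fill[of k] Suc by auto
    have sub: "dd i ` Fil (Suc i) c \<subseteq> dd i ` Fil (Suc i) (min c c')" "dd i ` Fil (Suc i) c' \<subseteq> dd i ` Fil (Suc i) (min c c')" for i
      using Fil(3)[of "min c c'" c "Suc i"] Fil(3)[of "min c c'" c' "Suc i"] by (auto intro!: image_mono)
    have "cycles F dd Z i \<inter> F' i \<subseteq> dd i ` Fil (Suc i) (min c c')" if "i < Suc k" for i
    proof (cases "i = k")
      case True
      then show ?thesis using order_trans[OF c' sub(2)[of k]] by simp
    next
      case False
      then show ?thesis using order_trans[OF c[rule_format] sub(1)] that by simp
    qed
    then show ?case by blast
  qed auto
  then obtain c where c: "\<forall>i<n. cycles F dd Z i \<inter> F' i \<subseteq> dd i ` Fil (Suc i) c" by blast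
  obtain c0 where c0: "\<pi> ` ?P 0 \<subseteq> Fil 0 c0"
    using bounded[of 0, OF _ projective_free_mod[OF subring] P(1,2)] by auto
  have "\<exists>y\<in>Fil 0 (min c c0). y - x \<in> Z" if x: "x \<in> F 0" for x
  proof -
    obtain y where "y \<in> ?P 0" "\<pi> y - x \<in> Z" using P(3) x by auto
    then show ?thesis using c0 Fil(3)[of "min c c0" c0 0] by auto
  qed
  moreover have "cycles F dd Z i \<inter> F' i \<subseteq> dd i ` Fil (Suc i) (min c c0)" if "i < n" for i
  proof -
    have "dd i ` Fil (Suc i) c \<subseteq> dd i ` Fil (Suc i) (min c c0)"
      using Fil(3)[of "min c c0" c "Suc i"] by (auto intro!: image_mono)
    then show ?thesis using order_trans[OF c[rule_format, OF that]] by simp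
  qed
  ultimately show ?thesis by blast
qed

end

section \<open>Integral group rings\<close>

text \<open>For \<open>S\<close> closed under multiplication this is the monoid ring of \<open>S\<close>, as a subset of the group ring.\<close>

definition zspan :: "'g set \<Rightarrow> ('g \<Rightarrow>\<^sub>0 int) set"
  where "zspan S = {x. Poly_Mapping.keys x \<subseteq> S}"

lemma zspan_add: "x \<in> zspan S \<Longrightarrow> y \<in> zspan S \<Longrightarrow> x + y \<in> zspan S"
  using keys_add[of x y] by (auto simp: zspan_def)

lemma zspan_zero [simp]: "0 \<in> zspan S"
  by (simp add: zspan_def)

lemma zspan_uminus: "x \<in> zspan S \<Longrightarrow> - x \<in> zspan S"
  by (simp add: zspan_def)

lemma zspan_frag_of [simp]: "frag_of g \<in> zspan S \<longleftrightarrow> g \<in> S"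
  by (simp add: zspan_def)

lemma zspan_mono: "S \<subseteq> T \<Longrightarrow> zspan S \<subseteq> zspan T"
  by (auto simp: zspan_def)

lemma zspan_induct [consumes 1, case_names zero one diff]:
  assumes "x \<in> zspan S" "P 0" "\<And>g. g \<in> S \<Longrightarrow> P (frag_of g)" "\<And>a b. P a \<Longrightarrow> P b \<Longrightarrow> P (a - b)"
  shows "P x"
  using assms by (intro frag_induction[of x S P]) (auto simp: zspan_def)

lemma frag_extend_add_fun: "frag_extend (\<lambda>g. f g + h g) x = frag_extend f x + frag_extend h x"
  by (simp add: frag_extend_def frag_cmul_distrib2 sum.distrib)

lemma mult_monoid_ring: "x \<otimes>\<^bsub>monoid_ring G\<^esub> y = frag_extend (\<lambda>g. frag_extend (\<lambda>h. frag_of (g \<otimes>\<^bsub>G\<^esub> h)) y) x"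
  by (simp add: monoid_ring_def)

lemma mult_monoid_ring_frag_of [simp]: "frag_of g \<otimes>\<^bsub>monoid_ring G\<^esub> frag_of h = frag_of (g \<otimes>\<^bsub>G\<^esub> h)"
  by (simp add: mult_monoid_ring)

lemma mult_monoid_ring_add_left:
  "(x + y) \<otimes>\<^bsub>monoid_ring G\<^esub> z = x \<otimes>\<^bsub>monoid_ring G\<^esub> z + y \<otimes>\<^bsub>monoid_ring G\<^esub> z"
  by (simp add: mult_monoid_ring frag_extend_add)

lemma mult_monoid_ring_add_right:
  "z \<otimes>\<^bsub>monoid_ring G\<^esub> (x + y) = z \<otimes>\<^bsub>monoid_ring G\<^esub> x + z \<otimes>\<^bsub>monoid_ring G\<^esub> y"
  by (simp add: mult_monoid_ring frag_extend_add frag_extend_add_fun)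

lemma mult_monoid_ring_diff_left:
  "(x - y) \<otimes>\<^bsub>monoid_ring G\<^esub> z = x \<otimes>\<^bsub>monoid_ring G\<^esub> z - y \<otimes>\<^bsub>monoid_ring G\<^esub> z"
  using mult_monoid_ring_add_left[where x = "x - y" and y = y and z = z and G = G] by simp

lemma mult_monoid_ring_diff_right:
  "z \<otimes>\<^bsub>monoid_ring G\<^esub> (x - y) = z \<otimes>\<^bsub>monoid_ring G\<^esub> x - z \<otimes>\<^bsub>monoid_ring G\<^esub> y"
  using mult_monoid_ring_add_right[where x = "x - y" and y = y and z = z and G = G] by simp

lemma mult_monoid_ring_zero [simp]:
  "0 \<otimes>\<^bsub>monoid_ring G\<^esub> z = 0" "z \<otimes>\<^bsub>monoid_ring G\<^esub> 0 = 0"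
  using mult_monoid_ring_diff_left[where x = z and y = z and z = z and G = G]
    mult_monoid_ring_diff_right[where x = z and y = z and z = z and G = G] by auto

lemma mult_monoid_ring_zspan:
  assumes "x \<in> zspan S" "y \<in> zspan T" "\<And>g h. g \<in> S \<Longrightarrow> h \<in> T \<Longrightarrow> g \<otimes>\<^bsub>G\<^esub> h \<in> U"
  shows "x \<otimes>\<^bsub>monoid_ring G\<^esub> y \<in> zspan U"
proof -
  have "Poly_Mapping.keys (x \<otimes>\<^bsub>monoid_ring G\<^esub> y) \<subseteq>
      (\<Union>g\<in>Poly_Mapping.keys x. Poly_Mapping.keys (frag_extend (\<lambda>h. frag_of (g \<otimes>\<^bsub>G\<^esub> h)) y))"
    unfolding mult_monoid_ring by (rule keys_frag_extend)
  also have "\<dots> \<subseteq> (\<Union>g\<in>Poly_Mapping.keys x. \<Union>h\<in>Poly_Mapping.keys y. {g \<otimes>\<^bsub>G\<^esub> h})"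
    using keys_frag_extend[of _ y] by (fastforce simp: keys_frag_of)
  finally show ?thesis using assms by (force simp: zspan_def)
qed

locale group_ring = group G for G :: "('g, 'b) monoid_scheme" (structure)
begin

lemma mult_monoid_ring_assoc:
  assumes "x \<in> zspan (carrier G)" "y \<in> zspan (carrier G)" "z \<in> zspan (carrier G)"
  shows "(x \<otimes>\<^bsub>monoid_ring G\<^esub> y) \<otimes>\<^bsub>monoid_ring G\<^esub> z = x \<otimes>\<^bsub>monoid_ring G\<^esub> (y \<otimes>\<^bsub>monoid_ring G\<^esub> z)"
  using assms(1)
proof (induction rule: zspan_induct)
  case (one g)
  show ?case
    using assms(2)
  proof (induction rule: zspan_induct)
    case (one h)
    show ?case
      using assms(3) by (induction rule: zspan_induct)
        (use \<open>g \<in> carrier G\<close> \<open>h \<in> carrier G\<close> in \<open>auto simp: m_assoc mult_monoid_ring_diff_right\<close>)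
  qed (auto simp: mult_monoid_ring_diff_left mult_monoid_ring_diff_right)
qed (auto simp: mult_monoid_ring_diff_left)

sublocale coefficient_ring "monoid.mult (monoid_ring G)" "frag_of \<one>" "zspan (carrier G)"
proof unfold_locales
  fix a assume "a \<in> zspan (carrier G)"
  then show "frag_of \<one> \<otimes>\<^bsub>monoid_ring G\<^esub> a = a"
    by (induction rule: zspan_induct) (auto simp: mult_monoid_ring_diff_right)
  show "a \<otimes>\<^bsub>monoid_ring G\<^esub> frag_of \<one> = a"
    using \<open>a \<in> zspan (carrier G)\<close>
    by (induction rule: zspan_induct) (auto simp: mult_monoid_ring_diff_left)
next
  fix a b assume "a \<in> zspan (carrier G)" "b \<in> zspan (carrier G)"
  then show "a \<otimes>\<^bsub>monoid_ring G\<^esub> b \<in> zspan (carrier G)"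
    by (rule mult_monoid_ring_zspan) auto
qed (auto simp: mult_monoid_ring_add_left mult_monoid_ring_add_right zspan_add zspan_uminus
    mult_monoid_ring_assoc)

notation act (infixr \<open>\<cdot>\<close> 75)

lemma subring_zspan:
  assumes "S \<subseteq> carrier G" "\<one> \<in> S" "\<And>g h. g \<in> S \<Longrightarrow> h \<in> S \<Longrightarrow> g \<otimes> h \<in> S"
  shows "subring (zspan S)"
  unfolding subring_def
  using assms zspan_mono[OF assms(1)] by (auto simp: zspan_add zspan_uminus intro: mult_monoid_ring_zspan)

lemma submod_free_mod_zspan:
  assumes "T \<subseteq> carrier G" "\<And>g h. g \<in> S \<Longrightarrow> h \<in> T \<Longrightarrow> g \<otimes> h \<in> T"
  shows "submod (zspan S) (free_mod (zspan T) m)"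
  unfolding submod_def
proof (intro conjI ballI)
  show "free_mod (zspan T) m \<subseteq> vec"
  proof
    fix f assume "f \<in> free_mod (zspan T) m"
    then have "f i \<in> zspan (carrier G)" for i
      using zspan_mono[OF assms(1)] by (cases "i < m") (auto simp: free_mod_def)
    then show "f \<in> vec" by (simp add: vec_def)
  qed
  fix a x assume "a \<in> zspan S" "x \<in> free_mod (zspan T) m"
  then show "a \<cdot> x \<in> free_mod (zspan T) m"
    using mult_monoid_ring_zspan[of a S _ T G T] assms(2) by (auto simp: free_mod_def act_def)
qed (auto simp: free_mod_def pointwise zspan_add)

end

section \<open>Subgroups of finite index and characters\<close>

locale finite_index = group_ring +
  fixes K
  assumes subgroup: "subgroup K G" and finite_index: "finite (rcosets K)"
begin

definition rep :: "'a \<Rightarrow> 'a"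
  where "rep g = (SOME x. x \<in> K #> g)"

lemma rep:
  assumes "g \<in> carrier G"
  shows "rep g \<in> carrier G" "g \<otimes> inv (rep g) \<in> K" "rep (rep g) = rep g"
proof -
  have "g \<in> K #> g" using rcos_self[OF assms subgroup] .
  then have *: "rep g \<in> K #> g" unfolding rep_def by (rule someI)
  then obtain k where k: "k \<in> K" "rep g = k \<otimes> g" unfolding r_coset_def by auto
  then have kc: "k \<in> carrier G" using subgroup.subset[OF subgroup] by auto
  then show "rep g \<in> carrier G" using k assms by auto
  have "g \<otimes> inv (rep g) = inv k"
    using k kc assms by (simp add: inv_mult_group m_assoc[symmetric])
  then show "g \<otimes> inv (rep g) \<in> K" using k subgroup.m_inv_closed[OF subgroup] by simp
  have eq: "K #> rep g = K #> g"
    using repr_independence[OF * _ subgroup] assms by simp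
  have "rep (rep g) = (SOME x. x \<in> K #> rep g)" by (rule rep_def)
  also have "\<dots> = rep g" unfolding eq by (rule rep_def[symmetric])
  finally show "rep (rep g) = rep g" .
qed

lemma rep_mult:
  assumes "g \<in> carrier G" "k \<in> K"
  shows "rep (k \<otimes> g) = rep g"
proof -
  have "k \<otimes> g \<in> K #> g" using assms unfolding r_coset_def by auto
  then have "K #> g = K #> (k \<otimes> g)" using repr_independence[OF _ _ subgroup] assms by simp
  then show ?thesis unfolding rep_def by simp
qed

lemma finite_rep: "finite (rep ` carrier G)"
proof -
  have "rep ` carrier G \<subseteq> (\<lambda>C. SOME x. x \<in> C) ` (rcosets K)"
    unfolding rep_def RCOSETS_def by auto
  then show ?thesis using finite_index finite_surj by blast
qed

text \<open>Two powers of \<open>g\<close> lie in the same right coset of \<open>K\<close>, by the pigeonhole principle.\<close>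

lemma pow_mem:
  assumes g: "g \<in> carrier G"
  obtains k :: nat where "k > 0" "g [^] k \<in> K"
proof -
  have "finite ((\<lambda>k::nat. rep (g [^] k)) ` UNIV)"
    using finite_rep by (rule finite_subset[rotated]) (use g in auto)
  then have "\<not> inj (\<lambda>k::nat. rep (g [^] k))"
    using finite_imageD infinite_UNIV_nat by blast
  then obtain i j :: nat where ij: "i < j" "rep (g [^] i) = rep (g [^] j)"
    unfolding inj_def by (metis linorder_neqE_nat)
  have gi: "g [^] i \<in> carrier G" "g [^] j \<in> carrier G" using g by auto
  have "(g [^] j \<otimes> inv (rep (g [^] j))) \<otimes> inv (g [^] i \<otimes> inv (rep (g [^] i))) \<in> K"
    using rep(2)[OF gi(1)] rep(2)[OF gi(2)] subgroup.m_closed[OF subgroup] subgroup.m_inv_closed[OF subgroup] by blast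
  moreover have "(g [^] j \<otimes> inv (rep (g [^] j))) \<otimes> inv (g [^] i \<otimes> inv (rep (g [^] i))) = g [^] j \<otimes> inv (g [^] i)"
    using ij(2) rep(1)[OF gi(1)] gi
    by (simp add: inv_mult_group m_assoc) (simp add: m_assoc[symmetric])
  moreover have "g [^] j = g [^] (j - i) \<otimes> g [^] i" using g ij(1) by (simp add: nat_pow_mult)
  then have "g [^] j \<otimes> inv (g [^] i) = g [^] (j - i)" using g gi by (simp add: m_assoc)
  ultimately show ?thesis using that[of "j - i"] ij(1) by simp
qed

end

locale real_character = group G for G (structure) +
  fixes \<xi> :: "'a \<Rightarrow> real"
  assumes char_mult: "g \<in> carrier G \<Longrightarrow> h \<in> carrier G \<Longrightarrow> \<xi> (g \<otimes> h) = \<xi> g + \<xi> h"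
begin

lemma char_one: "\<xi> \<one> = 0"
  using char_mult[of \<one> \<one>] by simp

lemma char_inv: "g \<in> carrier G \<Longrightarrow> \<xi> (inv g) = - \<xi> g"
  using char_mult[of g "inv g"] by (simp add: char_one)

lemma char_pow: "g \<in> carrier G \<Longrightarrow> \<xi> (g [^] (k::nat)) = real k * \<xi> g"
  by (induction k) (auto simp: char_one char_mult algebra_simps)

end

locale group_character = group_ring + real_character +
  assumes char_nonzero: "\<exists>g\<in>carrier G. \<xi> g \<noteq> 0"
begin

lemma char_positive: obtains t where "t \<in> carrier G" "\<xi> t > 0"
proof -
  obtain g where g: "g \<in> carrier G" "\<xi> g \<noteq> 0" using char_nonzero by auto
  then show ?thesis
    using that[of g] that[of "inv g"] char_inv[OF g(1)] by (cases "\<xi> g > 0") auto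
qed

text \<open>The multiples of one positive value of \<open>\<xi>\<close> leave only gaps of that length.\<close>

lemma char_value_near: "\<exists>\<tau>>0. \<forall>r. \<exists>s\<in>carrier G. r - \<tau> < \<xi> s \<and> \<xi> s \<le> r"
proof -
  obtain t where t: "t \<in> carrier G" "\<xi> t > 0" using char_positive .
  have "\<exists>s\<in>carrier G. r - \<xi> t < \<xi> s \<and> \<xi> s \<le> r" for r
  proof -
    define j where "j = \<lfloor>r / \<xi> t\<rfloor>"
    have "of_int j \<le> r / \<xi> t" "r / \<xi> t < of_int j + 1" by (auto simp: j_def)
    then have j: "of_int j * \<xi> t \<le> r" "r < of_int j * \<xi> t + \<xi> t"
      using t(2) by (auto simp: field_simps)
    define k where "k = nat \<bar>j\<bar>"
    have k: "real k = \<bar>of_int j\<bar>" by (simp add: k_def)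
    define s where "s = (if j \<ge> 0 then t [^] k else inv (t [^] k))"
    have "s \<in> carrier G" using t by (auto simp: s_def)
    moreover have "\<xi> s = of_int j * \<xi> t"
      using t(1) k by (auto simp: s_def char_pow char_inv)
    ultimately show ?thesis using j by (intro bexI[of _ s]) auto
  qed
  then show ?thesis using t(2) by blast
qed

definition level :: "real \<Rightarrow> ('a \<Rightarrow>\<^sub>0 int) set"
  where "level r = zspan {g \<in> carrier G. \<xi> g \<ge> r}"

lemma level_mono: "r \<le> s \<Longrightarrow> level s \<subseteq> level r"
  unfolding level_def by (rule zspan_mono) auto

lemma level_mult: "x \<in> level r \<Longrightarrow> y \<in> level s \<Longrightarrow> x \<otimes>\<^bsub>monoid_ring G\<^esub> y \<in> level (r + s)"
  unfolding level_def by (rule mult_monoid_ring_zspan) (auto simp: char_mult)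

lemma level_exhaust: "x \<in> zspan (carrier G) \<Longrightarrow> \<exists>r. x \<in> level r"
proof (induction rule: zspan_induct)
  case (diff a b)
  then obtain r s where "a \<in> level r" "b \<in> level s" by auto
  then have "a \<in> level (min r s)" "b \<in> level (min r s)" using level_mono by (meson min.cobounded1 min.cobounded2 subsetD)+
  then have "a - b \<in> level (min r s)"
    using zspan_add[of a _ "- b"] unfolding level_def by (simp add: zspan_uminus)
  then show ?case ..
qed (auto simp: level_def)

lemma free_mod_level_mono: "r \<le> s \<Longrightarrow> free_mod (level s) m \<subseteq> free_mod (level r) m"
  using level_mono[of r s] unfolding free_mod_def by blast

lemma free_mod_level_subset: "free_mod (level r) m \<subseteq> free_mod (zspan (carrier G)) m"
  using zspan_mono[of "{g \<in> carrier G. \<xi> g \<ge> r}" "carrier G"] unfolding free_mod_def level_def by blast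

lemma submod_level:
  assumes "S \<subseteq> {g \<in> carrier G. \<xi> g \<ge> 0}"
  shows "submod (zspan S) (free_mod (level r) m)"
  unfolding level_def by (rule submod_free_mod_zspan) (use assms in \<open>force simp: char_mult\<close>)+

lemma free_mod_level_exhaust:
  assumes "x \<in> free_mod (zspan (carrier G)) m" obtains r where "x \<in> free_mod (level r) m"
proof -
  have "\<forall>i<m. x i \<in> zspan (carrier G)" using assms by (auto simp: free_mod_def)
  then have "\<exists>r. \<forall>i<m. x i \<in> level r"
  proof (induction m)
    case (Suc m)
    then obtain r where r: "\<forall>i<m. x i \<in> level r" by auto
    obtain s where s: "x m \<in> level s" using level_exhaust Suc.prems by blast
    have "x m \<in> level (min r s)" using s level_mono[of "min r s" s] by auto
    moreover have "\<forall>i<m. x i \<in> level (min r s)" using r level_mono[of "min r s" r] by auto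
    ultimately show ?case by (intro exI[of _ "min r s"]) (auto simp: less_Suc_eq)
  qed auto
  then show ?thesis using that assms by (auto simp: free_mod_def)
qed

lemma act_level:
  assumes "a \<in> level s" "x \<in> free_mod (level r) m"
  shows "a \<cdot> x \<in> free_mod (level (s + r)) m"
  using assms level_mult by (auto simp: free_mod_def act_def)

text \<open>A linear map between free modules of finite rank is given by a finite matrix over the group ring,
  whose entries all lie in some level; applying the matrix lowers the level by a bounded amount.\<close>

lemma linear_bounded:
  assumes f: "linear_on (zspan (carrier G)) (free_mod (zspan (carrier G)) p) f"
    "f ` free_mod (zspan (carrier G)) p \<subseteq> free_mod (zspan (carrier G)) q"
  shows "\<exists>c. \<forall>r. f ` free_mod (level r) p \<subseteq> free_mod (level (r - c)) q"
proof -
  let ?L = "zspan (carrier G)"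
  define e where "e = (\<lambda>l i::nat. if i = l then frag_of \<one> else (0::'a \<Rightarrow>\<^sub>0 int))"
  have e: "e l \<in> free_mod ?L p" if "l < p" for l using that by (auto simp: e_def free_mod_def)
  have level0: "submod (zspan {\<one>}) (free_mod (level r) q)" for r
    by (rule submod_level) (auto simp: char_one)
  have "\<exists>c. \<forall>l<k. f (e l) \<in> free_mod (level (- c)) q" if "k \<le> p" for k
    using that
  proof (induction k)
    case (Suc k)
    then obtain c where c: "\<forall>l<k. f (e l) \<in> free_mod (level (- c)) q" by auto
    obtain r where r: "f (e k) \<in> free_mod (level r) q"
      using free_mod_level_exhaust[of "f (e k)" q] f(2) e[of k] Suc by auto
    have "- max c (- r) \<le> r" by linarith
    then have "\<forall>l<Suc k. f (e l) \<in> free_mod (level (- max c (- r))) q"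
      using c r free_mod_level_mono[of "- max c (- r)" r q] free_mod_level_mono[of "- max c (- r)" "- c" q]
      by (auto simp: less_Suc_eq)
    then show ?case by blast
  qed auto
  then obtain c where c: "\<And>l. l < p \<Longrightarrow> f (e l) \<in> free_mod (level (- c)) q" by blast
  have "f x \<in> free_mod (level (r - c)) q" if x: "x \<in> free_mod (level r) p" for r x
  proof -
    have xl: "x l \<in> level r" "x l \<in> ?L" if "l < p" for l
      using x that zspan_mono[of "{g \<in> carrier G. \<xi> g \<ge> r}" "carrier G"] by (auto simp: free_mod_def level_def)
    have f_sum: "f (\<Sum>l<k. x l \<cdot> e l) = (\<Sum>l<k. x l \<cdot> f (e l)) \<and> (\<Sum>l<k. x l \<cdot> e l) \<in> free_mod ?L p" if "k \<le> p" for k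
      using that
    proof (induction k)
      case 0
      show ?case
        using linear_zero[OF f(1) submod_free_mod[OF subring_L]] submodD(2)[OF submod_free_mod[OF subring_L]] by simp
    next
      case (Suc k)
      then have k: "k < p" by simp
      have xe: "x k \<cdot> e k \<in> free_mod ?L p"
        using submodD(4)[OF submod_free_mod[OF subring_L] xl(2)[OF k] e[OF k]] .
      have IH: "f (\<Sum>l<k. x l \<cdot> e l) = (\<Sum>l<k. x l \<cdot> f (e l))" "(\<Sum>l<k. x l \<cdot> e l) \<in> free_mod ?L p"
        using Suc by auto
      have "f ((\<Sum>l<k. x l \<cdot> e l) + x k \<cdot> e k) = f (\<Sum>l<k. x l \<cdot> e l) + f (x k \<cdot> e k)"
        using f(1) IH(2) xe unfolding linear_on_def by blast
      also have "f (x k \<cdot> e k) = x k \<cdot> f (e k)"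
        using f(1) xl(2)[OF k] e[OF k] unfolding linear_on_def by blast
      finally show ?case
        using IH submodD(3)[OF submod_free_mod[OF subring_L] IH(2) xe] by simp
    qed
    have "x = (\<Sum>l<p. x l \<cdot> e l)"
    proof
      fix i
      have "(\<Sum>l<p. x l \<cdot> e l) i = (\<Sum>l<p. if i = l then x i else 0)"
        unfolding sum_fun_apply act_def e_def using xl(2) mul_one_right by (intro sum.cong) auto
      also have "\<dots> = x i" using x by (auto simp: free_mod_def)
      finally show "x i = (\<Sum>l<p. x l \<cdot> e l) i" by simp
    qed
    then have "f x = (\<Sum>l<p. x l \<cdot> f (e l))" using f_sum[of p] by simp
    also have "\<dots> \<in> free_mod (level (r - c)) q"
      using act_level[OF xl(1) c] by (intro submod_sum[OF level0]) auto
    finally show ?thesis .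
  qed
  then show ?thesis by blast
qed

end

section \<open>The filtration of a free complex by a character\<close>

locale finite_index_character = group_character + finite_index
begin

text \<open>The elements \<open>k t\<close>, with \<open>k\<close> in \<open>K\<close> and \<open>t\<close> a representative, are measured by \<open>\<xi> k\<close> instead of
  \<open>\<xi> k + \<xi> t\<close>.  This changes levels by a bounded amount, as there are finitely many representatives, but
  if \<open>r = \<xi> u\<close> with \<open>u\<close> in \<open>K\<close>, then the elements with \<open>\<xi> k \<ge> r\<close> are those of the form \<open>k' u t\<close>
  with \<open>\<xi> k' \<ge> 0\<close>; so the new level is a free module of finite rank over the monoid ring of
  \<open>{k \<in> K. \<xi> k \<ge> 0}\<close>, with the basis of all \<open>u t\<close>.\<close>

definition coset_level :: "real \<Rightarrow> ('a \<Rightarrow>\<^sub>0 int) set"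
  where "coset_level r = zspan {g \<in> carrier G. \<xi> g - \<xi> (rep g) \<ge> r}"

abbreviation nonneg_ring :: "('a \<Rightarrow>\<^sub>0 int) set"
  where "nonneg_ring \<equiv> zspan {k \<in> K. \<xi> k \<ge> 0}"

lemma K_carrier: "k \<in> K \<Longrightarrow> k \<in> carrier G"
  using subgroup.subset[OF subgroup] by auto

lemma subring_nonneg: "subring nonneg_ring"
  by (rule subring_zspan)
     (auto simp: K_carrier char_one char_mult subgroup.one_closed[OF subgroup] subgroup.m_closed[OF subgroup])

lemma coset_level_bounds:
  "\<exists>c\<ge>0. \<forall>r m. free_mod (level (r + c)) m \<subseteq> free_mod (coset_level r) m \<and>
    free_mod (coset_level r) m \<subseteq> free_mod (level (r - c)) m"
proof -
  define c where "c = Max (insert 0 ((\<lambda>t. \<bar>\<xi> t\<bar>) ` rep ` carrier G))"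
  have c: "\<bar>\<xi> (rep g)\<bar> \<le> c" if "g \<in> carrier G" for g
    unfolding c_def using finite_rep that by (intro Max_ge) auto
  have "c \<ge> 0" unfolding c_def using finite_rep by (intro Max_ge) auto
  moreover have "level (r + c) \<subseteq> coset_level r" for r
    unfolding level_def coset_level_def using c by (intro zspan_mono) (force simp: abs_le_iff)
  moreover have "coset_level r \<subseteq> level (r - c)" for r
    unfolding level_def coset_level_def using c by (intro zspan_mono) (force simp: abs_le_iff)
  ultimately show ?thesis unfolding free_mod_def by blast
qed

lemma submod_coset_level: "submod nonneg_ring (free_mod (coset_level r) m)"
  unfolding coset_level_def
  by (rule submod_free_mod_zspan) (auto simp: char_mult K_carrier rep_mult)

text \<open>The coefficient at \<open>u t\<close> in the expansion of an element of the group ring in the basis of all \<open>u t\<close>.\<close>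

definition coord :: "'a \<Rightarrow> 'a \<Rightarrow> ('a \<Rightarrow>\<^sub>0 int) \<Rightarrow> ('a \<Rightarrow>\<^sub>0 int)"
  where "coord u t x = frag_extend (\<lambda>g. if rep g = t then frag_of (g \<otimes> inv (u \<otimes> t)) else 0) x"

lemma coord_add: "coord u t (x + y) = coord u t x + coord u t y"
  by (simp add: coord_def frag_extend_add)

lemma coord_mult:
  assumes "u \<in> carrier G" "t \<in> carrier G" "a \<in> zspan K" "x \<in> zspan (carrier G)"
  shows "coord u t (a \<otimes>\<^bsub>monoid_ring G\<^esub> x) = a \<otimes>\<^bsub>monoid_ring G\<^esub> coord u t x"
  using assms(3)
proof (induction rule: zspan_induct)
  case (one k)
  show ?case
    using assms(4) by (induction rule: zspan_induct)
      (use assms(1,2) one in \<open>auto simp: coord_def mult_monoid_ring_diff_right frag_extend_diff rep_mult m_assoc K_carrier\<close>)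
qed (auto simp: coord_def mult_monoid_ring_diff_left frag_extend_diff)

lemma coord_mem:
  assumes "u \<in> K" "x \<in> coset_level (\<xi> u)" "t \<in> carrier G"
  shows "coord u t x \<in> nonneg_ring"
  using assms(2) unfolding coset_level_def
proof (induction rule: zspan_induct)
  case (one g)
  show ?case
  proof (cases "rep g = t")
    case True
    have g: "g \<in> carrier G" "\<xi> g - \<xi> t \<ge> \<xi> u" using one True by auto
    have u: "u \<in> carrier G" using assms(1) K_carrier by auto
    have "g \<otimes> inv (u \<otimes> t) = (g \<otimes> inv t) \<otimes> inv u"
      using g u assms(3) by (simp add: inv_mult_group m_assoc)
    moreover have "g \<otimes> inv t \<in> K" using rep(2)[OF g(1)] True by simp
    then have "(g \<otimes> inv t) \<otimes> inv u \<in> K"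
      using assms(1) subgroup.m_closed[OF subgroup] subgroup.m_inv_closed[OF subgroup] by auto
    moreover have "\<xi> ((g \<otimes> inv t) \<otimes> inv u) \<ge> 0"
      using g u assms(3) by (simp add: char_mult char_inv)
    ultimately show ?thesis using True by (simp add: coord_def)
  qed (simp add: coord_def)
next
  case (diff a b)
  then show ?case
    using zspan_add[of "coord u t a" _ "- coord u t b"] zspan_uminus[of "coord u t b"]
    by (simp add: coord_def frag_extend_diff)
qed (auto simp: coord_def)

lemma coord_expand:
  assumes "u \<in> carrier G" "x \<in> zspan (carrier G)"
  shows "(\<Sum>t\<in>rep ` carrier G. coord u t x \<otimes>\<^bsub>monoid_ring G\<^esub> frag_of (u \<otimes> t)) = x"
  using assms(2)
proof (induction rule: zspan_induct)
  case (one g)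
  have "coord u t (frag_of g) \<otimes>\<^bsub>monoid_ring G\<^esub> frag_of (u \<otimes> t) = (if rep g = t then frag_of g else 0)"
    if "t \<in> rep ` carrier G" for t
  proof (cases "rep g = t")
    case True
    have "u \<otimes> t \<in> carrier G" using that rep(1) assms(1) by auto
    then have "g \<otimes> inv (u \<otimes> t) \<otimes> (u \<otimes> t) = g" using one by (simp add: m_assoc)
    then show ?thesis using True by (simp add: coord_def)
  qed (simp add: coord_def)
  then have "(\<Sum>t\<in>rep ` carrier G. coord u t (frag_of g) \<otimes>\<^bsub>monoid_ring G\<^esub> frag_of (u \<otimes> t)) =
      (\<Sum>t\<in>rep ` carrier G. if rep g = t then frag_of g else 0)"
    by (intro sum.cong) auto
  also have "\<dots> = frag_of g" using one finite_rep by (simp add: sum.delta)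
  finally show ?case .
next
  case (diff a b)
  have "coord u t (a - b) = coord u t a - coord u t b" for t
    by (simp add: coord_def frag_extend_diff)
  then show ?case using diff by (simp add: mult_monoid_ring_diff_left sum_subtractf)
qed (simp add: coord_def)

lemma projective_coset_level:
  assumes u: "u \<in> K"
  shows "projective nonneg_ring (free_mod (coset_level (\<xi> u)) m)"
proof -
  have uc: "u \<in> carrier G" using K_carrier[OF u] .
  have lev: "coset_level r \<subseteq> zspan (carrier G)" for r
    unfolding coset_level_def by (rule zspan_mono) auto
  define b where "b = (\<lambda>(t, l) i::nat. if i = l then frag_of (u \<otimes> t) else (0::'a \<Rightarrow>\<^sub>0 int))"
  show ?thesis
  proof (rule projectiveI[OF submod_coset_level, where I = "(rep ` carrier G) \<times> {..<m}" and b = b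
        and \<phi> = "\<lambda>(t, l) x. coord u t (x l)"], unfold dual_basis_def, intro conjI ballI)
    show "finite ((rep ` carrier G) \<times> {..<m})" using finite_rep by auto
  next
    fix i assume "i \<in> (rep ` carrier G) \<times> {..<m}"
    then obtain g l where i: "i = (rep g, l)" "g \<in> carrier G" "l < m" by auto
    have "rep (u \<otimes> rep g) = rep g" using rep_mult[of "rep g" u] rep i u by simp
    then show "b i \<in> free_mod (coset_level (\<xi> u)) m"
      using i uc rep(1)[OF i(2)] by (auto simp: b_def free_mod_def coset_level_def char_mult)
  next
    fix i x assume "i \<in> (rep ` carrier G) \<times> {..<m}" "x \<in> free_mod (coset_level (\<xi> u)) m"
    then show "(case i of (t, l) \<Rightarrow> \<lambda>x. coord u t (x l)) x \<in> nonneg_ring"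
      using coord_mem[OF u] rep(1) by (auto simp: free_mod_def)
  next
    fix i x y show "(case i of (t, l) \<Rightarrow> \<lambda>x. coord u t (x l)) (x + y) =
        (case i of (t, l) \<Rightarrow> \<lambda>x. coord u t (x l)) x + (case i of (t, l) \<Rightarrow> \<lambda>x. coord u t (x l)) y"
      by (cases i) (simp add: pointwise coord_add)
  next
    fix i a x assume *: "i \<in> (rep ` carrier G) \<times> {..<m}" "a \<in> nonneg_ring" "x \<in> free_mod (coset_level (\<xi> u)) m"
    then have "a \<in> zspan K" using zspan_mono[of "{k \<in> K. \<xi> k \<ge> 0}" K] by auto
    then show "(case i of (t, l) \<Rightarrow> \<lambda>x. coord u t (x l)) (a \<cdot> x) =
        a \<otimes>\<^bsub>monoid_ring G\<^esub> (case i of (t, l) \<Rightarrow> \<lambda>x. coord u t (x l)) x"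
      using * lev[THEN subsetD] rep(1) coord_mult[OF uc] by (auto simp: act_def free_mod_def)
  next
    fix x assume x: "x \<in> free_mod (coset_level (\<xi> u)) m"
    have "(\<Sum>i\<in>(rep ` carrier G) \<times> {..<m}. (case i of (t, l) \<Rightarrow> \<lambda>x. coord u t (x l)) x \<cdot> b i) j = x j" for j
    proof -
      have "(\<Sum>i\<in>(rep ` carrier G) \<times> {..<m}. (case i of (t, l) \<Rightarrow> \<lambda>x. coord u t (x l)) x \<cdot> b i) j
          = (\<Sum>t\<in>rep ` carrier G. \<Sum>l<m. (coord u t (x l) \<cdot> b (t, l)) j)"
        unfolding sum_fun_apply sum.cartesian_product by (intro sum.cong) auto
      also have "\<dots> = (\<Sum>t\<in>rep ` carrier G. \<Sum>l<m. if j = l then coord u t (x j) \<otimes>\<^bsub>monoid_ring G\<^esub> frag_of (u \<otimes> t) else 0)"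
        by (intro sum.cong) (auto simp: act_def b_def)
      also have "\<dots> = (if j < m then (\<Sum>t\<in>rep ` carrier G. coord u t (x j) \<otimes>\<^bsub>monoid_ring G\<^esub> frag_of (u \<otimes> t)) else 0)"
        by (simp add: sum.delta)
      also have "\<dots> = x j"
        using coord_expand[OF uc, of "x j"] x lev by (auto simp: free_mod_def)
      finally show ?thesis .
    qed
    then show "x = (\<Sum>i\<in>(rep ` carrier G) \<times> {..<m}. (case i of (t, l) \<Rightarrow> \<lambda>x. coord u t (x l)) x \<cdot> b i)"
      by auto
  qed
qed

text \<open>The levels of the filtration are modules over the monoid ring of the elements of \<open>G\<close> with
  \<open>\<xi> \<ge> 0\<close>, and \<open>F\<close> is a complex over the whole group ring.  The subcomplex \<open>F'\<close> is made of levels relative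
  to cosets, chosen at values of \<open>\<xi>\<close> on \<open>K\<close> that grow with the degree fast enough to absorb the loss
  of level under the differentials.  A bounded filling of the cycles in \<open>F'\<close> then gives essential
  acyclicity: a cycle of any level is moved into \<open>F'\<close> by an element of \<open>G\<close>, filled, and moved back.\<close>

theorem resolves_iff_essentially_acyclic:
  fixes m :: "nat \<Rightarrow> nat"
  defines "F \<equiv> \<lambda>i. free_mod (zspan (carrier G)) (m i)"
  assumes F: "complex (zspan (carrier G)) n F dd Z" "exact n F dd Z"
  shows "(\<exists>p D \<pi>. resolves nonneg_ring n (F 0) Z p D \<pi>) \<longleftrightarrow>
    (\<exists>c\<ge>0. (\<forall>r. \<forall>x\<in>F 0. \<exists>y\<in>free_mod (level r) (m 0). y - x \<in> Z) \<and>
      (\<forall>i<n. \<forall>r. cycles F dd Z i \<inter> free_mod (level r) (m i) \<subseteq> dd i ` free_mod (level (r - c)) (m (Suc i))))"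
proof -
  let ?L = "zspan (carrier G)"
  define Fil where "Fil = (\<lambda>i r. free_mod (level r) (m i))"
  obtain c where c: "c \<ge> 0" "\<And>r m. free_mod (level (r + c)) m \<subseteq> free_mod (coset_level r) m"
    "\<And>r m. free_mod (coset_level r) m \<subseteq> free_mod (level (r - c)) m"
    using coset_level_bounds by auto
  have "\<exists>d. \<forall>i<k. \<forall>r. dd i ` Fil (Suc i) r \<subseteq> Fil i (r - d)" if "k \<le> n" for k
    using that
  proof (induction k)
    case (Suc k)
    then obtain d where d: "\<forall>i<k. \<forall>r. dd i ` Fil (Suc i) r \<subseteq> Fil i (r - d)" by auto
    have "dd k ` F (Suc k) \<subseteq> F k" using boundary_mem[OF F(1), of k] Suc by auto
    then obtain d' where d': "\<forall>r. dd k ` Fil (Suc k) r \<subseteq> Fil k (r - d')"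
      using linear_bounded[of "m (Suc k)" "dd k" "m k"] complexD(4)[OF F(1), of k] Suc
      unfolding F_def Fil_def by auto
    have mono: "Fil i (r - d) \<subseteq> Fil i (r - max d d')" "Fil i (r - d') \<subseteq> Fil i (r - max d d')" for i r
      unfolding Fil_def by (auto intro!: free_mod_level_mono)
    have "dd i ` Fil (Suc i) r \<subseteq> Fil i (r - max d d')" if "i < Suc k" for i r
    proof (cases "i = k")
      case True
      then show ?thesis using order_trans[OF d'[rule_format] mono(2)] by simp
    next
      case False
      then show ?thesis using order_trans[OF d[rule_format] mono(1)] that by simp
    qed
    then show ?case by blast
  qed auto
  from this[of n] obtain d where "\<forall>i<n. \<forall>r. dd i ` Fil (Suc i) r \<subseteq> Fil i (r - d)" by auto
  then have d: "dd i ` Fil (Suc i) r \<subseteq> Fil i (r - d)" if "i < n" for i r using that by simp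
  obtain g where g: "g \<in> carrier G" "\<xi> g > 0" using char_positive .
  obtain k :: nat where k: "k > 0" "g [^] k \<in> K" using pow_mem[OF g(1)] .
  \<comment> \<open>The element \<open>t\<close> of \<open>K\<close> has positive value, and \<open>N\<close> is so large that the steps between the values
    at \<open>\<rho> 0\<close>, \<open>\<rho> 1\<close>, and so on exceed the loss \<open>d\<close> under a differential plus twice the distance
    \<open>c\<close> between levels and levels relative to cosets.\<close>
  define t where "t = g [^] k"
  have t: "t \<in> K" "t \<in> carrier G" "\<xi> t > 0" using g k by (auto simp: t_def char_pow)
  obtain N :: nat where N: "(2 * c + d) / \<xi> t < real N" using reals_Archimedean2 by blast
  then have N: "2 * c + d < real N * \<xi> t" using t(3) by (simp add: field_simps)
  define \<rho> where "\<rho> = (\<lambda>i::nat. t [^] (i * N))"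
  have \<rho>: "\<rho> i \<in> K" "\<xi> (\<rho> i) = real i * (real N * \<xi> t)" for i
  proof -
    have "t [^] j \<in> K" for j :: nat
      by (induction j) (auto simp: t subgroup.one_closed[OF subgroup] subgroup.m_closed[OF subgroup])
    then show "\<rho> i \<in> K" by (simp add: \<rho>_def)
    show "\<xi> (\<rho> i) = real i * (real N * \<xi> t)" using t by (simp add: \<rho>_def char_pow)
  qed
  define F' where "F' = (\<lambda>i. free_mod (coset_level (\<xi> (\<rho> i))) (m i))"
  have F'_bounds: "Fil i (\<xi> (\<rho> i) + c) \<subseteq> F' i" "F' i \<subseteq> Fil i (\<xi> (\<rho> i) - c)" for i
    unfolding F'_def Fil_def using c by auto
  have nonneg: "{k \<in> K. \<xi> k \<ge> 0} \<subseteq> {g \<in> carrier G. \<xi> g \<ge> 0}" "zspan {k \<in> K. \<xi> k \<ge> 0} \<subseteq> ?L"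
    using K_carrier by (auto intro!: zspan_mono)
  have Fil_F: "Fil i r \<subseteq> F i" for i r
    unfolding Fil_def F_def by (rule free_mod_level_subset)
  interpret filt: filtered_resolution "monoid.mult (monoid_ring G)" "frag_of \<one>" ?L nonneg_ring n F dd Z Fil F'
  proof unfold_locales
    show "subring nonneg_ring" by (rule subring_nonneg)
    have "linear_on nonneg_ring (F (Suc i)) (dd i)" if "i < n" for i
      using linear_subring[OF complexD(4)[OF F(1) that] nonneg(2) order_refl] .
    moreover have "submod nonneg_ring (F i)" if "i \<le> n" for i
      using submod_subring[OF complexD(1)[OF F(1) that] nonneg(2)] .
    moreover have "submod nonneg_ring Z" using submod_subring[OF complexD(2)[OF F(1)] nonneg(2)] .
    ultimately show "complex nonneg_ring n F dd Z" using F(1) unfolding complex_def by blast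
    show "exact n F dd Z" by fact
    show "submod nonneg_ring (Fil i r)" for i r
      unfolding Fil_def by (rule submod_level[OF nonneg(1)])
    show "Fil i r \<subseteq> F i" for i r by (rule Fil_F)
    show "Fil i s \<subseteq> Fil i r" if "r \<le> s" for i r s
      unfolding Fil_def by (rule free_mod_level_mono[OF that])
    show "F i \<subseteq> (\<Union>r. Fil i r)" for i
      unfolding F_def Fil_def by (auto elim: free_mod_level_exhaust)
    show "projective nonneg_ring (F' i)" for i
      unfolding F'_def by (rule projective_coset_level[OF \<rho>(1)])
    show "F' i \<subseteq> F i" for i using F'_bounds(2) Fil_F by blast
    show "dd i ` F' (Suc i) \<subseteq> F' i" if "i < n" for i
    proof -
      have "dd i ` F' (Suc i) \<subseteq> dd i ` Fil (Suc i) (\<xi> (\<rho> (Suc i)) - c)"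
        using F'_bounds(2) by (rule image_mono)
      also have "\<dots> \<subseteq> Fil i (\<xi> (\<rho> (Suc i)) - c - d)" using d[OF that] .
      also have "\<dots> \<subseteq> Fil i (\<xi> (\<rho> i) + c)"
        unfolding Fil_def using N by (intro free_mod_level_mono) (simp add: \<rho>(2) algebra_simps)
      also have "\<dots> \<subseteq> F' i" by (rule F'_bounds(1))
      finally show ?thesis .
    qed
    have "Fil i (\<xi> (\<rho> n) + c) \<subseteq> F' i" if "i \<le> n" for i
    proof -
      have "real i * (real N * \<xi> t) \<le> real n * (real N * \<xi> t)"
        using that t(3) by (intro mult_right_mono) auto
      then have "Fil i (\<xi> (\<rho> n) + c) \<subseteq> Fil i (\<xi> (\<rho> i) + c)"
        unfolding Fil_def by (intro free_mod_level_mono) (simp add: \<rho>(2))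
      then show ?thesis using F'_bounds(1) by blast
    qed
    then show "\<exists>c. \<forall>i\<le>n. Fil i c \<subseteq> F' i" by blast
  qed
  have Z: "submod ?L Z" using complexD(2)[OF F(1)] .
  \<comment> \<open>Translation by \<open>s\<close> in \<open>G\<close> shifts levels by \<open>\<xi> s\<close> and commutes with the differentials.\<close>
  have shift: "filt.essentially_acyclic"
    if ex: "\<forall>x\<in>F 0. \<exists>y\<in>Fil 0 b. y - x \<in> Z" "\<forall>i<n. cycles F dd Z i \<inter> F' i \<subseteq> dd i ` Fil (Suc i) b" for b
  proof -
    obtain r0 where r0: "\<And>i. i \<le> n \<Longrightarrow> Fil i r0 \<subseteq> F' i" using filt.F'(4) by blast
    obtain \<tau> where \<tau>: "\<tau> > 0" "\<And>r. \<exists>s\<in>carrier G. r - \<tau> < \<xi> s \<and> \<xi> s \<le> r"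
      using char_value_near by auto
    have sx: "frag_of s \<cdot> frag_of (inv s) \<cdot> x = x" "frag_of s \<in> ?L" "frag_of (inv s) \<in> ?L"
      if "s \<in> carrier G" "x \<in> F i" "i \<le> n" for s x i
      using that act_act[of "frag_of s" "frag_of (inv s)" x] submodD(1)[OF complexD(1)[OF F(1) that(3)]]
      by auto
    have act_Fil: "frag_of s \<cdot> x \<in> Fil i r'" if "s \<in> carrier G" "x \<in> Fil i r" "r' \<le> \<xi> s + r" for s x i r r'
    proof -
      have "frag_of s \<in> level (\<xi> s)" using that(1) by (simp add: level_def)
      then have "frag_of s \<cdot> x \<in> Fil i (\<xi> s + r)" using act_level that(2) unfolding Fil_def by blast
      then show ?thesis using free_mod_level_mono[OF that(3)] unfolding Fil_def by blast
    qed
    \<comment> \<open>Here \<open>s\<close> has \<open>\<xi> s > r - b\<close>, so that it moves level \<open>b\<close> into level \<open>r\<close>.\<close>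
    have "\<exists>y\<in>Fil 0 r. y - x \<in> Z" if x: "x \<in> F 0" for x r
    proof -
      obtain s where s: "s \<in> carrier G" "r - b + \<tau> - \<tau> < \<xi> s" using \<tau>(2) by blast
      have "frag_of (inv s) \<cdot> x \<in> F 0" using submodD(4)[OF complexD(1)[OF F(1)] sx(3)[OF s(1) x]] x by simp
      then obtain y where y: "y \<in> Fil 0 b" "y - frag_of (inv s) \<cdot> x \<in> Z" using ex(1) by blast
      have "frag_of s \<cdot> (y - frag_of (inv s) \<cdot> x) \<in> Z"
        using submodD(4)[OF Z sx(2)[OF s(1) x] y(2)] by simp
      then have "frag_of s \<cdot> y - x \<in> Z" using sx(1)[OF s(1) x] by (simp add: act_diff_right)
      then show ?thesis using act_Fil[OF s(1) y(1), of r] s(2) by (intro bexI[of _ "frag_of s \<cdot> y"]) auto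
    qed
    \<comment> \<open>Here \<open>\<xi> s\<close> is at most \<open>r - r0\<close>, so that the inverse of \<open>s\<close> moves level \<open>r\<close> into level \<open>r0\<close>, and
      exceeds \<open>r - r0 - \<tau>\<close>, so that \<open>s\<close> moves level \<open>b\<close> at least into level \<open>r - r0 - \<tau> + b\<close>.\<close>
    moreover have "cycles F dd Z i \<inter> Fil i r \<subseteq> dd i ` Fil (Suc i) (r - max 0 (r0 + \<tau> - b))" if i: "i < n" for i r
    proof
      fix z assume z: "z \<in> cycles F dd Z i \<inter> Fil i r"
      obtain s where s: "s \<in> carrier G" "r - r0 - \<tau> < \<xi> s" "\<xi> s \<le> r - r0" using \<tau>(2) by blast
      have zF: "z \<in> F i" using z Fil_F by blast
      have "frag_of (inv s) \<cdot> z \<in> cycles F dd Z i"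
        using submodD(4)[OF submod_cycles[OF F(1)] sx(3)[OF s(1) zF]] i z by simp
      moreover have "frag_of (inv s) \<cdot> z \<in> Fil i r0"
        using act_Fil[of "inv s" z i r r0] s z by (simp add: char_inv)
      then have "frag_of (inv s) \<cdot> z \<in> F' i" using r0[of i] i by auto
      ultimately obtain w where w: "w \<in> Fil (Suc i) b" "frag_of (inv s) \<cdot> z = dd i w"
        using ex(2) i by blast
      have wF: "w \<in> F (Suc i)" using w(1) Fil_F by blast
      have "z = frag_of s \<cdot> dd i w" using sx(1)[OF s(1) zF] w(2) i by simp
      also have "\<dots> = dd i (frag_of s \<cdot> w)"
        using complexD(4)[OF F(1) i] sx(2)[OF s(1) wF] wF i unfolding linear_on_def by auto
      finally show "z \<in> dd i ` Fil (Suc i) (r - max 0 (r0 + \<tau> - b))"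
        using act_Fil[OF s(1) w(1), of "r - max 0 (r0 + \<tau> - b)"] s(2) by auto
    qed
    ultimately show ?thesis
      unfolding filt.essentially_acyclic_def by (intro exI[of _ "max 0 (r0 + \<tau> - b)"]) auto
  qed
  have "(\<exists>p D \<pi>. resolves nonneg_ring n (F 0) Z p D \<pi>) \<longleftrightarrow> filt.essentially_acyclic"
    using filt.essentially_acyclic_imp_resolves filt.resolves_imp_bounded_filling shift by blast
  then show ?thesis unfolding filt.essentially_acyclic_def unfolding Fil_def .
qed

end

section \<open>Finitely generated free modules in coordinates\<close>

context left_module
begin

lemma smult_zero_left: "x \<in> carrier M \<Longrightarrow> \<zero>\<^bsub>R\<^esub> \<odot>\<^bsub>M\<^esub> x = \<zero>\<^bsub>M\<^esub>"
  using smult_l_distr[of "\<zero>\<^bsub>R\<^esub>" "\<zero>\<^bsub>R\<^esub>" x] smult_closed[of "\<zero>\<^bsub>R\<^esub>" x]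
  by (simp add: M.add.l_cancel_one')

lemma smult_zero_right: "a \<in> carrier R \<Longrightarrow> a \<odot>\<^bsub>M\<^esub> \<zero>\<^bsub>M\<^esub> = \<zero>\<^bsub>M\<^esub>"
  using smult_r_distr[of a "\<zero>\<^bsub>M\<^esub>" "\<zero>\<^bsub>M\<^esub>"] smult_closed[of a "\<zero>\<^bsub>M\<^esub>"]
  by (simp add: M.add.l_cancel_one')

lemma smult_finsum:
  assumes "finite I" "a \<in> carrier R" "f \<in> I \<rightarrow> carrier M"
  shows "a \<odot>\<^bsub>M\<^esub> (\<Oplus>\<^bsub>M\<^esub>i\<in>I. f i) = (\<Oplus>\<^bsub>M\<^esub>i\<in>I. a \<odot>\<^bsub>M\<^esub> f i)"
  using assms
proof (induction I rule: finite_induct)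
  case (insert i I)
  have "(\<Oplus>\<^bsub>M\<^esub>i\<in>insert i I. f i) = f i \<oplus>\<^bsub>M\<^esub> (\<Oplus>\<^bsub>M\<^esub>i\<in>I. f i)"
    using insert by (intro M.finsum_insert) auto
  moreover have "(\<Oplus>\<^bsub>M\<^esub>i\<in>insert i I. a \<odot>\<^bsub>M\<^esub> f i) = a \<odot>\<^bsub>M\<^esub> f i \<oplus>\<^bsub>M\<^esub> (\<Oplus>\<^bsub>M\<^esub>i\<in>I. a \<odot>\<^bsub>M\<^esub> f i)"
    using insert smult_closed by (intro M.finsum_insert) (auto simp: Pi_iff)
  moreover have "(\<Oplus>\<^bsub>M\<^esub>i\<in>I. f i) \<in> carrier M" using insert by (intro M.finsum_closed) auto
  ultimately show ?case using insert by (auto simp: smult_r_distr)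
qed (simp add: smult_zero_right)

definition coordinates :: "'m set \<Rightarrow> 'm \<Rightarrow> ('m \<Rightarrow> 'r) \<Rightarrow> bool"
  where "coordinates B x c \<longleftrightarrow> c \<in> B \<rightarrow>\<^sub>E carrier R \<and> finite {b \<in> B. c b \<noteq> \<zero>\<^bsub>R\<^esub>} \<and>
    x = (\<Oplus>\<^bsub>M\<^esub>b\<in>{b \<in> B. c b \<noteq> \<zero>\<^bsub>R\<^esub>}. c b \<odot>\<^bsub>M\<^esub> b)"

lemma finsum_support:
  assumes "B \<subseteq> carrier M" "c \<in> B \<rightarrow> carrier R" "finite U" "{b \<in> B. c b \<noteq> \<zero>\<^bsub>R\<^esub>} \<subseteq> U" "U \<subseteq> B"
  shows "(\<Oplus>\<^bsub>M\<^esub>b\<in>{b \<in> B. c b \<noteq> \<zero>\<^bsub>R\<^esub>}. c b \<odot>\<^bsub>M\<^esub> b) = (\<Oplus>\<^bsub>M\<^esub>b\<in>U. c b \<odot>\<^bsub>M\<^esub> b)"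
proof (rule M.add.finprod_mono_neutral_cong_left[OF assms(3,4)])
  fix b assume "b \<in> U - {b \<in> B. c b \<noteq> \<zero>\<^bsub>R\<^esub>}"
  then have "c b = \<zero>\<^bsub>R\<^esub>" "b \<in> carrier M" using assms by auto
  then show "c b \<odot>\<^bsub>M\<^esub> b = \<zero>\<^bsub>M\<^esub>" by (simp add: smult_zero_left)
qed (use assms smult_closed in \<open>auto simp: Pi_iff subset_iff\<close>)

lemma coordinatesI:
  assumes "B \<subseteq> carrier M" "c \<in> B \<rightarrow>\<^sub>E carrier R" "finite U" "{b \<in> B. c b \<noteq> \<zero>\<^bsub>R\<^esub>} \<subseteq> U" "U \<subseteq> B"
    "x = (\<Oplus>\<^bsub>M\<^esub>b\<in>U. c b \<odot>\<^bsub>M\<^esub> b)"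
  shows "coordinates B x c"
  unfolding coordinates_def using assms finsum_support[OF assms(1) _ assms(3-5)] finite_subset[OF assms(4,3)]
  by (auto simp: PiE_def)

lemma coordinates_add:
  assumes B: "B \<subseteq> carrier M" and c: "coordinates B x c" "coordinates B y d"
  shows "coordinates B (x \<oplus>\<^bsub>M\<^esub> y) (\<lambda>b\<in>B. c b \<oplus>\<^bsub>R\<^esub> d b)"
proof -
  let ?U = "{b \<in> B. c b \<noteq> \<zero>\<^bsub>R\<^esub>} \<union> {b \<in> B. d b \<noteq> \<zero>\<^bsub>R\<^esub>}"
  have fin: "finite ?U" using c unfolding coordinates_def by auto
  have cB: "c b \<in> carrier R" "d b \<in> carrier R" if "b \<in> B" for b
    using c that unfolding coordinates_def by auto
  have BM: "b \<in> carrier M" if "b \<in> B" for b using B that by auto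
  have "x = (\<Oplus>\<^bsub>M\<^esub>b\<in>?U. c b \<odot>\<^bsub>M\<^esub> b)" "y = (\<Oplus>\<^bsub>M\<^esub>b\<in>?U. d b \<odot>\<^bsub>M\<^esub> b)"
    using c cB finsum_support[OF B _ fin, of c] finsum_support[OF B _ fin, of d]
    unfolding coordinates_def by auto
  then have "x \<oplus>\<^bsub>M\<^esub> y = (\<Oplus>\<^bsub>M\<^esub>b\<in>?U. c b \<odot>\<^bsub>M\<^esub> b) \<oplus>\<^bsub>M\<^esub> (\<Oplus>\<^bsub>M\<^esub>b\<in>?U. d b \<odot>\<^bsub>M\<^esub> b)"
    by (rule arg_cong2)
  also have "\<dots> = (\<Oplus>\<^bsub>M\<^esub>b\<in>?U. c b \<odot>\<^bsub>M\<^esub> b \<oplus>\<^bsub>M\<^esub> d b \<odot>\<^bsub>M\<^esub> b)"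
    using cB BM smult_closed by (intro M.finsum_addf[symmetric]) auto
  also have "\<dots> = (\<Oplus>\<^bsub>M\<^esub>b\<in>?U. (\<lambda>b\<in>B. c b \<oplus>\<^bsub>R\<^esub> d b) b \<odot>\<^bsub>M\<^esub> b)"
    using cB BM smult_closed by (intro M.finsum_cong') (auto simp: smult_l_distr)
  finally have "x \<oplus>\<^bsub>M\<^esub> y = (\<Oplus>\<^bsub>M\<^esub>b\<in>?U. (\<lambda>b\<in>B. c b \<oplus>\<^bsub>R\<^esub> d b) b \<odot>\<^bsub>M\<^esub> b)" .
  moreover have "{b \<in> B. (\<lambda>b\<in>B. c b \<oplus>\<^bsub>R\<^esub> d b) b \<noteq> \<zero>\<^bsub>R\<^esub>} \<subseteq> ?U" by auto
  moreover have "(\<lambda>b\<in>B. c b \<oplus>\<^bsub>R\<^esub> d b) \<in> B \<rightarrow>\<^sub>E carrier R" using cB by auto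
  moreover have "?U \<subseteq> B" by auto
  ultimately show ?thesis using coordinatesI[OF B _ fin] by blast
qed

lemma coordinates_smult:
  assumes B: "B \<subseteq> carrier M" and c: "coordinates B x c" and a: "a \<in> carrier R"
  shows "coordinates B (a \<odot>\<^bsub>M\<^esub> x) (\<lambda>b\<in>B. a \<otimes>\<^bsub>R\<^esub> c b)"
proof -
  let ?U = "{b \<in> B. c b \<noteq> \<zero>\<^bsub>R\<^esub>}"
  have fin: "finite ?U" and x: "x = (\<Oplus>\<^bsub>M\<^esub>b\<in>?U. c b \<odot>\<^bsub>M\<^esub> b)"
    using c unfolding coordinates_def by auto
  have cB: "c b \<in> carrier R" if "b \<in> B" for b
    using c that unfolding coordinates_def by auto
  have BM: "b \<in> carrier M" if "b \<in> B" for b using B that by auto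
  have "a \<odot>\<^bsub>M\<^esub> x = (\<Oplus>\<^bsub>M\<^esub>b\<in>?U. a \<odot>\<^bsub>M\<^esub> (c b \<odot>\<^bsub>M\<^esub> b))"
    unfolding x using fin a cB BM smult_closed by (intro smult_finsum) auto
  also have "\<dots> = (\<Oplus>\<^bsub>M\<^esub>b\<in>?U. (\<lambda>b\<in>B. a \<otimes>\<^bsub>R\<^esub> c b) b \<odot>\<^bsub>M\<^esub> b)"
    using a cB BM smult_closed by (intro M.finsum_cong') (auto simp: smult_assoc)
  finally have "a \<odot>\<^bsub>M\<^esub> x = (\<Oplus>\<^bsub>M\<^esub>b\<in>?U. (\<lambda>b\<in>B. a \<otimes>\<^bsub>R\<^esub> c b) b \<odot>\<^bsub>M\<^esub> b)" .
  moreover have "{b \<in> B. (\<lambda>b\<in>B. a \<otimes>\<^bsub>R\<^esub> c b) b \<noteq> \<zero>\<^bsub>R\<^esub>} \<subseteq> ?U" using a by auto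
  moreover have "(\<lambda>b\<in>B. a \<otimes>\<^bsub>R\<^esub> c b) \<in> B \<rightarrow>\<^sub>E carrier R" using a cB by auto
  moreover have "?U \<subseteq> B" by auto
  ultimately show ?thesis using coordinatesI[OF B _ fin] by blast
qed

lemma coordinates_basis_element:
  assumes "B \<subseteq> carrier M" "b \<in> B"
  shows "coordinates B b (\<lambda>b'\<in>B. if b' = b then \<one>\<^bsub>R\<^esub> else \<zero>\<^bsub>R\<^esub>)"
  by (rule coordinatesI[OF assms(1), where U = "{b}"]) (use assms smult_one in \<open>auto simp: subset_iff\<close>)

lemma coordinates_zero:
  assumes "B \<subseteq> carrier M" shows "coordinates B \<zero>\<^bsub>M\<^esub> (\<lambda>b\<in>B. \<zero>\<^bsub>R\<^esub>)"
  by (rule coordinatesI[OF assms, where U = "{}"]) auto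

text \<open>The finitely many generators involve only a finite set \<open>U\<close> of basis elements, so every element has an
  expansion supported in \<open>U\<close>.  By uniqueness this holds for the expansion of a basis element \<open>b\<close> as
  \<open>1 b\<close>, and \<open>1 \<noteq> 0\<close> gives that \<open>b\<close> is in \<open>U\<close>.\<close>

lemma finite_basis:
  assumes BM: "B \<subseteq> carrier M" and B: "\<forall>x\<in>carrier M. \<exists>!c. coordinates B x c"
    and S: "finite S" "S \<subseteq> carrier M" "\<forall>x\<in>carrier M. \<exists>c\<in>S \<rightarrow> carrier R. x = (\<Oplus>\<^bsub>M\<^esub>s\<in>S. c s \<odot>\<^bsub>M\<^esub> s)"
    and "\<one>\<^bsub>R\<^esub> \<noteq> \<zero>\<^bsub>R\<^esub>"
  shows "finite B"
proof -
  have "\<forall>s\<in>S. \<exists>c. coordinates B s c"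
    using S(2) B by blast
  then obtain C where C: "\<And>s. s \<in> S \<Longrightarrow> coordinates B s (C s)" by metis
  define U where "U = (\<Union>s\<in>S. {b \<in> B. C s b \<noteq> \<zero>\<^bsub>R\<^esub>})"
  have U: "finite U" unfolding U_def using S(1) C unfolding coordinates_def by auto
  have "\<exists>c. coordinates B (\<Oplus>\<^bsub>M\<^esub>s\<in>T. a s \<odot>\<^bsub>M\<^esub> s) c \<and> {b \<in> B. c b \<noteq> \<zero>\<^bsub>R\<^esub>} \<subseteq> U"
    if "finite T" "T \<subseteq> S" "a \<in> S \<rightarrow> carrier R" for T a
    using that
  proof (induction T rule: finite_induct)
    case empty
    have "{b \<in> B. (\<lambda>b\<in>B. \<zero>\<^bsub>R\<^esub>) b \<noteq> \<zero>\<^bsub>R\<^esub>} \<subseteq> U" by auto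
    then show ?case unfolding M.finsum_empty using coordinates_zero[OF BM] by blast
  next
    case (insert s T)
    then obtain c where c: "coordinates B (\<Oplus>\<^bsub>M\<^esub>s\<in>T. a s \<odot>\<^bsub>M\<^esub> s) c" "{b \<in> B. c b \<noteq> \<zero>\<^bsub>R\<^esub>} \<subseteq> U" by auto
    have s: "s \<in> S" "a s \<in> carrier R" using insert by auto
    let ?d = "\<lambda>b\<in>B. a s \<otimes>\<^bsub>R\<^esub> C s b"
    let ?e = "\<lambda>b\<in>B. ?d b \<oplus>\<^bsub>R\<^esub> c b"
    have eq: "(\<Oplus>\<^bsub>M\<^esub>s\<in>insert s T. a s \<odot>\<^bsub>M\<^esub> s) = a s \<odot>\<^bsub>M\<^esub> s \<oplus>\<^bsub>M\<^esub> (\<Oplus>\<^bsub>M\<^esub>s\<in>T. a s \<odot>\<^bsub>M\<^esub> s)"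
      using insert S(2) smult_closed by (intro M.finsum_insert) (auto simp: Pi_iff subset_iff)
    have "coordinates B (\<Oplus>\<^bsub>M\<^esub>s\<in>insert s T. a s \<odot>\<^bsub>M\<^esub> s) ?e"
      unfolding eq by (rule coordinates_add[OF BM coordinates_smult[OF BM C[OF s(1)] s(2)] c(1)])
    moreover have "{b \<in> B. ?e b \<noteq> \<zero>\<^bsub>R\<^esub>} \<subseteq> U"
      using c(2) s by (auto simp: U_def)
    ultimately show ?case by blast
  qed
  note span = this[OF S(1) order_refl]
  have ex: "\<exists>c. coordinates B x c \<and> {b \<in> B. c b \<noteq> \<zero>\<^bsub>R\<^esub>} \<subseteq> U" if x: "x \<in> carrier M" for x
  proof -
    obtain a where a: "a \<in> S \<rightarrow> carrier R" "x = (\<Oplus>\<^bsub>M\<^esub>s\<in>S. a s \<odot>\<^bsub>M\<^esub> s)" using S(3) x by blast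
    show ?thesis unfolding a(2) by (rule span[OF a(1)])
  qed
  have "B \<subseteq> U"
  proof
    fix b assume b: "b \<in> B"
    then obtain c where c: "coordinates B b c" "{b \<in> B. c b \<noteq> \<zero>\<^bsub>R\<^esub>} \<subseteq> U" using ex BM by blast
    have "c = (\<lambda>b'\<in>B. if b' = b then \<one>\<^bsub>R\<^esub> else \<zero>\<^bsub>R\<^esub>)"
      using B c(1) coordinates_basis_element[OF BM b] b BM by blast
    then show "b \<in> U" using c(2) b assms(6) by auto
  qed
  then show ?thesis using U finite_subset by auto
qed

end

text \<open>The set that \<open>\<kappa>\<close> maps onto is the free module of rank \<open>m\<close> in the form used for complexes of vectors.\<close>

lemma nat_indexed_coordinates:
  fixes R :: "('r::ab_group_add, 'c) ring_scheme" and M :: "('r, 'm) module"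
  assumes R: "\<zero>\<^bsub>R\<^esub> = 0" "add R = (+)" "\<one>\<^bsub>R\<^esub> \<noteq> \<zero>\<^bsub>R\<^esub>"
    and M: "free_module R M" "finitely_generated_module R M"
  obtains m :: nat and \<kappa> :: "'m \<Rightarrow> nat \<Rightarrow> 'r" where
    "bij_betw \<kappa> (carrier M) {f. (\<forall>i<m. f i \<in> carrier R) \<and> (\<forall>i\<ge>m. f i = 0)}"
    "\<And>x y. x \<in> carrier M \<Longrightarrow> y \<in> carrier M \<Longrightarrow> \<kappa> (x \<oplus>\<^bsub>M\<^esub> y) = \<kappa> x + \<kappa> y"
    "\<And>a x. a \<in> carrier R \<Longrightarrow> x \<in> carrier M \<Longrightarrow> \<kappa> (a \<odot>\<^bsub>M\<^esub> x) = (\<lambda>i. a \<otimes>\<^bsub>R\<^esub> \<kappa> x i)"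
proof -
  interpret left_module R M using M(1) unfolding free_module_def by simp
  obtain B where B: "module_basis R M B" using M(1) unfolding free_module_def by auto
  have BM: "B \<subseteq> carrier M" using B unfolding module_basis_def by simp
  have B: "\<forall>x\<in>carrier M. \<exists>!c. coordinates B x c"
    using B unfolding module_basis_def coordinates_def by blast
  obtain S where "finite S" "S \<subseteq> carrier M"
    "\<forall>x\<in>carrier M. \<exists>c\<in>S \<rightarrow> carrier R. x = (\<Oplus>\<^bsub>M\<^esub>s\<in>S. c s \<odot>\<^bsub>M\<^esub> s)"
    using M(2) unfolding finitely_generated_module_def by auto
  then have fin: "finite B" using finite_basis[OF BM B _ _ _ R(3)] by blast
  define m where "m = card B"
  obtain h where h: "bij_betw h {..<m} B"
    using ex_bij_betw_nat_finite[OF fin] by (auto simp: m_def lessThan_atLeast0)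
  have hB: "h l \<in> B" if "l < m" for l using h that by (auto simp: bij_betw_def)
  define C where "C = (\<lambda>x. THE c. coordinates B x c)"
  have C_eq: "C x = c" if "coordinates B x c" "x \<in> carrier M" for x c
    unfolding C_def using that B by blast
  have C: "coordinates B x (C x)" if "x \<in> carrier M" for x
    using B that C_eq[OF _ that] by metis
  define \<kappa> where "\<kappa> = (\<lambda>x l. if l < m then C x (h l) else 0)"
  let ?F = "{f. (\<forall>i<m. f i \<in> carrier R) \<and> (\<forall>i\<ge>m. f i = 0)}"
  have "\<kappa> x \<in> ?F" if "x \<in> carrier M" for x
    using C[OF that] hB unfolding coordinates_def \<kappa>_def by auto
  moreover have "inj_on \<kappa> (carrier M)"
  proof (rule inj_onI)
    fix x y assume xy: "x \<in> carrier M" "y \<in> carrier M" "\<kappa> x = \<kappa> y"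
    have eq: "C x b = C y b" if b: "b \<in> B" for b
    proof -
      obtain l where "l < m" "b = h l" using h b by (auto simp: bij_betw_def)
      then show ?thesis using fun_cong[OF xy(3), of l] by (simp add: \<kappa>_def)
    qed
    have "C x \<in> B \<rightarrow>\<^sub>E carrier R" "C y \<in> B \<rightarrow>\<^sub>E carrier R"
      using C[OF xy(1)] C[OF xy(2)] unfolding coordinates_def by blast+
    then have "C x = C y" using eq by (rule PiE_ext)
    then show "x = y" using C[OF xy(1)] C[OF xy(2)] unfolding coordinates_def by simp
  qed
  moreover have "f \<in> \<kappa> ` carrier M" if f: "f \<in> ?F" for f
  proof -
    define c where "c = (\<lambda>b\<in>B. f (inv_into {..<m} h b))"
    have inv: "inv_into {..<m} h b < m" if "b \<in> B" for b
      using inv_into_into[of b h "{..<m}"] h that by (auto simp: bij_betw_def)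
    have c: "c \<in> B \<rightarrow>\<^sub>E carrier R" using f inv by (auto simp: c_def)
    define x where "x = (\<Oplus>\<^bsub>M\<^esub>b\<in>B. c b \<odot>\<^bsub>M\<^esub> b)"
    have x: "x \<in> carrier M"
      unfolding x_def using c BM smult_closed by (intro M.finsum_closed) (auto simp: Pi_iff PiE_iff subset_iff)
    have "coordinates B x c" by (rule coordinatesI[OF BM c fin]) (auto simp: x_def)
    then have "C x = c" using C_eq x by simp
    then have "\<kappa> x = f"
      using f h by (auto simp: \<kappa>_def c_def fun_eq_iff bij_betw_def hB inv_into_f_f not_less)
    then show ?thesis using x by auto
  qed
  ultimately have "bij_betw \<kappa> (carrier M) ?F" unfolding bij_betw_def by blast
  moreover have "\<kappa> (x \<oplus>\<^bsub>M\<^esub> y) = \<kappa> x + \<kappa> y" if "x \<in> carrier M" "y \<in> carrier M" for x y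
    using C_eq[OF coordinates_add[OF BM C[OF that(1)] C[OF that(2)]]] that hB R
    by (auto simp: \<kappa>_def fun_eq_iff pointwise)
  moreover have "\<kappa> (a \<odot>\<^bsub>M\<^esub> x) = (\<lambda>i. a \<otimes>\<^bsub>R\<^esub> \<kappa> x i)" if "a \<in> carrier R" "x \<in> carrier M" for a x
    using C_eq[OF coordinates_smult[OF BM C[OF that(2)] that(1)]] that hB R smult_closed R.r_null[OF that(1)]
    by (auto simp: \<kappa>_def fun_eq_iff)
  ultimately show ?thesis using that[of \<kappa> m] by blast
qed

section \<open>Free modules of finitely supported functions on words\<close>

text \<open>Each entry is announced by \<open>z\<close> and the end of the word by \<open>e\<close>.  For \<open>z \<noteq> e\<close> this is a prefix-free code,
  so that a list of words can be recovered from the concatenation of their codes.\<close>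

fun word_code :: "'x \<Rightarrow> 'x \<Rightarrow> 'x list \<Rightarrow> 'x list"
  where "word_code z e [] = [e]" | "word_code z e (x # xs) = z # x # word_code z e xs"

lemma word_code_prefix_free:
  assumes "z \<noteq> e"
  shows "word_code z e xs @ us = word_code z e ys @ vs \<longleftrightarrow> xs = ys \<and> us = vs"
proof (induction xs arbitrary: ys)
  case Nil
  show ?case using assms by (cases ys) auto
next
  case (Cons x xs)
  show ?case using assms Cons by (cases ys) auto
qed

lemma words_code_inj:
  assumes "z \<noteq> e"
  shows "concat (map (word_code z e) xss) = concat (map (word_code z e) yss) \<longleftrightarrow> xss = yss"
proof (induction xss arbitrary: yss)
  case Nil
  have "word_code z e ys \<noteq> []" for ys by (cases ys) auto
  then show ?case by (cases yss) auto
next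
  case (Cons xs xss)
  have "word_code z e xs \<noteq> []" by (cases xs) auto
  then show ?case using word_code_prefix_free[OF assms] Cons by (cases yss) auto
qed

text \<open>In a resolution by free modules of functions on words, a kernel is covered by the free module
  on its elements, which are themselves functions on words; the encoding turns them back into words.
  A finitely supported function is determined by its finite graph, which is a list of pairs of a word
  and a value, and each pair is in turn a word.\<close>

lemma finitely_supported_encoding:
  fixes z e :: "'r::zero"
  assumes "z \<noteq> e"
  obtains \<iota> :: "(('r + 'm) list \<Rightarrow> 'r) \<Rightarrow> ('r + 'm) list" where "inj_on \<iota> {f. finite {k. f k \<noteq> 0}}"
proof -
  define graph where "graph = (\<lambda>f :: ('r + 'm) list \<Rightarrow> 'r. SOME xs. set xs = (\<lambda>k. (k, f k)) ` {k. f k \<noteq> 0})"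
  have graph: "set (graph f) = (\<lambda>k. (k, f k)) ` {k. f k \<noteq> 0}" if "finite {k. f k \<noteq> 0}" for f
    unfolding graph_def by (rule someI_ex, rule finite_list) (use that in auto)
  define flat where "flat = (\<lambda>xs :: (('r + 'm) list \<times> 'r) list. map (\<lambda>(l, r). Inl r # l) xs)"
  have flat: "inj flat"
    unfolding flat_def by (rule inj_mapI) (auto intro: injI)
  define \<iota> where "\<iota> = (\<lambda>f. concat (map (word_code (Inl z) (Inl e)) (flat (graph f))))"
  have "inj_on \<iota> {f. finite {k. f k \<noteq> 0}}"
  proof (rule inj_onI)
    fix f g :: "('r + 'm) list \<Rightarrow> 'r"
    assume fg: "f \<in> {f. finite {k. f k \<noteq> 0}}" "g \<in> {f. finite {k. f k \<noteq> 0}}" "\<iota> f = \<iota> g"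
    then have "flat (graph f) = flat (graph g)"
      unfolding \<iota>_def using words_code_inj[of "Inl z :: 'r + 'm" "Inl e"] assms by simp
    then have "graph f = graph g" using flat by (simp add: inj_eq)
    then have eq: "(\<lambda>k. (k, f k)) ` {k. f k \<noteq> 0} = (\<lambda>k. (k, g k)) ` {k. g k \<noteq> 0}"
      using graph[of f] graph[of g] fg(1,2) by simp
    show "f = g"
    proof
      fix k
      have "f k \<noteq> 0 \<Longrightarrow> (k, f k) \<in> (\<lambda>k. (k, g k)) ` {k. g k \<noteq> 0}" using eq by blast
      moreover have "g k \<noteq> 0 \<Longrightarrow> (k, g k) \<in> (\<lambda>k. (k, f k)) ` {k. f k \<noteq> 0}" using eq by blast
      ultimately show "f k = g k" by (cases "f k = 0"; cases "g k = 0") auto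
    qed
  qed
  then show ?thesis by (rule that)
qed

context group_ring
begin

definition submonoid_ring :: "'g set \<Rightarrow> ('g \<Rightarrow>\<^sub>0 int) ring"
  where "submonoid_ring S = monoid_ring (G\<lparr>carrier := S\<rparr>)"

lemma submonoid_ring_simps [simp]:
  "carrier (submonoid_ring S) = zspan S" "monoid.mult (submonoid_ring S) = monoid.mult (monoid_ring G)"
  "\<one>\<^bsub>submonoid_ring S\<^esub> = frag_of \<one>" "\<zero>\<^bsub>submonoid_ring S\<^esub> = 0" "add (submonoid_ring S) = (+)"
  by (auto simp: submonoid_ring_def monoid_ring_def zspan_def fun_eq_iff)

lemma zspan_L: "subring (zspan S) \<Longrightarrow> x \<in> zspan S \<Longrightarrow> x \<in> zspan (carrier G)"
  using subringD(1) by blast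

lemma ring_submonoid_ring:
  assumes S: "subring (zspan S)" shows "ring (submonoid_ring S)"
proof (rule ringI)
  show "abelian_group (submonoid_ring S)"
    by (rule abelian_groupI) (auto simp: zspan_add algebra_simps intro: bexI[of _ "- _"] zspan_uminus)
  show "monoid (submonoid_ring S)"
    by (rule monoidI)
       (auto simp: subringD[OF S] subringD(3)[OF S, simplified] mul_assoc mul_one_left mul_one_right zspan_L[OF S])
qed (auto simp: mult_monoid_ring_add_left mult_monoid_ring_add_right)

definition as_module :: "('i \<Rightarrow> 'g \<Rightarrow>\<^sub>0 int) set \<Rightarrow> ('g \<Rightarrow>\<^sub>0 int, 'i \<Rightarrow> 'g \<Rightarrow>\<^sub>0 int) module"
  where "as_module X = \<lparr>carrier = X, monoid.mult = undefined, monoid.one = undefined,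
     ring.zero = 0, ring.add = (+), module.smult = act\<rparr>"

lemma as_module_simps [simp]:
  "carrier (as_module X) = X" "\<zero>\<^bsub>as_module X\<^esub> = 0" "add (as_module X) = (+)" "smult (as_module X) = act"
  by (auto simp: as_module_def)

lemma left_module_as_module:
  assumes S: "subring (zspan S)" and X: "submod (zspan S) X"
  shows "left_module (submonoid_ring S) (as_module X)"
proof -
  interpret ring "submonoid_ring S" using ring_submonoid_ring[OF S] .
  have "abelian_group (as_module X)"
    by (rule abelian_groupI)
       (auto simp: submodD[OF X] algebra_simps intro!: bexI[of _ "- _"] submod_uminus[OF S X])
  moreover have "x \<in> vec" if "x \<in> X" for x using that submodD(1)[OF X] by auto
  ultimately show ?thesis
    unfolding left_module_def left_module_axioms_def
    using ring_submonoid_ring[OF S]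
    by (auto simp: submodD[OF X] act_add_left act_add_right act_act zspan_L[OF S])
qed

lemma finsum_as_module:
  assumes X: "submod (zspan S) X" "subring (zspan S)" and "finite I" "f \<in> I \<rightarrow> X"
  shows "finsum (as_module X) f I = sum f I"
proof -
  interpret left_module "submonoid_ring S" "as_module X" using left_module_as_module[OF X(2,1)] .
  show ?thesis
    using assms(3,4)
  proof (induction I rule: finite_induct)
    case (insert i I)
    have "finsum (as_module X) f (insert i I) = f i \<oplus>\<^bsub>as_module X\<^esub> finsum (as_module X) f I"
      using insert by (intro M.finsum_insert) auto
    then show ?case using insert by simp
  qed simp
qed

definition finsupp :: "'g set \<Rightarrow> 'i set \<Rightarrow> ('i \<Rightarrow> 'g \<Rightarrow>\<^sub>0 int) set"
  where "finsupp S B = {f. finite {k. f k \<noteq> 0} \<and> {k. f k \<noteq> 0} \<subseteq> B \<and> (\<forall>k. f k \<in> zspan S)}"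

definition unit_vec :: "'i \<Rightarrow> 'i \<Rightarrow> 'g \<Rightarrow>\<^sub>0 int"
  where "unit_vec b = (\<lambda>k. if k = b then frag_of \<one> else 0)"

lemma submod_finsupp:
  assumes "subring (zspan S)" shows "submod (zspan S) (finsupp S B)"
  unfolding submod_def
proof (intro conjI ballI)
  show "finsupp S B \<subseteq> vec" using zspan_L[OF assms] by (auto simp: finsupp_def vec_def)
  show "0 \<in> finsupp S B" by (simp add: finsupp_def pointwise)
next
  fix x y assume "x \<in> finsupp S B" "y \<in> finsupp S B"
  moreover have "{k. (x + y) k \<noteq> 0} \<subseteq> {k. x k \<noteq> 0} \<union> {k. y k \<noteq> 0}" by (auto simp: pointwise)
  ultimately show "x + y \<in> finsupp S B"
    unfolding finsupp_def by (auto simp: zspan_add pointwise intro: finite_subset)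
next
  fix a x assume "a \<in> zspan S" "x \<in> finsupp S B"
  moreover have "{k. (a \<cdot> x) k \<noteq> 0} \<subseteq> {k. x k \<noteq> 0}" by (auto simp: act_def)
  ultimately show "a \<cdot> x \<in> finsupp S B"
    unfolding finsupp_def using subringD(6)[OF assms] by (auto simp: act_def intro: finite_subset)
qed

lemma unit_vec_mem: "subring (zspan S) \<Longrightarrow> b \<in> B \<Longrightarrow> unit_vec b \<in> finsupp S B"
  using subringD(3)[of "zspan S"] by (auto simp: finsupp_def unit_vec_def)

lemma inj_unit_vec: "inj unit_vec"
  by (rule injI) (metis unit_vec_def frag_of_nonzero)

lemma sum_unit_vec:
  assumes "finite U" "\<And>b. b \<in> U \<Longrightarrow> c b \<in> zspan (carrier G)"
  shows "(\<Sum>b\<in>U. c b \<cdot> unit_vec b) = (\<lambda>k. if k \<in> U then c k else 0)"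
proof
  fix k
  have "(\<Sum>b\<in>U. c b \<cdot> unit_vec b) k = (\<Sum>b\<in>U. if k = b then c b else 0)"
    unfolding sum_fun_apply using assms(2) mul_one_right by (intro sum.cong) (auto simp: act_def unit_vec_def)
  then show "(\<Sum>b\<in>U. c b \<cdot> unit_vec b) k = (if k \<in> U then c k else 0)" using assms(1) by simp
qed

lemma free_module_finsupp:
  fixes B :: "'i set"
  assumes S: "subring (zspan S)"
  shows "free_module (submonoid_ring S) (as_module (finsupp S B))"
proof -
  let ?R = "submonoid_ring S" and ?M = "as_module (finsupp S B)"
  have X: "submod (zspan S) (finsupp S B)" using submod_finsupp[OF S] .
  have fs: "finsum ?M (\<lambda>v. c v \<cdot> v) {v \<in> unit_vec ` B. c v \<noteq> 0} =
      (\<lambda>k. if k \<in> B then c (unit_vec k) else 0)"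
    if c: "c \<in> unit_vec ` B \<rightarrow>\<^sub>E zspan S" "finite {v \<in> unit_vec ` B. c v \<noteq> 0}" for c :: "('i \<Rightarrow> 'g \<Rightarrow>\<^sub>0 int) \<Rightarrow> 'g \<Rightarrow>\<^sub>0 int"
  proof -
    let ?U = "{b \<in> B. c (unit_vec b) \<noteq> 0}"
    have U: "{v \<in> unit_vec ` B. c v \<noteq> 0} = unit_vec ` ?U" by auto
    have inj: "inj_on unit_vec ?U" using inj_unit_vec by (rule inj_on_subset) auto
    have fin: "finite ?U" using c(2) unfolding U using inj by (rule finite_imageD)
    have "finsum ?M (\<lambda>v. c v \<cdot> v) {v \<in> unit_vec ` B. c v \<noteq> 0} = (\<Sum>v\<in>unit_vec ` ?U. c v \<cdot> v)"
      unfolding U using c(1) fin unit_vec_mem[OF S, of _ B] submodD(4)[OF X]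
      by (intro finsum_as_module[OF X S]) (auto simp: PiE_iff)
    also have "\<dots> = (\<Sum>b\<in>?U. c (unit_vec b) \<cdot> unit_vec b)"
      using sum.reindex[OF inj] by simp
    also have "\<dots> = (\<lambda>k. if k \<in> ?U then c (unit_vec k) else 0)"
      using c(1) zspan_L[OF S] fin by (intro sum_unit_vec) (auto simp: PiE_iff)
    also have "\<dots> = (\<lambda>k. if k \<in> B then c (unit_vec k) else 0)" by auto
    finally show ?thesis .
  qed
  have "\<exists>!c. c \<in> unit_vec ` B \<rightarrow>\<^sub>E zspan S \<and> finite {v \<in> unit_vec ` B. c v \<noteq> 0} \<and>
      x = finsum ?M (\<lambda>v. c v \<cdot> v) {v \<in> unit_vec ` B. c v \<noteq> 0}" if x: "x \<in> finsupp S B" for x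
  proof (rule ex_ex1I)
    define c where "c = (\<lambda>v\<in>unit_vec ` B. x (inv_into UNIV unit_vec v))"
    have cu: "c (unit_vec b) = x b" if "b \<in> B" for b
      using that inv_into_f_f[OF inj_unit_vec, of b] by (simp add: c_def)
    have c: "c \<in> unit_vec ` B \<rightarrow>\<^sub>E zspan S" using x by (auto simp: c_def finsupp_def)
    have "{v \<in> unit_vec ` B. c v \<noteq> 0} \<subseteq> unit_vec ` {k. x k \<noteq> 0}" using cu by auto
    then have fin: "finite {v \<in> unit_vec ` B. c v \<noteq> 0}"
      by (rule finite_subset) (use x in \<open>simp add: finsupp_def\<close>)
    have "x = (\<lambda>k. if k \<in> B then c (unit_vec k) else 0)"
      using x cu by (auto simp: finsupp_def fun_eq_iff)
    then show "\<exists>c. c \<in> unit_vec ` B \<rightarrow>\<^sub>E zspan S \<and> finite {v \<in> unit_vec ` B. c v \<noteq> 0} \<and>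
      x = finsum ?M (\<lambda>v. c v \<cdot> v) {v \<in> unit_vec ` B. c v \<noteq> 0}"
      using fs[OF c fin] c fin by (intro exI[of _ c]) simp
  next
    fix c c'
    assume c: "c \<in> unit_vec ` B \<rightarrow>\<^sub>E zspan S \<and> finite {v \<in> unit_vec ` B. c v \<noteq> 0} \<and>
        x = finsum ?M (\<lambda>v. c v \<cdot> v) {v \<in> unit_vec ` B. c v \<noteq> 0}"
      and c': "c' \<in> unit_vec ` B \<rightarrow>\<^sub>E zspan S \<and> finite {v \<in> unit_vec ` B. c' v \<noteq> 0} \<and>
        x = finsum ?M (\<lambda>v. c' v \<cdot> v) {v \<in> unit_vec ` B. c' v \<noteq> 0}"
    have "(\<lambda>k. if k \<in> B then c (unit_vec k) else 0) = (\<lambda>k. if k \<in> B then c' (unit_vec k) else 0)"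
      using fs[of c] fs[of c'] c c' by simp
    then have "c (unit_vec k) = c' (unit_vec k)" if "k \<in> B" for k using that by (metis (full_types))
    then show "c = c'" using c c' by (intro PiE_ext[of c "unit_vec ` B" "\<lambda>_. zspan S" c']) auto
  qed
  then have "module_basis ?R ?M (unit_vec ` B)"
    unfolding module_basis_def using unit_vec_mem[OF S, of _ B] by auto
  then show ?thesis unfolding free_module_def using left_module_as_module[OF S X] by blast
qed

lemma finitely_generated_finsupp:
  fixes B :: "'i set"
  assumes S: "subring (zspan S)" and "finite B"
  shows "finitely_generated_module (submonoid_ring S) (as_module (finsupp S B))"
  unfolding finitely_generated_module_def
proof (intro conjI exI[of _ "unit_vec ` B"] ballI)
  have X: "submod (zspan S) (finsupp S B)" using submod_finsupp[OF S] .
  show "left_module (submonoid_ring S) (as_module (finsupp S B))" using left_module_as_module[OF S X] .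
  show "finite (unit_vec ` B)" using assms by simp
  show "unit_vec ` B \<subseteq> carrier (as_module (finsupp S B))" using unit_vec_mem[OF S] by auto
  fix x assume "x \<in> carrier (as_module (finsupp S B))"
  then have x: "x \<in> finsupp S B" by simp
  define c where "c = (\<lambda>v. x (inv_into UNIV unit_vec v))"
  have cu: "c (unit_vec b) = x b" for b using inv_into_f_f[OF inj_unit_vec, of b] by (simp add: c_def)
  have "c \<in> unit_vec ` B \<rightarrow> zspan S" using x by (auto simp: cu finsupp_def)
  moreover have "finsum (as_module (finsupp S B)) (\<lambda>v. c v \<cdot> v) (unit_vec ` B) = (\<Sum>v\<in>unit_vec ` B. c v \<cdot> v)"
  proof (rule finsum_as_module[OF X S])
    have "x b \<cdot> unit_vec b \<in> finsupp S B" if "b \<in> B" for b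
      using x by (intro submodD(4)[OF X] unit_vec_mem[OF S that]) (simp add: finsupp_def)
    then show "(\<lambda>v. c v \<cdot> v) \<in> unit_vec ` B \<rightarrow> finsupp S B" by (auto simp: cu)
  qed (use assms(2) in simp)
  moreover have "(\<Sum>v\<in>unit_vec ` B. c v \<cdot> v) = (\<Sum>b\<in>B. x b \<cdot> unit_vec b)"
    using sum.reindex[OF inj_on_subset[OF inj_unit_vec subset_UNIV], of "\<lambda>v. c v \<cdot> v" B] by (simp add: cu)
  moreover have "(\<Sum>b\<in>B. x b \<cdot> unit_vec b) = (\<lambda>k. if k \<in> B then x k else 0)"
    using x zspan_L[OF S] assms(2) by (intro sum_unit_vec) (auto simp: finsupp_def)
  moreover have "(\<lambda>k. if k \<in> B then x k else 0) = x" using x by (auto simp: finsupp_def fun_eq_iff)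
  ultimately show "\<exists>c\<in>unit_vec ` B \<rightarrow> carrier (submonoid_ring S).
      x = (\<Oplus>\<^bsub>as_module (finsupp S B)\<^esub>s\<in>unit_vec ` B. c s \<odot>\<^bsub>as_module (finsupp S B)\<^esub> s)"
    by (intro bexI[of _ c]) auto
qed

lemma linear_left_module_hom:
  assumes "linear_on (zspan S) X f" "f ` X \<subseteq> Y"
  shows "f \<in> left_module_hom (submonoid_ring S) (as_module X) (as_module Y)"
  using assms by (auto simp: left_module_hom_def hom_def linear_on_def)

text \<open>The linear map from the free module on the index set that sends the unit vector at \<open>l\<close> to \<open>j l\<close>.\<close>

definition free_cover :: "('k \<Rightarrow> 'i \<Rightarrow> 'g \<Rightarrow>\<^sub>0 int) \<Rightarrow> ('k \<Rightarrow> 'g \<Rightarrow>\<^sub>0 int) \<Rightarrow> 'i \<Rightarrow> 'g \<Rightarrow>\<^sub>0 int"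
  where "free_cover j f = (\<Sum>l\<in>{l. f l \<noteq> 0}. f l \<cdot> j l)"

lemma free_cover_superset:
  assumes "finite U" "{l. f l \<noteq> 0} \<subseteq> U"
  shows "free_cover j f = (\<Sum>l\<in>U. f l \<cdot> j l)"
  unfolding free_cover_def by (rule sum.mono_neutral_left) (use assms in auto)

lemma free_cover_linear:
  assumes S: "subring (zspan S)" and j: "\<And>l. l \<in> B \<Longrightarrow> j l \<in> vec"
  shows "linear_on (zspan S) (finsupp S B) (free_cover j)"
  unfolding linear_on_def
proof (intro conjI ballI)
  fix x y assume xy: "x \<in> finsupp S B" "y \<in> finsupp S B"
  let ?U = "{l. x l \<noteq> 0} \<union> {l. y l \<noteq> 0}"
  have U: "finite ?U" using xy by (auto simp: finsupp_def)
  have "free_cover j (x + y) = (\<Sum>l\<in>?U. (x + y) l \<cdot> j l)"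
    using U by (rule free_cover_superset) (auto simp: pointwise)
  also have "\<dots> = (\<Sum>l\<in>?U. x l \<cdot> j l) + (\<Sum>l\<in>?U. y l \<cdot> j l)"
    by (simp add: pointwise act_add_left sum.distrib)
  also have "\<dots> = free_cover j x + free_cover j y"
    using free_cover_superset[OF U, of x j] free_cover_superset[OF U, of y j] by simp
  finally show "free_cover j (x + y) = free_cover j x + free_cover j y" .
next
  fix a x assume ax: "a \<in> zspan S" "x \<in> finsupp S B"
  let ?U = "{l. x l \<noteq> 0}"
  have U: "finite ?U" using ax by (auto simp: finsupp_def)
  have "free_cover j (a \<cdot> x) = (\<Sum>l\<in>?U. (a \<cdot> x) l \<cdot> j l)"
    using U by (rule free_cover_superset) (auto simp: act_def)
  also have "\<dots> = (\<Sum>l\<in>?U. a \<cdot> x l \<cdot> j l)"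
  proof (rule sum.cong[OF refl])
    fix l assume "l \<in> ?U"
    then have "l \<in> B" using ax(2) by (auto simp: finsupp_def)
    then show "(a \<cdot> x) l \<cdot> j l = a \<cdot> x l \<cdot> j l"
      unfolding act_def[of a x]
      using ax zspan_L[OF S] j by (intro act_act) (auto simp: finsupp_def)
  qed
  also have "\<dots> = a \<cdot> free_cover j x" by (simp add: free_cover_def act_sum_right)
  finally show "free_cover j (a \<cdot> x) = a \<cdot> free_cover j x" .
qed

lemma free_cover_image:
  assumes S: "subring (zspan S)" and K: "submod (zspan S) K" and j: "j ` B = K"
  shows "free_cover j ` finsupp S B = K"
proof
  show "free_cover j ` finsupp S B \<subseteq> K"
  proof (rule image_subsetI)
    fix x assume x: "x \<in> finsupp S B"
    then have "x l \<cdot> j l \<in> K" if "x l \<noteq> 0" for l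
      using j that by (intro submodD(4)[OF K]) (auto simp: finsupp_def)
    then show "free_cover j x \<in> K" unfolding free_cover_def by (intro submod_sum[OF K]) auto
  qed
  show "K \<subseteq> free_cover j ` finsupp S B"
  proof
    fix x assume "x \<in> K"
    then obtain b where b: "b \<in> B" "j b = x" using j by auto
    have "free_cover j (unit_vec b) = (\<Sum>l\<in>{b}. unit_vec b l \<cdot> j l)"
      by (rule free_cover_superset) (auto simp: unit_vec_def)
    also have "\<dots> = x" using b \<open>x \<in> K\<close> submodD(1)[OF K] by (auto simp: unit_vec_def)
    finally show "x \<in> free_cover j ` finsupp S B" using unit_vec_mem[OF S b(1)] by force
  qed
qed

text \<open>A free resolution of \<open>A\<close> through degree \<open>n\<close> by modules of finite rank in coordinates, with
  augmentation \<open>e\<close>, over the monoid ring of \<open>S\<close>.\<close>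

definition presents :: "'g set \<Rightarrow> nat \<Rightarrow> ('g \<Rightarrow>\<^sub>0 int, 'm) module \<Rightarrow> (nat \<Rightarrow> nat) \<Rightarrow>
    (nat \<Rightarrow> (nat \<Rightarrow> 'g \<Rightarrow>\<^sub>0 int) \<Rightarrow> nat \<Rightarrow> 'g \<Rightarrow>\<^sub>0 int) \<Rightarrow> ((nat \<Rightarrow> 'g \<Rightarrow>\<^sub>0 int) \<Rightarrow> 'm) \<Rightarrow> bool"
  where "presents S n A p D e \<longleftrightarrow>
     (\<forall>x\<in>free_mod (zspan S) (p 0). \<forall>y\<in>free_mod (zspan S) (p 0). e (x + y) = e x \<oplus>\<^bsub>A\<^esub> e y) \<and>
     (\<forall>a\<in>zspan S. \<forall>x\<in>free_mod (zspan S) (p 0). e (a \<cdot> x) = a \<odot>\<^bsub>A\<^esub> e x) \<and>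
     e ` free_mod (zspan S) (p 0) = carrier A \<and>
     complex (zspan S) n (\<lambda>i. free_mod (zspan S) (p i)) D {x \<in> free_mod (zspan S) (p 0). e x = \<zero>\<^bsub>A\<^esub>} \<and>
     exact n (\<lambda>i. free_mod (zspan S) (p i)) D {x \<in> free_mod (zspan S) (p 0). e x = \<zero>\<^bsub>A\<^esub>}"

end

section \<open>Type FP over subrings of a group ring\<close>

context group_ring
begin

lemma presentsD:
  assumes "presents S n A p D e"
  shows "x \<in> free_mod (zspan S) (p 0) \<Longrightarrow> y \<in> free_mod (zspan S) (p 0) \<Longrightarrow> e (x + y) = e x \<oplus>\<^bsub>A\<^esub> e y"
    "a \<in> zspan S \<Longrightarrow> x \<in> free_mod (zspan S) (p 0) \<Longrightarrow> e (a \<cdot> x) = a \<odot>\<^bsub>A\<^esub> e x"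
    "e ` free_mod (zspan S) (p 0) = carrier A"
    "complex (zspan S) n (\<lambda>i. free_mod (zspan S) (p i)) D {x \<in> free_mod (zspan S) (p 0). e x = \<zero>\<^bsub>A\<^esub>}"
    "exact n (\<lambda>i. free_mod (zspan S) (p i)) D {x \<in> free_mod (zspan S) (p 0). e x = \<zero>\<^bsub>A\<^esub>}"
  using assms unfolding presents_def by blast+

lemma left_module_homD:
  assumes "f \<in> left_module_hom R M N"
  shows "x \<in> carrier M \<Longrightarrow> f x \<in> carrier N"
    "x \<in> carrier M \<Longrightarrow> y \<in> carrier M \<Longrightarrow> f (x \<oplus>\<^bsub>M\<^esub> y) = f x \<oplus>\<^bsub>N\<^esub> f y"
    "a \<in> carrier R \<Longrightarrow> x \<in> carrier M \<Longrightarrow> f (a \<odot>\<^bsub>M\<^esub> x) = a \<odot>\<^bsub>N\<^esub> f x"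
  using assms by (auto simp: left_module_hom_def hom_def)

lemma left_module_hom_zero:
  assumes "f \<in> left_module_hom R M N" "abelian_group M" "abelian_group N"
  shows "f \<zero>\<^bsub>M\<^esub> = \<zero>\<^bsub>N\<^esub>"
proof -
  interpret M: abelian_group M by fact
  interpret N: abelian_group N by fact
  have "f \<zero>\<^bsub>M\<^esub> \<oplus>\<^bsub>N\<^esub> f \<zero>\<^bsub>M\<^esub> = f \<zero>\<^bsub>M\<^esub>"
    using left_module_homD(2)[OF assms(1), of "\<zero>\<^bsub>M\<^esub>" "\<zero>\<^bsub>M\<^esub>"] by simp
  then show ?thesis using left_module_homD(1)[OF assms(1), of "\<zero>\<^bsub>M\<^esub>"] by (simp add: N.add.l_cancel_one')
qed

text \<open>The differentials are transported along coordinates \<open>\<kappa>\<close> of the modules of degree up to \<open>n\<close> and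
  their inverses \<open>\<rho>\<close>.\<close>

theorem fp_type_imp_presents:
  fixes A :: "('g \<Rightarrow>\<^sub>0 int, 'm) module"
  assumes S: "subring (zspan S)" and fp: "fp_type n (submonoid_ring S) A"
  shows "\<exists>p D e. presents S n A p D e"
proof -
  let ?R = "submonoid_ring S"
  obtain P :: "nat \<Rightarrow> ('g \<Rightarrow>\<^sub>0 int, (('g \<Rightarrow>\<^sub>0 int) + 'm) list \<Rightarrow> ('g \<Rightarrow>\<^sub>0 int)) module" and d \<epsilon>
    where res: "free_resolution ?R A P d \<epsilon>" and fg: "\<And>i. i \<le> n \<Longrightarrow> finitely_generated_module ?R (P i)"
    using fp unfolding fp_type_def by blast
  have free: "free_module ?R (P i)" for i using res unfolding free_resolution_def by blast
  have \<epsilon>: "\<epsilon> \<in> left_module_hom ?R (P 0) A" and d: "d i \<in> left_module_hom ?R (P (Suc i)) (P i)" for i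
    using res unfolding free_resolution_def by blast+
  have onto: "\<epsilon> ` carrier (P 0) = carrier A"
    and ex0: "{x \<in> carrier (P 0). \<epsilon> x = \<zero>\<^bsub>A\<^esub>} = d 0 ` carrier (P 1)"
    and ex: "{x \<in> carrier (P (Suc i)). d i x = \<zero>\<^bsub>P i\<^esub>} = d (Suc i) ` carrier (P (Suc (Suc i)))" for i
    using res unfolding free_resolution_def by blast+
  have grp: "abelian_group (P i)" for i
    using free[of i] unfolding free_module_def left_module_def by blast
  have closed: "a \<in> zspan S \<Longrightarrow> x \<in> carrier (P i) \<Longrightarrow> a \<odot>\<^bsub>P i\<^esub> x \<in> carrier (P i)"
    "x \<in> carrier (P i) \<Longrightarrow> y \<in> carrier (P i) \<Longrightarrow> x \<oplus>\<^bsub>P i\<^esub> y \<in> carrier (P i)"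
    "\<zero>\<^bsub>P i\<^esub> \<in> carrier (P i)" "x \<in> carrier (P i) \<Longrightarrow> \<zero>\<^bsub>P i\<^esub> \<oplus>\<^bsub>P i\<^esub> x = x" for a x y i
  proof -
    interpret left_module ?R "P i" using free[of i] unfolding free_module_def by blast
    show "a \<in> zspan S \<Longrightarrow> x \<in> carrier (P i) \<Longrightarrow> a \<odot>\<^bsub>P i\<^esub> x \<in> carrier (P i)"
      "x \<in> carrier (P i) \<Longrightarrow> y \<in> carrier (P i) \<Longrightarrow> x \<oplus>\<^bsub>P i\<^esub> y \<in> carrier (P i)"
      "\<zero>\<^bsub>P i\<^esub> \<in> carrier (P i)" "x \<in> carrier (P i) \<Longrightarrow> \<zero>\<^bsub>P i\<^esub> \<oplus>\<^bsub>P i\<^esub> x = x"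
      using smult_closed by auto
  qed
  define iso where "iso = (\<lambda>i (m::nat) (\<kappa> :: _ \<Rightarrow> nat \<Rightarrow> 'g \<Rightarrow>\<^sub>0 int).
      bij_betw \<kappa> (carrier (P i)) (free_mod (zspan S) m) \<and>
      (\<forall>x\<in>carrier (P i). \<forall>y\<in>carrier (P i). \<kappa> (x \<oplus>\<^bsub>P i\<^esub> y) = \<kappa> x + \<kappa> y) \<and>
      (\<forall>a\<in>zspan S. \<forall>x\<in>carrier (P i). \<kappa> (a \<odot>\<^bsub>P i\<^esub> x) = a \<cdot> \<kappa> x))"
  have "\<exists>m \<kappa>. i \<le> n \<longrightarrow> iso i m \<kappa>" for i
  proof (cases "i \<le> n")
    case True
    have "\<exists>m \<kappa>. iso i m \<kappa>"
    proof (rule nat_indexed_coordinates[OF _ _ _ free[of i] fg[OF True]])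
      fix m :: nat and \<kappa>
      assume "bij_betw \<kappa> (carrier (P i)) {f. (\<forall>i<m. f i \<in> carrier ?R) \<and> (\<forall>i\<ge>m. f i = 0)}"
        "\<And>x y. x \<in> carrier (P i) \<Longrightarrow> y \<in> carrier (P i) \<Longrightarrow> \<kappa> (x \<oplus>\<^bsub>P i\<^esub> y) = \<kappa> x + \<kappa> y"
        "\<And>a x. a \<in> carrier ?R \<Longrightarrow> x \<in> carrier (P i) \<Longrightarrow> \<kappa> (a \<odot>\<^bsub>P i\<^esub> x) = (\<lambda>j. a \<otimes>\<^bsub>?R\<^esub> \<kappa> x j)"
      then have "iso i m \<kappa>" unfolding iso_def free_mod_def act_def by simp
      then show "\<exists>m \<kappa>. iso i m \<kappa>" by blast
    qed auto
    then show ?thesis by blast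
  qed blast
  then obtain p \<kappa> where "\<And>i. i \<le> n \<longrightarrow> iso i (p i) (\<kappa> i)" by metis
  then have \<kappa>: "iso i (p i) (\<kappa> i)" if "i \<le> n" for i using that by blast
  let ?F = "\<lambda>i. free_mod (zspan S) (p i)"
  define \<rho> where "\<rho> = (\<lambda>i. inv_into (carrier (P i)) (\<kappa> i))"
  have F: "submod (zspan S) (?F i)" for i using submod_free_mod[OF S] .
  have \<kappa>_mem: "\<kappa> i x \<in> ?F i" and \<rho>\<kappa>: "\<rho> i (\<kappa> i x) = x" if "i \<le> n" "x \<in> carrier (P i)" for i x
    using \<kappa>[OF that(1)] that(2) unfolding iso_def \<rho>_def bij_betw_def by auto
  have \<rho>_mem: "\<rho> i x \<in> carrier (P i)" and \<kappa>\<rho>: "\<kappa> i (\<rho> i x) = x" if "i \<le> n" "x \<in> ?F i" for i x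
  proof -
    have x: "x \<in> \<kappa> i ` carrier (P i)" using \<kappa>[OF that(1)] that(2) unfolding iso_def bij_betw_def by simp
    show "\<rho> i x \<in> carrier (P i)" unfolding \<rho>_def using x by (rule inv_into_into)
    show "\<kappa> i (\<rho> i x) = x" unfolding \<rho>_def using x by (rule f_inv_into_f)
  qed
  have \<kappa>_add: "\<kappa> i (x \<oplus>\<^bsub>P i\<^esub> y) = \<kappa> i x + \<kappa> i y" if "i \<le> n" "x \<in> carrier (P i)" "y \<in> carrier (P i)" for i x y
    using \<kappa>[OF that(1)] that unfolding iso_def by blast
  have \<kappa>_act: "\<kappa> i (a \<odot>\<^bsub>P i\<^esub> x) = a \<cdot> \<kappa> i x" if "i \<le> n" "a \<in> zspan S" "x \<in> carrier (P i)" for i a x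
    using \<kappa>[OF that(1)] that unfolding iso_def by blast
  have \<kappa>_zero: "\<kappa> i \<zero>\<^bsub>P i\<^esub> = 0" if "i \<le> n" for i
    using \<kappa>_add[OF that closed(3) closed(3)] closed(4)[OF closed(3)] by simp
  have \<rho>_zero: "\<rho> i 0 = \<zero>\<^bsub>P i\<^esub>" if "i \<le> n" for i
    using \<rho>\<kappa>[OF that closed(3)] \<kappa>_zero[OF that] by simp
  have \<rho>_add: "\<rho> i (x + y) = \<rho> i x \<oplus>\<^bsub>P i\<^esub> \<rho> i y" if "i \<le> n" "x \<in> ?F i" "y \<in> ?F i" for i x y
    using \<rho>\<kappa>[OF that(1) closed(2)[OF \<rho>_mem[OF that(1,2)] \<rho>_mem[OF that(1,3)]]]
      \<kappa>_add[OF that(1) \<rho>_mem[OF that(1,2)] \<rho>_mem[OF that(1,3)]] \<kappa>\<rho>[OF that(1,2)] \<kappa>\<rho>[OF that(1,3)] by simp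
  have \<rho>_act: "\<rho> i (a \<cdot> x) = a \<odot>\<^bsub>P i\<^esub> \<rho> i x" if "i \<le> n" "a \<in> zspan S" "x \<in> ?F i" for i a x
    using \<rho>\<kappa>[OF that(1) closed(1)[OF that(2) \<rho>_mem[OF that(1,3)]]]
      \<kappa>_act[OF that(1,2) \<rho>_mem[OF that(1,3)]] \<kappa>\<rho>[OF that(1,3)] by simp
  define D where "D = (\<lambda>i x. \<kappa> i (d i (\<rho> (Suc i) x)))"
  define e where "e = (\<lambda>x. \<epsilon> (\<rho> 0 x))"
  let ?Z = "{x \<in> ?F 0. e x = \<zero>\<^bsub>A\<^esub>}"
  have d_mem: "d i (\<rho> (Suc i) x) \<in> carrier (P i)" if "Suc i \<le> n" "x \<in> ?F (Suc i)" for i x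
    using left_module_homD(1)[OF d \<rho>_mem[OF that]] .
  have d_zero: "d i \<zero>\<^bsub>P (Suc i)\<^esub> = \<zero>\<^bsub>P i\<^esub>" for i using left_module_hom_zero[OF d grp grp] .
  have e_add: "e (x + y) = e x \<oplus>\<^bsub>A\<^esub> e y" if "x \<in> ?F 0" "y \<in> ?F 0" for x y
    unfolding e_def using \<rho>_add[OF le0 that] left_module_homD(2)[OF \<epsilon> \<rho>_mem[OF le0 that(1)] \<rho>_mem[OF le0 that(2)]] by simp
  have e_act: "e (a \<cdot> x) = a \<odot>\<^bsub>A\<^esub> e x" if "a \<in> zspan S" "x \<in> ?F 0" for a x
    unfolding e_def using \<rho>_act[OF le0 that] left_module_homD(3)[OF \<epsilon> _ \<rho>_mem[OF le0 that(2)]] that(1) by simp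
  have e_onto: "e ` ?F 0 = carrier A"
  proof -
    have "\<rho> 0 ` ?F 0 = carrier (P 0)"
      using \<rho>_mem[OF le0] \<kappa>_mem[OF le0] \<rho>\<kappa>[OF le0] by (auto intro!: image_eqI[of _ _ "\<kappa> 0 _"]) 
    then show ?thesis unfolding e_def using onto by (metis image_image)
  qed
  have A: "left_module ?R A" using fp unfolding fp_type_def by simp
  interpret A: left_module ?R A by fact
  have e_zero: "e 0 = \<zero>\<^bsub>A\<^esub>"
    unfolding e_def \<rho>_zero[OF le0] using left_module_hom_zero[OF \<epsilon> grp] A.M.abelian_group_axioms by simp
  have Z: "submod (zspan S) ?Z"
    unfolding submod_def using submodD[OF F[of 0]] e_zero e_add e_act A.smult_zero_right by auto
  have cyc: "x \<in> cycles ?F D ?Z i \<longleftrightarrow> x \<in> ?F i \<and> \<rho> i x \<in> d i ` carrier (P (Suc i))" if i: "i \<le> n" for i x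
  proof (cases i)
    case 0
    then show ?thesis using ex0 \<rho>_mem[OF le0, of x] by (auto simp: e_def)
  next
    case (Suc j)
    have "x \<in> cycles ?F D ?Z i \<longleftrightarrow> x \<in> ?F i \<and> d j (\<rho> i x) = \<zero>\<^bsub>P j\<^esub>"
    proof -
      have "D j x = 0 \<longleftrightarrow> d j (\<rho> i x) = \<zero>\<^bsub>P j\<^esub>" if "x \<in> ?F i"
        using \<rho>\<kappa>[of j "d j (\<rho> i x)"] d_mem[of j x] \<kappa>_zero[of j] \<rho>_zero[of j] that Suc i
        unfolding D_def by (metis Suc_leD)
      then show ?thesis using Suc by auto
    qed
    then show ?thesis using ex[of j] Suc \<rho>_mem[OF i, of x] by auto
  qed
  have lin: "linear_on (zspan S) (?F (Suc i)) (D i)" if i: "i < n" for i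
    unfolding linear_on_def D_def
  proof (intro conjI ballI)
    have i': "Suc i \<le> n" "i \<le> n" using i by auto
    fix x y assume xy: "x \<in> ?F (Suc i)" "y \<in> ?F (Suc i)"
    show "\<kappa> i (d i (\<rho> (Suc i) (x + y))) = \<kappa> i (d i (\<rho> (Suc i) x)) + \<kappa> i (d i (\<rho> (Suc i) y))"
      using \<rho>_add[OF i'(1) xy] left_module_homD(2)[OF d \<rho>_mem[OF i'(1) xy(1)] \<rho>_mem[OF i'(1) xy(2)]]
        \<kappa>_add[OF i'(2) d_mem[OF i'(1) xy(1)] d_mem[OF i'(1) xy(2)]] by simp
  next
    have i': "Suc i \<le> n" "i \<le> n" using i by auto
    fix a x assume ax: "a \<in> zspan S" "x \<in> ?F (Suc i)"
    show "\<kappa> i (d i (\<rho> (Suc i) (a \<cdot> x))) = a \<cdot> \<kappa> i (d i (\<rho> (Suc i) x))"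
      using \<rho>_act[OF i'(1) ax] left_module_homD(3)[OF d _ \<rho>_mem[OF i'(1) ax(2)]]
        \<kappa>_act[OF i'(2) ax(1) d_mem[OF i'(1) ax(2)]] ax(1) by simp
  qed
  have im: "D i x \<in> cycles ?F D ?Z i" if i: "i < n" and x: "x \<in> ?F (Suc i)" for i x
  proof -
    have i': "Suc i \<le> n" "i \<le> n" using i by auto
    show ?thesis
      unfolding cyc[OF i'(2)]
      using \<kappa>_mem[OF i'(2) d_mem[OF i'(1) x]] \<rho>\<kappa>[OF i'(2) d_mem[OF i'(1) x]] \<rho>_mem[OF i'(1) x]
      by (simp add: D_def)
  qed
  have "complex (zspan S) n ?F D ?Z"
    unfolding complex_def using F Z lin im by blast
  moreover have "cycles ?F D ?Z i \<subseteq> D i ` ?F (Suc i)" if i: "i < n" for i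
  proof
    fix x assume x: "x \<in> cycles ?F D ?Z i"
    have i': "Suc i \<le> n" "i \<le> n" using i by auto
    obtain y where y: "y \<in> carrier (P (Suc i))" "\<rho> i x = d i y" and xF: "x \<in> ?F i" using x cyc[OF i'(2)] by auto
    have "D i (\<kappa> (Suc i) y) = x"
      unfolding D_def \<rho>\<kappa>[OF i'(1) y(1)] using y(2) \<kappa>\<rho>[OF i'(2) xF] by simp
    then show "x \<in> D i ` ?F (Suc i)" using \<kappa>_mem[OF i'(1) y(1)] by blast
  qed
  ultimately show ?thesis
    unfolding presents_def exact_def using e_add e_act e_onto by blast
qed

text \<open>In degrees up to \<open>n\<close>, the modules of the complex become functions on finite sets of words, the words
  \<open>\<nu> l\<close> replacing the indices \<open>l\<close>.  From degree \<open>n + 1\<close> on, each kernel \<open>Ks i\<close> is covered by the free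
  module on all its elements, indexed through the encoding \<open>\<iota>\<close> of functions by words, and the kernel
  of this cover is \<open>Ks (i + 1)\<close>.\<close>

theorem presents_imp_fp_type:
  fixes A :: "('g \<Rightarrow>\<^sub>0 int, 'm) module"
  assumes S: "subring (zspan S)" and A: "left_module (submonoid_ring S) A" and pres: "presents S n A p D e"
  shows "fp_type n (submonoid_ring S) A"
proof -
  let ?R = "submonoid_ring S" and ?F = "\<lambda>i. free_mod (zspan S) (p i)"
  let ?Z = "{x \<in> ?F 0. e x = \<zero>\<^bsub>A\<^esub>}"
  note P = presentsD[OF pres]
  interpret A: left_module ?R A by fact
  have F: "submod (zspan S) (?F i)" for i using submod_free_mod[OF S] .
  obtain \<iota> :: "((('g \<Rightarrow>\<^sub>0 int) + 'm) list \<Rightarrow> ('g \<Rightarrow>\<^sub>0 int)) \<Rightarrow> (('g \<Rightarrow>\<^sub>0 int) + 'm) list"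
    where \<iota>: "inj_on \<iota> {f. finite {k. f k \<noteq> 0}}"
    using finitely_supported_encoding[of 0 "frag_of \<one>"] by (metis frag_of_nonzero)
  define j where "j = inv_into {f. finite {k. f k \<noteq> 0}} \<iota>"
  define \<nu> :: "nat \<Rightarrow> (('g \<Rightarrow>\<^sub>0 int) + 'm) list" where "\<nu> = (\<lambda>l. replicate l (Inl 0))"
  have \<nu>: "inj \<nu>" unfolding \<nu>_def by (rule injI) (metis length_replicate)
  define B where "B = (\<lambda>i. \<nu> ` {..<p i})"
  define proj where "proj = (\<lambda>f l. f (\<nu> l) :: 'g \<Rightarrow>\<^sub>0 int)"
  define embed where "embed = (\<lambda>x k. if k \<in> range \<nu> then x (inv_into UNIV \<nu> k) else (0 :: 'g \<Rightarrow>\<^sub>0 int))"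
  have proj_embed: "proj (embed x) = x" for x
    using inv_into_f_f[OF \<nu>] by (auto simp: proj_def embed_def)
  have embed_mem: "embed x \<in> finsupp S (B i)" if "x \<in> ?F i" for x i
  proof -
    have "{k. embed x k \<noteq> 0} \<subseteq> B i"
      using that inv_into_f_f[OF \<nu>] by (auto simp: embed_def B_def free_mod_def not_less[symmetric] split: if_splits)
    moreover have "embed x k \<in> zspan S" for k
      using that by (cases "inv_into UNIV \<nu> k < p i") (auto simp: embed_def free_mod_def)
    ultimately show ?thesis unfolding finsupp_def B_def by (auto intro: finite_subset)
  qed
  have embed_proj: "embed (proj f) = f" if "f \<in> finsupp S (B i)" for f i
  proof
    fix k
    show "embed (proj f) k = f k"
    proof (cases "k \<in> range \<nu>")
      case True
      then show ?thesis using inv_into_f_f[OF \<nu>] by (auto simp: proj_def embed_def)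
    next
      case False
      then have "k \<notin> B i" by (auto simp: B_def)
      then show ?thesis using that False by (auto simp: embed_def finsupp_def)
    qed
  qed
  have proj_mem: "proj f \<in> ?F i" if "f \<in> finsupp S (B i)" for f i
  proof -
    have "f (\<nu> l) = 0" if "l \<ge> p i" for l
    proof -
      have "\<nu> l \<notin> B i" using \<nu> that by (auto simp: B_def inj_eq)
      then show ?thesis using \<open>f \<in> finsupp S (B i)\<close> by (auto simp: finsupp_def)
    qed
    then show ?thesis using that by (auto simp: proj_def free_mod_def finsupp_def)
  qed
  have proj_lin: "linear_on (zspan S) X proj" for X
    by (auto simp: linear_on_def proj_def act_def pointwise)
  have embed_lin: "linear_on (zspan S) X embed" for X
    by (auto simp: linear_on_def embed_def act_def pointwise)
  have proj_zero: "proj 0 = 0" and embed_zero: "embed 0 = 0" by (auto simp: proj_def embed_def pointwise)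
  define cyc where "cyc = (\<lambda>i. {f \<in> finsupp S (B i). proj f \<in> cycles ?F D ?Z i})"
  define Ks where "Ks = rec_nat (cyc n) (\<lambda>_ K. {f \<in> finsupp S (\<iota> ` K). free_cover j f = 0})"
  have Ks_0: "Ks 0 = cyc n" and Ks_Suc: "Ks (Suc i) = {f \<in> finsupp S (\<iota> ` Ks i). free_cover j f = 0}" for i
    by (auto simp: Ks_def)
  define Y where "Y = (\<lambda>i. finsupp S (if i \<le> n then B i else \<iota> ` Ks (i - Suc n)))"
  define d where "d = (\<lambda>i. if i < n then (\<lambda>f. embed (D i (proj f))) else free_cover j)"
  have fin: "f \<in> {f. finite {k. f k \<noteq> 0}}" if "f \<in> finsupp S X" for f X
    using that by (auto simp: finsupp_def)
  have cyc_sub: "submod (zspan S) (cyc i)" if "i \<le> n" for i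
    unfolding cyc_def using submod_preimage[OF proj_lin submod_finsupp[OF S] submod_cycles[OF P(4) that]] .
  have Ks_fin: "Ks i \<subseteq> {f. finite {k. f k \<noteq> 0}}" for i
    by (cases i) (auto simp: Ks_0 Ks_Suc cyc_def finsupp_def)
  have j\<iota>: "j ` \<iota> ` Ks i = Ks i" for i
    using Ks_fin[of i] inv_into_f_f[OF \<iota>] unfolding j_def image_image by force
  have cover: "submod (zspan S) (Ks i) \<and> linear_on (zspan S) (finsupp S (\<iota> ` Ks i)) (free_cover j)
      \<and> free_cover j ` finsupp S (\<iota> ` Ks i) = Ks i" for i
  proof -
    have *: "linear_on (zspan S) (finsupp S (\<iota> ` Ks i)) (free_cover j) \<and> free_cover j ` finsupp S (\<iota> ` Ks i) = Ks i"
      if K: "submod (zspan S) (Ks i)" for i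
    proof
      show "linear_on (zspan S) (finsupp S (\<iota> ` Ks i)) (free_cover j)"
        using j\<iota>[of i] submodD(1)[OF K] by (intro free_cover_linear[OF S]) blast
      show "free_cover j ` finsupp S (\<iota> ` Ks i) = Ks i"
        by (rule free_cover_image[OF S K j\<iota>])
    qed
    have "submod (zspan S) (Ks i)"
    proof (induction i)
      case 0
      show ?case unfolding Ks_0 by (rule cyc_sub) simp
    next
      case (Suc i)
      show ?case
        unfolding Ks_Suc using *[OF Suc] submod_finsupp[OF S] by (intro submod_kernel) blast+
    qed
    then show ?thesis using * by blast
  qed
  have Y_B: "Y i = finsupp S (B i)" if "i \<le> n" for i using that by (simp add: Y_def)
  have Y_K: "Y (Suc i) = finsupp S (\<iota> ` Ks (i - n))" if "n \<le> i" for i using that by (simp add: Y_def)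
  have d_image: "d i ` Y (Suc i) = cyc i" if i: "i \<le> n" for i
  proof (cases "i < n")
    case True
    have "embed (D i (proj f)) \<in> cyc i" if "f \<in> finsupp S (B (Suc i))" for f
      using complexD(5)[OF P(4) True proj_mem[OF that]] cycles_subset[OF P(4), of i] embed_mem[of _ i]
      by (auto simp: cyc_def proj_embed)
    moreover have "f \<in> (\<lambda>f. embed (D i (proj f))) ` finsupp S (B (Suc i))" if f: "f \<in> cyc i" for f
    proof -
      obtain x where x: "x \<in> ?F (Suc i)" "proj f = D i x"
        using f P(5) True unfolding cyc_def exact_def by blast
      have "embed (D i (proj (embed x))) = f"
        using embed_proj[of f i] f unfolding proj_embed x(2)[symmetric] by (simp add: cyc_def)
      then show ?thesis using embed_mem[OF x(1)] by (intro image_eqI[of _ _ "embed x"]) auto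
    qed
    ultimately show ?thesis using True by (auto simp: d_def Y_B)
  next
    case False
    then have "i = n" using i by simp
    then show ?thesis using cover[of 0] by (simp add: d_def Y_K Ks_0)
  qed
  have d_image': "d i ` Y (Suc i) = Ks (i - n)" if "n \<le> i" for i
    using cover[of "i - n"] that by (simp add: d_def Y_K)
  have d_kernel: "{f \<in> Y (Suc i). d i f = 0} = d (Suc i) ` Y (Suc (Suc i))" for i
  proof (cases "i < n")
    case True
    have "embed (D i (proj f)) = 0 \<longleftrightarrow> D i (proj f) = 0" for f
      using proj_embed embed_zero proj_zero by metis
    then show ?thesis
      using True proj_mem[of _ "Suc i"] d_image[of "Suc i"] by (auto simp: d_def Y_B cyc_def)
  next
    case False
    then have "{f \<in> Y (Suc i). d i f = 0} = Ks (Suc (i - n))" by (simp add: d_def Y_K Ks_Suc)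
    then show ?thesis using d_image'[of "Suc i"] False by (simp add: Suc_diff_le)
  qed
  have d_hom: "d i \<in> left_module_hom ?R (as_module (Y (Suc i))) (as_module (Y i))" for i
  proof (rule linear_left_module_hom)
    show "linear_on (zspan S) (Y (Suc i)) (d i)"
    proof (cases "i < n")
      case True
      have "linear_on (zspan S) (finsupp S (B (Suc i))) (\<lambda>f. D i (proj f))"
        using linear_compose[OF proj_lin complexD(4)[OF P(4) True]] proj_mem by blast
      then have "linear_on (zspan S) (finsupp S (B (Suc i))) (\<lambda>f. embed (D i (proj f)))"
        using linear_compose[OF _ embed_lin subset_UNIV] by blast
      then show ?thesis using True by (simp add: d_def Y_B)
    next
      case False
      then show ?thesis using cover[of "i - n"] by (simp add: d_def Y_K)
    qed
    show "d i ` Y (Suc i) \<subseteq> Y i"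
    proof (cases i)
      case 0
      then show ?thesis using d_image[of 0] by (auto simp: cyc_def Y_B)
    next
      case (Suc l)
      then show ?thesis using d_kernel[of l] by auto
    qed
  qed
  have "free_resolution ?R A (\<lambda>i. as_module (Y i)) d (\<lambda>f. e (proj f))"
    unfolding free_resolution_def
  proof (intro conjI allI)
    show "free_module ?R (as_module (Y i))" for i
      unfolding Y_def by (rule free_module_finsupp[OF S])
    show "d i \<in> left_module_hom ?R (as_module (Y (Suc i))) (as_module (Y i))" for i by (rule d_hom)
    have e_mem: "e x \<in> carrier A" if "x \<in> ?F 0" for x using P(3) that by blast
    have proj0: "proj f \<in> ?F 0" if "f \<in> Y 0" for f using proj_mem that Y_B[of 0] by simp
    show "(\<lambda>f. e (proj f)) \<in> left_module_hom ?R (as_module (Y 0)) A"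
      unfolding left_module_hom_def hom_def
      using proj0 e_mem P(1,2) proj_lin[of UNIV] by (auto simp: linear_on_def)
    have "e x \<in> (\<lambda>f. e (proj f)) ` Y 0" if "x \<in> ?F 0" for x
      using embed_mem[OF that] proj_embed[of x] Y_B[of 0] by (intro image_eqI[of _ _ "embed x"]) auto
    then show "(\<lambda>f. e (proj f)) ` carrier (as_module (Y 0)) = carrier A"
      using P(3) proj0 e_mem by (auto simp flip: P(3))
    show "{x \<in> carrier (as_module (Y 0)). e (proj x) = \<zero>\<^bsub>A\<^esub>} = d 0 ` carrier (as_module (Y 1))"
      using d_image[of 0] proj0 Y_B[of 0] by (auto simp: cyc_def)
    show "{x \<in> carrier (as_module (Y (Suc i))). d i x = \<zero>\<^bsub>as_module (Y i)\<^esub>} =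
        d (Suc i) ` carrier (as_module (Y (Suc (Suc i))))" for i
      using d_kernel by simp
  qed
  moreover have "finitely_generated_module ?R (as_module (Y i))" if "i \<le> n" for i
    unfolding Y_B[OF that] B_def by (rule finitely_generated_finsupp[OF S]) simp
  ultimately show ?thesis unfolding fp_type_def using A by blast
qed

end

context group_ring
begin

lemma submonoid_ring_carrier: "submonoid_ring (carrier G) = monoid_ring G"
  by (simp add: submonoid_ring_def)

lemma left_module_submonoid:
  assumes S: "subring (zspan S)" and "left_module (monoid_ring G) A"
  shows "left_module (submonoid_ring S) A"
proof -
  interpret left_module "submonoid_ring (carrier G)" A
    using assms(2) unfolding submonoid_ring_carrier .
  show ?thesis
    unfolding left_module_def left_module_axioms_def
    using ring_submonoid_ring[OF S] M.abelian_group_axioms zspan_L[OF S]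
      smult_closed smult_l_distr smult_r_distr smult_assoc smult_one by auto
qed

text \<open>A resolution over the monoid ring of \<open>S\<close> is compared with one over the group ring in degree \<open>0\<close>
  only: its augmentation lifts through the augmentation \<open>e\<close> since its module of degree \<open>0\<close> is
  projective, and conversely a lift is composed with \<open>e\<close>.\<close>

lemma fp_type_iff_resolves:
  assumes S: "subring (zspan S)" and F: "presents (carrier G) n A m dd e"
    and A: "left_module (monoid_ring G) A"
  shows "fp_type n (submonoid_ring S) A \<longleftrightarrow>
    (\<exists>p D \<pi>. resolves (zspan S) n (free_mod (zspan (carrier G)) (m 0))
       {x \<in> free_mod (zspan (carrier G)) (m 0). e x = \<zero>\<^bsub>A\<^esub>} p D \<pi>)"
    (is "_ \<longleftrightarrow> (\<exists>p D \<pi>. resolves _ _ ?F ?Z p D \<pi>)")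
proof
  note F = presentsD[OF F]
  interpret left_module "submonoid_ring (carrier G)" A
    using A unfolding submonoid_ring_carrier .
  have SL: "zspan S \<subseteq> zspan (carrier G)" using subringD(1)[OF S] .
  have smF: "submod (zspan (carrier G)) ?F" using submod_free_mod[OF subring_L] .
  have smF': "submod (zspan S) ?F" using submod_subring[OF smF SL] .
  have e_mem: "e x \<in> carrier A" if "x \<in> ?F" for x using F(3) that by blast
  have e_zero: "e 0 = \<zero>\<^bsub>A\<^esub>" using submodD(2)[OF complexD(2)[OF F(4)]] by simp
  have e_diff: "e (x - y) = \<zero>\<^bsub>A\<^esub> \<longleftrightarrow> e x = e y" if xy: "x \<in> ?F" "y \<in> ?F" for x y
  proof -
    have d: "x - y \<in> ?F" using submod_diff[OF subring_L smF xy] .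
    have "e x = e (x - y) \<oplus>\<^bsub>A\<^esub> e y" using F(1)[OF d xy(2)] by simp
    moreover have "e (x - y) \<oplus>\<^bsub>A\<^esub> e y = \<zero>\<^bsub>A\<^esub> \<oplus>\<^bsub>A\<^esub> e y \<longleftrightarrow> e (x - y) = \<zero>\<^bsub>A\<^esub>"
      using e_mem[OF d] e_mem[OF xy(2)] by (intro M.add.right_cancel) auto
    ultimately show ?thesis using e_mem[OF xy(2)] by simp
  qed
  show "\<exists>p D \<pi>. resolves (zspan S) n ?F ?Z p D \<pi>" if fp: "fp_type n (submonoid_ring S) A"
  proof -
    obtain p D \<epsilon> where pres: "presents S n A p D \<epsilon>" using fp_type_imp_presents[OF S fp] by blast
    note P = presentsD[OF pres]
    let ?P = "free_mod (zspan S) (p 0)"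
    have \<epsilon>_zero: "\<epsilon> 0 = \<zero>\<^bsub>A\<^esub>" using submodD(2)[OF complexD(2)[OF P(4)]] by simp
    obtain \<pi> where \<pi>: "linear_on (zspan S) ?P \<pi>" "\<pi> ` ?P \<subseteq> ?F" "\<And>x. x \<in> ?P \<Longrightarrow> e (\<pi> x) = \<epsilon> x"
    proof (rule projective_lift[OF S projective_free_mod[OF S] smF', of "\<lambda>x y. e y = \<epsilon> x"])
      show "e 0 = \<epsilon> 0" using e_zero \<epsilon>_zero by simp
      fix x assume "x \<in> ?P"
      then have "\<epsilon> x \<in> carrier A" using P(3) by blast
      then show "\<exists>y\<in>?F. e y = \<epsilon> x" using F(3) by force
    next
      fix a x y assume "a \<in> zspan S" "x \<in> ?P" "y \<in> ?F" "e y = \<epsilon> x"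
      then show "e (a \<cdot> y) = \<epsilon> (a \<cdot> x)" using F(2)[of a y] P(2)[of a x] SL by auto
    qed (use F(1) P(1) in auto)
    have "{y \<in> ?P. \<pi> y \<in> ?Z} = {x \<in> ?P. \<epsilon> x = \<zero>\<^bsub>A\<^esub>}" using \<pi>(2,3) by auto
    moreover have "\<exists>y\<in>?P. \<pi> y - x \<in> ?Z" if x: "x \<in> ?F" for x
    proof -
      obtain y where y: "y \<in> ?P" "\<epsilon> y = e x" using e_mem[OF x] unfolding P(3)[symmetric] by auto
      have "\<pi> y \<in> ?F" using \<pi>(2) y(1) by auto
      then show ?thesis using y \<pi>(3)[OF y(1)] e_diff[of "\<pi> y" x] submod_diff[OF subring_L smF _ x, of "\<pi> y"] x by auto
    qed
    ultimately have "resolves (zspan S) n ?F ?Z p D \<pi>"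
      unfolding resolves_def using \<pi>(1,2) P(4,5) by simp
    then show ?thesis by blast
  qed
  show "fp_type n (submonoid_ring S) A" if res: "\<exists>p D \<pi>. resolves (zspan S) n ?F ?Z p D \<pi>"
  proof -
    obtain p D \<pi> where "resolves (zspan S) n ?F ?Z p D \<pi>" using res by blast
    note P = resolvesD[OF this]
    let ?P = "free_mod (zspan S) (p 0)"
    have add: "\<pi> (x + y) = \<pi> x + \<pi> y" if "x \<in> ?P" "y \<in> ?P" for x y
      using P(1) that unfolding linear_on_def by blast
    have act: "\<pi> (a \<cdot> x) = a \<cdot> \<pi> x" if "a \<in> zspan S" "x \<in> ?P" for a x
      using P(1) that unfolding linear_on_def by blast
    have mem: "\<pi> x \<in> ?F" if "x \<in> ?P" for x using P(2) that by blast
    have Z: "{y \<in> ?P. \<pi> y \<in> ?Z} = {x \<in> ?P. e (\<pi> x) = \<zero>\<^bsub>A\<^esub>}" using mem by auto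
    have "e (\<pi> (x + y)) = e (\<pi> x) \<oplus>\<^bsub>A\<^esub> e (\<pi> y)" if "x \<in> ?P" "y \<in> ?P" for x y
      using add[OF that] F(1)[OF mem[OF that(1)] mem[OF that(2)]] by simp
    moreover have "e (\<pi> (a \<cdot> x)) = a \<odot>\<^bsub>A\<^esub> e (\<pi> x)" if "a \<in> zspan S" "x \<in> ?P" for a x
      using act[OF that] F(2)[OF _ mem[OF that(2)]] that SL by auto
    moreover have "(\<lambda>x. e (\<pi> x)) ` ?P = carrier A"
    proof
      show "(\<lambda>x. e (\<pi> x)) ` ?P \<subseteq> carrier A" using mem e_mem by blast
      show "carrier A \<subseteq> (\<lambda>x. e (\<pi> x)) ` ?P"
      proof
        fix a assume "a \<in> carrier A"
        then obtain x where x: "x \<in> ?F" "a = e x" using F(3) by auto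
        then obtain y where y: "y \<in> ?P" "\<pi> y - x \<in> ?Z" using P(3) by blast
        then have "e (\<pi> y) = e x" using e_diff[OF mem[OF y(1)] x(1)] by simp
        then show "a \<in> (\<lambda>x. e (\<pi> x)) ` ?P" using x y by force
      qed
    qed
    ultimately have "presents S n A p D (\<lambda>x. e (\<pi> x))"
      unfolding presents_def using P(4,5) unfolding Z by blast
    then show ?thesis using presents_imp_fp_type[OF S left_module_submonoid[OF S A]] by blast
  qed
qed

end

text \<open>Essential acyclicity of the filtration of a resolution over the group ring of \<open>G\<close> depends on \<open>\<xi>\<close> only.
  It is equivalent to type \<open>FP\<^sub>n\<close> over the monoid ring of the nonnegative part of any subgroup of
  finite index, in particular of \<open>H\<close> and of \<open>G\<close>.\<close>

theorem fp_type_nonneg_finite_index: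
  fixes G :: "('g, 'b) monoid_scheme" and \<xi> :: "'g \<Rightarrow> real"
  assumes "group G" "subgroup H G" "finite (rcosets\<^bsub>G\<^esub> H)"
    and \<xi>: "\<And>g h. g \<in> carrier G \<Longrightarrow> h \<in> carrier G \<Longrightarrow> \<xi> (g \<otimes>\<^bsub>G\<^esub> h) = \<xi> g + \<xi> h"
      "\<exists>g\<in>carrier G. \<xi> g \<noteq> 0"
    and A: "fp_type n (monoid_ring G) A"
  shows "fp_type n (monoid_ring (G\<lparr>carrier := {h \<in> H. \<xi> h \<ge> 0}\<rparr>)) A \<longleftrightarrow>
    fp_type n (monoid_ring (G\<lparr>carrier := {g \<in> carrier G. \<xi> g \<ge> 0}\<rparr>)) A"
proof -
  interpret group G by fact
  interpret group_ring G ..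
  have A': "left_module (monoid_ring G) A" using A unfolding fp_type_def by blast
  obtain m dd e where F: "presents (carrier G) n A m dd e"
    using fp_type_imp_presents[OF subring_L] A unfolding submonoid_ring_carrier by blast
  let ?F = "\<lambda>i. free_mod (zspan (carrier G)) (m i)"
  let ?Z = "{x \<in> ?F 0. e x = \<zero>\<^bsub>A\<^esub>}"
  define essac where "essac \<longleftrightarrow>
    (\<exists>c\<ge>0. (\<forall>r. \<forall>x\<in>?F 0. \<exists>y\<in>free_mod (group_character.level G \<xi> r) (m 0). y - x \<in> ?Z) \<and>
      (\<forall>i<n. \<forall>r. cycles ?F dd ?Z i \<inter> free_mod (group_character.level G \<xi> r) (m i)
         \<subseteq> dd i ` free_mod (group_character.level G \<xi> (r - c)) (m (Suc i))))"
  have main: "fp_type n (monoid_ring (G\<lparr>carrier := {k \<in> K. \<xi> k \<ge> 0}\<rparr>)) A \<longleftrightarrow> essac"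
    if K: "subgroup K G" "finite (rcosets\<^bsub>G\<^esub> K)" for K
  proof -
    interpret finite_index_character G \<xi> K
      by (intro finite_index_character.intro group_character.intro real_character.intro real_character_axioms.intro
          group_character_axioms.intro
          finite_index.intro finite_index_axioms.intro group_ring_axioms group_axioms K \<xi>)
    show ?thesis
      using fp_type_iff_resolves[OF subring_nonneg F A']
        resolves_iff_essentially_acyclic[OF presentsD(4,5)[OF F]]
      unfolding submonoid_ring_def essac_def by simp
  qed
  have "rcosets\<^bsub>G\<^esub> (carrier G) \<subseteq> {carrier G}"
    unfolding RCOSETS_def using coset_join2[OF _ subgroup_self] by auto
  then have "finite (rcosets\<^bsub>G\<^esub> (carrier G))" by (rule finite_subset) simp
  then show ?thesis using main[OF assms(2,3)] main[OF subgroup_self] by blast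
qed

section \<open>The tensor product with the rationals\<close>

context linear_map
begin

text \<open>By the exchange lemma, a nonzero \<open>v\<close> in the kernel together with a set of fewer than \<open>dim V\<close> vectors
  spans \<open>V\<close>; the images of the latter would span \<open>W\<close>.\<close>

lemma surjective_eq_dim_imp_kernel_trivial:
  assumes fd: "V.fin_dim" and surj: "T ` carrier V = carrier W" and dim: "V.dim = W.dim"
    and v: "v \<in> carrier V" "T v = \<zero>\<^bsub>W\<^esub>"
  shows "v = \<zero>\<^bsub>V\<^esub>"
proof (rule ccontr)
  assume "v \<noteq> \<zero>\<^bsub>V\<^esub>"
  then have li: "V.module.lin_indpt {v}"
    using V.lin_dep_iff_in_span[of "{}" v] v V.span_empty V.module.finite_lin_indpt2[of "{}"] by simp
  obtain \<beta> where \<beta>: "finite \<beta>" "V.basis \<beta>" using V.finite_basis_exists[OF fd] by auto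
  have \<beta>C: "\<beta> \<subseteq> carrier V" "V.module.span \<beta> = carrier V" using \<beta>(2) by (auto simp: V.basis_def)
  obtain C where C: "finite C" "C \<subseteq> carrier V" "int (card C) \<le> int (card \<beta>) - int (card {v})"
    "V.module.span ({v} \<union> C) = V.module.span \<beta>"
    using V.replacement[OF _ \<beta>(1) \<beta>C(1) li] v(1) \<beta>C(2) by auto
  have TC: "T ` C \<subseteq> carrier W" using C(2) by auto
  have sub: "submodule K (W.module.span (T ` C)) W" using W.module.span_is_submodule[OF TC] .
  then interpret S: submodule K "W.module.span (T ` C)" W .
  let ?N = "{x \<in> carrier V. T x \<in> W.module.span (T ` C)}"
  have "submodule K ?N V"
    unfolding submodule_def using V.module.module_axioms by (auto intro: S.m_closed S.smult_closed S.zero_closed)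
  moreover have "{v} \<union> C \<subseteq> ?N"
    using v C(2) W.module.in_own_span[OF TC] S.zero_closed by auto
  ultimately have "carrier V \<subseteq> ?N" using V.module.span_is_subset[of "{v} \<union> C" ?N] C(4) \<beta>C(2) by simp
  then have "carrier W \<subseteq> W.module.span (T ` C)" unfolding surj[symmetric] by auto
  then have "W.module.span (T ` C) = carrier W" using W.module.span_is_subset2[OF TC] by auto
  then have "W.dim \<le> card (T ` C)" using W.gen_ge_dim[OF _ TC] C(1) by auto
  also have "\<dots> \<le> card C" using C(1) by (rule card_image_le)
  also have "card C < card \<beta>" using C(3) by simp
  also have "card \<beta> = V.dim" using V.dim_basis[OF \<beta>] by simp
  finally show False using dim by simp
qed

end

locale rational_tensor = comm_group A for A :: "('a, 'b) monoid_scheme" (structure)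
begin

abbreviation ker where "ker \<equiv> tensor_rat_kernel A"

lemma carrier_free: "x \<in> carrier (tensor_rat_free A) \<longleftrightarrow> Poly_Mapping.keys x \<subseteq> carrier A \<times> UNIV"
  by (simp add: tensor_rat_free_def)

lemma free_simps: "monoid.mult (tensor_rat_free A) = (+)" "\<one>\<^bsub>tensor_rat_free A\<^esub> = 0"
  by (auto simp: tensor_rat_free_def free_Abelian_group_def)

lemma relations_carrier: "tensor_rat_relations A \<subseteq> carrier (tensor_rat_free A)"
  unfolding tensor_rat_relations_def subset_iff carrier_free
  by (auto dest!: subsetD[OF keys_diff])

lemma kernel_subgroup: "subgroup ker (tensor_rat_free A)"
  unfolding tensor_rat_kernel_def tensor_rat_free_def
  using relations_carrier unfolding tensor_rat_free_def
  by (intro group.generate_is_subgroup) auto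

lemma kernel_carrier: "x \<in> ker \<Longrightarrow> Poly_Mapping.keys x \<subseteq> carrier A \<times> UNIV"
  using subgroup.subset[OF kernel_subgroup] carrier_free by auto

lemma kernel_zero: "0 \<in> ker"
  using subgroup.one_closed[OF kernel_subgroup] by (simp add: free_simps)

lemma kernel_add: "x \<in> ker \<Longrightarrow> y \<in> ker \<Longrightarrow> x + y \<in> ker"
  using subgroup.m_closed[OF kernel_subgroup] by (simp add: free_simps)

lemma kernel_uminus: "x \<in> ker \<Longrightarrow> - x \<in> ker"
  using subgroup.m_inv_closed[OF kernel_subgroup, of x] kernel_carrier[of x]
  by (simp add: tensor_rat_free_def)

lemma kernel_diff: "x \<in> ker \<Longrightarrow> y \<in> ker \<Longrightarrow> x - y \<in> ker"
  using kernel_add[of x "- y"] kernel_uminus by simp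

lemma kernel_relation: "r \<in> tensor_rat_relations A \<Longrightarrow> r \<in> ker"
  unfolding tensor_rat_kernel_def by (rule generate.incl)

lemma kernel_mult: "a \<in> carrier A \<Longrightarrow> b \<in> carrier A \<Longrightarrow> frag_of (a \<otimes> b, q) - frag_of (a, q) - frag_of (b, q) \<in> ker"
  by (rule kernel_relation) (auto simp: tensor_rat_relations_def)

lemma kernel_plus: "a \<in> carrier A \<Longrightarrow> frag_of (a, q + r) - frag_of (a, q) - frag_of (a, r) \<in> ker"
  by (rule kernel_relation) (auto simp: tensor_rat_relations_def)

lemma kernel_induct [consumes 1, case_names zero mult plus add uminus]:
  assumes "x \<in> ker" "P 0"
    "\<And>a b q. a \<in> carrier A \<Longrightarrow> b \<in> carrier A \<Longrightarrow> P (frag_of (a \<otimes> b, q) - frag_of (a, q) - frag_of (b, q))"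
    "\<And>a q r. a \<in> carrier A \<Longrightarrow> P (frag_of (a, q + r) - frag_of (a, q) - frag_of (a, r))"
    "\<And>x y. P x \<Longrightarrow> P y \<Longrightarrow> P (x + y)" "\<And>x. P x \<Longrightarrow> P (- x)"
  shows "P x"
proof -
  have rel: "P r" if "r \<in> tensor_rat_relations A" for r
    using that assms(3,4) unfolding tensor_rat_relations_def by auto
  show ?thesis
    using assms(1) unfolding tensor_rat_kernel_def
  proof (induction rule: generate.induct)
    case (inv h)
    have "Poly_Mapping.keys h \<subseteq> carrier A \<times> UNIV" using relations_carrier inv carrier_free by auto
    then show ?case using rel[OF inv] assms(6) by (simp add: tensor_rat_free_def)
  qed (auto simp: free_simps assms rel)
qed

text \<open>The element of the tensor product represented by a formal combination of pairs; a pair \<open>(a, q)\<close>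
  represents \<open>a \<otimes> q\<close>.\<close>

definition cls :: "('a \<times> rat \<Rightarrow>\<^sub>0 int) \<Rightarrow> ('a \<times> rat \<Rightarrow>\<^sub>0 int) set"
  where "cls x = ker #>\<^bsub>tensor_rat_free A\<^esub> x"

lemma cls_image: "cls x = (\<lambda>k. k + x) ` ker"
  by (auto simp: cls_def r_coset_def free_simps)

lemma cls_eq_iff: "cls x = cls y \<longleftrightarrow> x - y \<in> ker"
proof
  assume "cls x = cls y"
  moreover have "x \<in> cls x" unfolding cls_image using kernel_zero by force
  ultimately obtain k where "k \<in> ker" "x = k + y" unfolding cls_image by auto
  then show "x - y \<in> ker" by simp
next
  assume xy: "x - y \<in> ker"
  have "k + x = (k + (x - y)) + y" "k + y = (k - (x - y)) + x" for k by auto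
  then show "cls x = cls y"
    unfolding cls_image using kernel_add[OF _ xy] kernel_diff[OF _ xy] by blast
qed

lemma cls_add: "cls x <#>\<^bsub>tensor_rat_free A\<^esub> cls y = cls (x + y)"
proof -
  have "(k + x) + (l + y) = (k + l) + (x + y)" "k + (x + y) = (k + x) + (0 + y)" for k l :: "'a \<times> rat \<Rightarrow>\<^sub>0 int"
    by (auto simp: algebra_simps)
  then show ?thesis
    unfolding cls_image set_mult_def free_simps using kernel_add kernel_zero by (auto; blast)
qed

lemma tensor_carrier: "carrier (tensor_rat A) = cls ` {x. Poly_Mapping.keys x \<subseteq> carrier A \<times> UNIV}"
  by (auto simp: tensor_rat_def FactGroup_def RCOSETS_def cls_def carrier_free)

lemma tensor_add: "cls x \<oplus>\<^bsub>tensor_rat A\<^esub> cls y = cls (x + y)"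
  by (simp add: tensor_rat_def FactGroup_def cls_add)

lemma tensor_zero: "\<zero>\<^bsub>tensor_rat A\<^esub> = cls 0"
  by (auto simp: tensor_rat_def FactGroup_def cls_image)

end

text \<open>Maps on a quotient are defined as unions over the elements of a coset.  For a map that respects
  the kernels all the sets in the union are equal.\<close>

lemma coset_map_cls:
  assumes "rational_tensor A" "rational_tensor B"
    and f: "\<And>x y. f (x + y) = f x + f y" "f ` tensor_rat_kernel A \<subseteq> tensor_rat_kernel B"
  shows "(\<Union>y\<in>rational_tensor.cls A x. rational_tensor.cls B (f y)) = rational_tensor.cls B (f x)"
proof -
  interpret A: rational_tensor A by fact
  interpret B: rational_tensor B by fact
  have "B.cls (f (k + x)) = B.cls (f x)" if "k \<in> A.ker" for k
    using f that by (auto simp: B.cls_eq_iff)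
  moreover have "A.ker \<noteq> {}" using A.kernel_zero by auto
  ultimately show ?thesis unfolding A.cls_image by auto
qed

context rational_tensor
begin

definition scale :: "rat \<Rightarrow> ('a \<times> rat \<Rightarrow>\<^sub>0 int) \<Rightarrow> ('a \<times> rat \<Rightarrow>\<^sub>0 int)"
  where "scale p x = frag_extend (\<lambda>(a, q). frag_of (a, p * q)) x"

lemma scale_add: "scale p (x + y) = scale p x + scale p y"
  by (simp add: scale_def frag_extend_add)

lemma scale_diff: "scale p (x - y) = scale p x - scale p y"
  by (simp add: scale_def frag_extend_diff)

lemma scale_zero: "scale p 0 = 0"
  by (simp add: scale_def)

lemma scale_kernel: "x \<in> ker \<Longrightarrow> scale p x \<in> ker"
proof (induction rule: kernel_induct)
  case (uminus x)
  then show ?case using kernel_uminus by (simp add: scale_def frag_extend_minus)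
qed (auto simp: scale_zero kernel_zero scale_add scale_diff kernel_add kernel_mult kernel_plus distrib_left
    scale_def[of _ "frag_of _"])

lemma tensor_smult: "p \<odot>\<^bsub>tensor_rat A\<^esub> cls x = cls (scale p x)"
proof -
  have "p \<odot>\<^bsub>tensor_rat A\<^esub> cls x = (\<Union>y\<in>cls x. cls (scale p y))"
    by (simp add: tensor_rat_def cls_def scale_def)
  moreover have "scale p ` ker \<subseteq> ker" using scale_kernel by auto
  ultimately show ?thesis
    using coset_map_cls[OF rational_tensor_axioms rational_tensor_axioms, of "scale p" x, OF scale_add] by simp
qed

lemma keys_scale: "Poly_Mapping.keys x \<subseteq> carrier A \<times> UNIV \<Longrightarrow> Poly_Mapping.keys (scale p x) \<subseteq> carrier A \<times> UNIV"
  unfolding scale_def by (rule order_trans[OF keys_frag_extend]) auto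

lemma frag_cases:
  assumes "Poly_Mapping.keys x \<subseteq> carrier A \<times> UNIV" "P 0" "\<And>a q. a \<in> carrier A \<Longrightarrow> P (frag_of (a, q))"
    "\<And>x y. P x \<Longrightarrow> P y \<Longrightarrow> P (x - y)"
  shows "P x"
  using assms(1) by (rule frag_induction) (use assms in auto)

lemma scale_plus:
  assumes "Poly_Mapping.keys x \<subseteq> carrier A \<times> UNIV"
  shows "scale (p + q) x - (scale p x + scale q x) \<in> ker"
proof (rule frag_cases[OF assms])
  fix a r assume "a \<in> carrier A"
  then show "scale (p + q) (frag_of (a, r)) - (scale p (frag_of (a, r)) + scale q (frag_of (a, r))) \<in> ker"
    using kernel_plus[of a "p * r" "q * r"] by (simp add: scale_def distrib_right diff_diff_eq)
next
  fix x y assume "scale (p + q) x - (scale p x + scale q x) \<in> ker" "scale (p + q) y - (scale p y + scale q y) \<in> ker"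
  then have "(scale (p + q) x - (scale p x + scale q x)) - (scale (p + q) y - (scale p y + scale q y)) \<in> ker"
    by (rule kernel_diff)
  then show "scale (p + q) (x - y) - (scale p (x - y) + scale q (x - y)) \<in> ker"
    by (simp add: scale_diff algebra_simps)
qed (simp add: scale_zero kernel_zero)

lemma scale_scale:
  assumes "Poly_Mapping.keys x \<subseteq> carrier A \<times> UNIV" shows "scale (p * q) x = scale p (scale q x)"
  by (rule frag_cases[OF assms]) (auto simp: scale_def frag_extend_diff mult.assoc)

lemma scale_one: assumes "Poly_Mapping.keys x \<subseteq> carrier A \<times> UNIV" shows "scale 1 x = x"
  by (rule frag_cases[OF assms]) (auto simp: scale_def frag_extend_diff)

lemma vectorspace_tensor: "vectorspace class_ring (tensor_rat A)"
proof (rule vs_criteria)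
  let ?C = "{x. Poly_Mapping.keys x \<subseteq> carrier A \<times> UNIV}"
  have add: "x + y \<in> ?C" if "x \<in> ?C" "y \<in> ?C" for x y :: "'a \<times> rat \<Rightarrow>\<^sub>0 int"
    using that keys_add[of x y] by auto
  show "field (class_ring :: rat ring)" by (rule class_field)
  show "\<zero>\<^bsub>tensor_rat A\<^esub> \<in> carrier (tensor_rat A)" by (auto simp: tensor_zero tensor_carrier)
  show "\<forall>v w. v \<in> carrier (tensor_rat A) \<and> w \<in> carrier (tensor_rat A) \<longrightarrow>
      v \<oplus>\<^bsub>tensor_rat A\<^esub> w \<in> carrier (tensor_rat A)"
    using add by (auto simp: tensor_carrier tensor_add)
  show "\<forall>v\<in>carrier (tensor_rat A). \<exists>w\<in>carrier (tensor_rat A). v \<oplus>\<^bsub>tensor_rat A\<^esub> w = \<zero>\<^bsub>tensor_rat A\<^esub>"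
  proof
    fix v assume "v \<in> carrier (tensor_rat A)"
    then obtain x where x: "x \<in> ?C" "v = cls x" by (auto simp: tensor_carrier)
    then show "\<exists>w\<in>carrier (tensor_rat A). v \<oplus>\<^bsub>tensor_rat A\<^esub> w = \<zero>\<^bsub>tensor_rat A\<^esub>"
      by (intro bexI[of _ "cls (- x)"]) (auto simp: tensor_carrier tensor_add tensor_zero)
  qed
  show "\<forall>c v. c \<in> carrier class_ring \<and> v \<in> carrier (tensor_rat A) \<longrightarrow> c \<odot>\<^bsub>tensor_rat A\<^esub> v \<in> carrier (tensor_rat A)"
    using keys_scale by (auto simp: tensor_carrier tensor_smult)
  show "\<forall>v w. v \<in> carrier (tensor_rat A) \<and> w \<in> carrier (tensor_rat A) \<longrightarrow>
      v \<oplus>\<^bsub>tensor_rat A\<^esub> w = w \<oplus>\<^bsub>tensor_rat A\<^esub> v"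
    by (auto simp: tensor_carrier tensor_add add.commute)
  show "\<forall>v w x. v \<in> carrier (tensor_rat A) \<and> w \<in> carrier (tensor_rat A) \<and> x \<in> carrier (tensor_rat A) \<longrightarrow>
      v \<oplus>\<^bsub>tensor_rat A\<^esub> w \<oplus>\<^bsub>tensor_rat A\<^esub> x = v \<oplus>\<^bsub>tensor_rat A\<^esub> (w \<oplus>\<^bsub>tensor_rat A\<^esub> x)"
    by (auto simp: tensor_carrier tensor_add add.assoc)
  show "\<forall>v\<in>carrier (tensor_rat A). v \<oplus>\<^bsub>tensor_rat A\<^esub> \<zero>\<^bsub>tensor_rat A\<^esub> = v"
    by (auto simp: tensor_carrier tensor_add tensor_zero)
  show "\<forall>a b v. a \<in> carrier class_ring \<and> b \<in> carrier class_ring \<and> v \<in> carrier (tensor_rat A) \<longrightarrow>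
      (a \<otimes>\<^bsub>class_ring\<^esub> b) \<odot>\<^bsub>tensor_rat A\<^esub> v = a \<odot>\<^bsub>tensor_rat A\<^esub> (b \<odot>\<^bsub>tensor_rat A\<^esub> v)"
    by (auto simp: tensor_carrier tensor_smult scale_scale)
  show "\<forall>v\<in>carrier (tensor_rat A). \<one>\<^bsub>class_ring\<^esub> \<odot>\<^bsub>tensor_rat A\<^esub> v = v"
    by (auto simp: tensor_carrier tensor_smult scale_one)
  show "\<forall>a b v. a \<in> carrier class_ring \<and> b \<in> carrier class_ring \<and> v \<in> carrier (tensor_rat A) \<longrightarrow>
      (a \<oplus>\<^bsub>class_ring\<^esub> b) \<odot>\<^bsub>tensor_rat A\<^esub> v = a \<odot>\<^bsub>tensor_rat A\<^esub> v \<oplus>\<^bsub>tensor_rat A\<^esub> b \<odot>\<^bsub>tensor_rat A\<^esub> v"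
  proof (intro allI impI)
    fix a b :: rat and v assume v: "a \<in> carrier class_ring \<and> b \<in> carrier class_ring \<and> v \<in> carrier (tensor_rat A)"
    then obtain x where x: "x \<in> ?C" "v = cls x" by (auto simp: tensor_carrier)
    then have "cls (scale (a + b) x) = cls (scale a x + scale b x)" using scale_plus cls_eq_iff by simp
    then show "(a \<oplus>\<^bsub>class_ring\<^esub> b) \<odot>\<^bsub>tensor_rat A\<^esub> v = a \<odot>\<^bsub>tensor_rat A\<^esub> v \<oplus>\<^bsub>tensor_rat A\<^esub> b \<odot>\<^bsub>tensor_rat A\<^esub> v"
      by (simp add: x(2) tensor_smult tensor_add)
  qed
  show "\<forall>a v w. a \<in> carrier class_ring \<and> v \<in> carrier (tensor_rat A) \<and> w \<in> carrier (tensor_rat A) \<longrightarrow>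
      a \<odot>\<^bsub>tensor_rat A\<^esub> (v \<oplus>\<^bsub>tensor_rat A\<^esub> w) = a \<odot>\<^bsub>tensor_rat A\<^esub> v \<oplus>\<^bsub>tensor_rat A\<^esub> a \<odot>\<^bsub>tensor_rat A\<^esub> w"
    by (auto simp: tensor_carrier tensor_smult tensor_add scale_add)
qed

lemma cls_one: "cls (frag_of (\<one>, q)) = cls 0"
  using kernel_uminus[OF kernel_mult[of \<one> \<one> q]] by (simp add: cls_eq_iff)

lemma cls_mult: "a \<in> carrier A \<Longrightarrow> b \<in> carrier A \<Longrightarrow> cls (frag_of (a \<otimes> b, q)) = cls (frag_of (a, q) + frag_of (b, q))"
  using kernel_mult[of a b q] by (simp add: cls_eq_iff diff_diff_eq)

lemma cls_inv:
  assumes "a \<in> carrier A" shows "cls (frag_of (inv a, q)) = cls (- frag_of (a, q))"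
proof -
  have "cls (frag_of (a, q) + frag_of (inv a, q)) = cls 0"
    using cls_mult[of a "inv a" q] cls_one[of q] assms by simp
  then show ?thesis by (simp add: cls_eq_iff add.commute)
qed

text \<open>The identity \<open>a\<^sup>k \<otimes> q = a \<otimes> k q\<close>, which makes the elements of \<open>A\<close> divisible in the tensor product.\<close>

lemma cls_pow:
  assumes "a \<in> carrier A" shows "cls (frag_of (a [^] (k::nat), q)) = cls (frag_of (a, of_nat k * q))"
proof (induction k)
  case 0
  have "frag_of (a, 0 + 0) - frag_of (a, 0) - frag_of (a, 0) \<in> ker" using kernel_plus[OF assms] .
  then have "frag_of (a, 0) \<in> ker" using kernel_uminus by fastforce
  then show ?case using cls_one[of q] by (simp add: cls_eq_iff kernel_diff)
next
  case (Suc k)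
  have "frag_of (a [^] Suc k, q) - frag_of (a [^] k, q) - frag_of (a, q) \<in> ker"
    using kernel_mult[of "a [^] k" a q] assms by simp
  moreover have "frag_of (a [^] k, q) - frag_of (a, of_nat k * q) \<in> ker"
    using Suc by (simp add: cls_eq_iff)
  moreover have "frag_of (a, of_nat k * q + q) - frag_of (a, of_nat k * q) - frag_of (a, q) \<in> ker"
    using kernel_plus[OF assms] .
  ultimately have "(frag_of (a [^] Suc k, q) - frag_of (a [^] k, q) - frag_of (a, q)) +
      (frag_of (a [^] k, q) - frag_of (a, of_nat k * q)) -
      (frag_of (a, of_nat k * q + q) - frag_of (a, of_nat k * q) - frag_of (a, q)) \<in> ker"
    using kernel_add kernel_diff by blast
  then show ?case by (simp add: cls_eq_iff algebra_simps)
qed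

text \<open>The elements \<open>s \<otimes> 1\<close>, for \<open>s\<close> in a set of generators, span the tensor product.\<close>

lemma fin_dim_tensor:
  assumes S: "finite S" "S \<subseteq> carrier A" "generate A S = carrier A"
  shows "vectorspace.fin_dim class_ring (tensor_rat A)"
proof -
  interpret vectorspace class_ring "tensor_rat A" by (rule vectorspace_tensor)
  let ?B = "(\<lambda>s. cls (frag_of (s, 1))) ` S"
  have B: "?B \<subseteq> carrier (tensor_rat A)" using S(2) by (auto simp: tensor_carrier)
  interpret N: submodule class_ring "span ?B" "tensor_rat A" by (rule span_is_submodule[OF B])
  have gen: "cls (frag_of (s, q)) \<in> span ?B" if "s \<in> S" for s q
  proof -
    have "cls (frag_of (s, 1)) \<in> span ?B" using in_own_span[OF B] that by auto
    then have "q \<odot>\<^bsub>tensor_rat A\<^esub> cls (frag_of (s, 1)) \<in> span ?B" by (intro N.smult_closed) auto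
    then show ?thesis by (simp add: tensor_smult scale_def)
  qed
  have neg: "cls (- x) \<in> span ?B" if "cls x \<in> span ?B" "Poly_Mapping.keys x \<subseteq> carrier A \<times> UNIV" for x
  proof -
    have "(- 1) \<odot>\<^bsub>tensor_rat A\<^esub> cls x \<in> span ?B" using that(1) by (intro N.smult_closed) auto
    moreover have "scale (- 1 + 1) x - (scale (- 1) x + scale 1 x) \<in> ker" using scale_plus[OF that(2)] .
    moreover have "scale 0 x \<in> ker"
      using scale_plus[OF that(2), of 0 0] kernel_uminus by fastforce
    ultimately have "scale (- 1) x - (- x) \<in> ker"
      using kernel_diff[of "scale 0 x" "scale (- 1 + 1) x - (scale (- 1) x + scale 1 x)"]
      by (simp add: scale_one[OF that(2)] algebra_simps)
    then have "cls (scale (- 1) x) = cls (- x)" by (simp add: cls_eq_iff)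
    then show ?thesis using \<open>(- 1) \<odot>\<^bsub>tensor_rat A\<^esub> cls x \<in> span ?B\<close> by (simp add: tensor_smult)
  qed
  have add: "cls (x + y) \<in> span ?B" if "cls x \<in> span ?B" "cls y \<in> span ?B" for x y
    using N.m_closed[OF that] by (simp add: tensor_add)
  have all: "cls (frag_of (a, q)) \<in> span ?B" if "a \<in> generate A S" for a q
    using that
  proof (induction rule: generate.induct)
    case one
    show ?case using N.zero_closed by (simp add: cls_one tensor_zero)
  next
    case (incl h)
    then show ?case by (rule gen)
  next
    case (inv h)
    then show ?case using neg[OF gen[OF inv]] S(2) by (auto simp: cls_inv)
  next
    case (eng g h)
    then have "g \<in> carrier A" "h \<in> carrier A" using S(3) by auto
    then show ?case using eng add by (simp add: cls_mult)
  qed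
  have "cls x \<in> span ?B \<and> Poly_Mapping.keys x \<subseteq> carrier A \<times> UNIV" if "Poly_Mapping.keys x \<subseteq> carrier A \<times> UNIV" for x
  proof (rule frag_cases[OF that])
    show "cls 0 \<in> span ?B \<and> Poly_Mapping.keys (0 :: 'a \<times> rat \<Rightarrow>\<^sub>0 int) \<subseteq> carrier A \<times> UNIV"
      using N.zero_closed by (simp add: tensor_zero)
    fix x y assume "cls x \<in> span ?B \<and> Poly_Mapping.keys x \<subseteq> carrier A \<times> UNIV"
      "cls y \<in> span ?B \<and> Poly_Mapping.keys y \<subseteq> carrier A \<times> UNIV"
    then show "cls (x - y) \<in> span ?B \<and> Poly_Mapping.keys (x - y) \<subseteq> carrier A \<times> UNIV"
      using add[of x "- y"] neg[of y] keys_diff[of x y] by auto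
  qed (use all S(3) in auto)
  then have "span ?B = carrier (tensor_rat A)"
    using span_is_subset2[OF B] by (auto simp: tensor_carrier)
  then show ?thesis unfolding fin_dim_def using B S(1) by (intro exI[of _ ?B]) auto
qed

end

definition tensor_map :: "('a \<Rightarrow> 'c) \<Rightarrow> ('a \<times> rat \<Rightarrow>\<^sub>0 int) \<Rightarrow> ('c \<times> rat \<Rightarrow>\<^sub>0 int)"
  where "tensor_map f x = frag_extend (\<lambda>(a, q). frag_of (f a, q)) x"

text \<open>Injectivity of \<open>f \<otimes> \<rat>\<close>.  If \<open>b\<^sup>k = f a\<close> with \<open>k > 0\<close>, then \<open>b \<otimes> q\<close> is the image of \<open>a \<otimes> (q / k)\<close>;
  so \<open>f \<otimes> \<rat>\<close> is surjective, and both sides have the same finite dimension.\<close>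

lemma mem_kernel_of_tensor_map:
  fixes A :: "('a, 'b) monoid_scheme" and B :: "('c, 'd) monoid_scheme"
  assumes "comm_group A" "comm_group B" and f: "f \<in> hom A B"
    and fg: "finite S" "S \<subseteq> carrier A" "generate A S = carrier A"
    and rank: "torsion_free_rank A = torsion_free_rank B"
    and pow: "\<And>b. b \<in> carrier B \<Longrightarrow> \<exists>k>0. b [^]\<^bsub>B\<^esub> (k::nat) \<in> f ` carrier A"
    and x: "Poly_Mapping.keys x \<subseteq> carrier A \<times> UNIV" "tensor_map f x \<in> tensor_rat_kernel B"
  shows "x \<in> tensor_rat_kernel A"
proof -
  interpret A: rational_tensor A using assms(1) by (rule rational_tensor.intro)
  interpret B: rational_tensor B using assms(2) by (rule rational_tensor.intro)
  have add: "tensor_map f (x + y) = tensor_map f x + tensor_map f y" for x y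
    by (simp add: tensor_map_def frag_extend_add)
  have minus: "tensor_map f (- x) = - tensor_map f x" and diff: "tensor_map f (x - y) = tensor_map f x - tensor_map f y" for x y
    by (simp_all add: tensor_map_def frag_extend_minus frag_extend_diff)
  have of: "tensor_map f (frag_of (a, q)) = frag_of (f a, q)" for a q by (simp add: tensor_map_def)
  have fA: "f a \<in> carrier B" if "a \<in> carrier A" for a using hom_in_carrier[OF f that] .
  have ker: "tensor_map f k \<in> B.ker" if "k \<in> A.ker" for k
    using that
  proof (induction rule: A.kernel_induct)
    case (mult a b q)
    then show ?case using B.kernel_mult[of "f a" "f b" q] hom_mult[OF f] fA by (simp add: diff of)
  qed (auto simp: add minus diff of B.kernel_zero B.kernel_add B.kernel_uminus B.kernel_plus fA tensor_map_def[of f 0])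
  define T where "T = (\<lambda>C. \<Union>y\<in>C. B.cls (tensor_map f y))"
  have T: "T (A.cls y) = B.cls (tensor_map f y)" for y
    unfolding T_def using ker add
    by (intro coset_map_cls[OF A.rational_tensor_axioms B.rational_tensor_axioms]) auto
  have keys: "Poly_Mapping.keys (tensor_map f y) \<subseteq> carrier B \<times> UNIV" if "Poly_Mapping.keys y \<subseteq> carrier A \<times> UNIV" for y
    unfolding tensor_map_def using that fA by (intro order_trans[OF keys_frag_extend]) auto
  have scale: "tensor_map f (A.scale p y) = B.scale p (tensor_map f y)" if "Poly_Mapping.keys y \<subseteq> carrier A \<times> UNIV" for p y
    by (rule A.frag_cases[OF that])
       (auto simp: A.scale_diff B.scale_diff diff of A.scale_zero B.scale_zero A.scale_def[of _ "frag_of _"]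
         B.scale_def[of _ "frag_of _"] tensor_map_def[of f 0])
  interpret VA: vectorspace class_ring "tensor_rat A" by (rule A.vectorspace_tensor)
  interpret VB: vectorspace class_ring "tensor_rat B" by (rule B.vectorspace_tensor)
  have "T \<in> module_hom class_ring (tensor_rat A) (tensor_rat B)"
    unfolding module_hom_def
    using keys by (auto simp: A.tensor_carrier B.tensor_carrier T A.tensor_add B.tensor_add add
        A.tensor_smult B.tensor_smult scale)
  then interpret linear_map class_ring "tensor_rat A" "tensor_rat B" T
    unfolding linear_map_def mod_hom_def mod_hom_axioms_def
    using A.vectorspace_tensor B.vectorspace_tensor VA.module_axioms VB.module_axioms by blast
  have frag: "\<exists>y. Poly_Mapping.keys y \<subseteq> carrier A \<times> UNIV \<and> B.cls z = B.cls (tensor_map f y)"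
    if "Poly_Mapping.keys z \<subseteq> carrier B \<times> UNIV" for z
  proof (rule B.frag_cases[OF that])
    fix b q assume b: "b \<in> carrier B"
    obtain k :: nat and a where k: "k > 0" "a \<in> carrier A" "b [^]\<^bsub>B\<^esub> k = f a" using pow[OF b] by auto
    have "B.cls (frag_of (b, of_nat k * (q / of_nat k))) = B.cls (frag_of (f a, q / of_nat k))"
      using B.cls_pow[OF b, of k "q / of_nat k"] k(3) by simp
    then show "\<exists>y. Poly_Mapping.keys y \<subseteq> carrier A \<times> UNIV \<and> B.cls (frag_of (b, q)) = B.cls (tensor_map f y)"
      using k by (intro exI[of _ "frag_of (a, q / of_nat k)"]) (auto simp: of)
  next
    fix z z'
    assume "\<exists>y. Poly_Mapping.keys y \<subseteq> carrier A \<times> UNIV \<and> B.cls z = B.cls (tensor_map f y)"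
      "\<exists>y. Poly_Mapping.keys y \<subseteq> carrier A \<times> UNIV \<and> B.cls z' = B.cls (tensor_map f y)"
    then obtain y y' where y: "Poly_Mapping.keys y \<subseteq> carrier A \<times> UNIV" "Poly_Mapping.keys y' \<subseteq> carrier A \<times> UNIV"
      "z - tensor_map f y \<in> B.ker" "z' - tensor_map f y' \<in> B.ker" by (auto simp: B.cls_eq_iff)
    then have "(z - tensor_map f y) - (z' - tensor_map f y') \<in> B.ker" using B.kernel_diff by blast
    then show "\<exists>y. Poly_Mapping.keys y \<subseteq> carrier A \<times> UNIV \<and> B.cls (z - z') = B.cls (tensor_map f y)"
      using y keys_diff[of y y'] by (intro exI[of _ "y - y'"]) (auto simp: B.cls_eq_iff diff algebra_simps)
  qed (auto intro!: exI[of _ 0] simp: tensor_map_def)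
  have "T ` carrier (tensor_rat A) = carrier (tensor_rat B)"
  proof
    show "T ` carrier (tensor_rat A) \<subseteq> carrier (tensor_rat B)"
      using keys by (auto simp: A.tensor_carrier B.tensor_carrier T)
    show "carrier (tensor_rat B) \<subseteq> T ` carrier (tensor_rat A)"
    proof
      fix c assume "c \<in> carrier (tensor_rat B)"
      then obtain z where z: "Poly_Mapping.keys z \<subseteq> carrier B \<times> UNIV" "c = B.cls z" by (auto simp: B.tensor_carrier)
      obtain y where y: "Poly_Mapping.keys y \<subseteq> carrier A \<times> UNIV" "c = T (A.cls y)"
        using frag[OF z(1)] z(2) by (auto simp: T)
      then show "c \<in> T ` carrier (tensor_rat A)" by (auto simp: A.tensor_carrier)
    qed
  qed
  moreover have "A.cls x \<in> carrier (tensor_rat A)" using x(1) by (auto simp: A.tensor_carrier)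
  moreover have "T (A.cls x) = \<zero>\<^bsub>tensor_rat B\<^esub>" using x(2) by (simp add: T B.tensor_zero B.cls_eq_iff)
  ultimately have "A.cls x = \<zero>\<^bsub>tensor_rat A\<^esub>"
    using surjective_eq_dim_imp_kernel_trivial[OF A.fin_dim_tensor[OF fg]] rank
    unfolding torsion_free_rank_def by blast
  then show ?thesis by (simp add: A.tensor_zero A.cls_eq_iff)
qed

section \<open>Extension of characters from a subgroup of finite index\<close>

context finite_index
begin

lemma rep_mult_right:
  assumes "x \<in> carrier G" "y \<in> carrier G" shows "rep (rep x \<otimes> y) = rep (x \<otimes> y)"
proof -
  have r: "rep x \<in> carrier G" "x \<otimes> inv (rep x) \<in> K" using rep(1,2)[OF assms(1)] by auto
  have "(x \<otimes> inv (rep x)) \<otimes> (rep x \<otimes> y) = x \<otimes> y"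
    using assms r(1) by (simp add: m_assoc) (simp add: m_assoc[symmetric])
  then show ?thesis using rep_mult[OF m_closed[OF r(1) assms(2)] r(2)] by simp
qed

text \<open>Schreier's generators.  Reading a word from left to right, \<open>x\<close> is replaced by \<open>x s\<close>, and
  \<open>x (rep x)\<^sup>-\<^sup>1\<close> is multiplied on the right by the generator \<open>t s (rep (t s))\<^sup>-\<^sup>1\<close> for \<open>t = rep x\<close>.\<close>

lemma finitely_generated_subgroup:
  assumes S: "finite S" "S \<subseteq> carrier G" "generate G S = carrier G"
  obtains U where "finite U" "U \<subseteq> K" "generate (G\<lparr>carrier := K\<rparr>) U = K"
proof -
  define S' where "S' = S \<union> (\<lambda>s. inv s) ` S"
  have S': "finite S'" "S' \<subseteq> carrier G" using S by (auto simp: S'_def)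
  define step where "step = (\<lambda>(t, s). t \<otimes> s \<otimes> inv (rep (t \<otimes> s)))"
  \<comment> \<open>The representative of \<open>K\<close> itself may differ from \<open>\<one>\<close>.\<close>
  define U where "U = insert (rep \<one>) (step ` ((rep ` carrier G) \<times> S'))"
  have "finite U" using finite_rep S'(1) by (simp add: U_def)
  have "inv (inv (rep \<one>)) \<in> K"
    using rep(2)[of \<one>] rep(1)[of \<one>] subgroup.m_inv_closed[OF subgroup, of "inv (rep \<one>)"] by simp
  then have "rep \<one> \<in> K" using rep(1)[of \<one>] by simp
  moreover have "step (t, s) \<in> K" if "t \<in> rep ` carrier G" "s \<in> S'" for t s
    using that rep(1) S'(2) unfolding step_def by (auto intro!: rep(2))
  ultimately have UK: "U \<subseteq> K" by (auto simp: U_def)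
  have KG: "K \<subseteq> carrier G" using subgroup.subset[OF subgroup] .
  have gen: "subgroup (generate G U) G" using UK KG by (intro generate_is_subgroup) auto
  define good where "good = (\<lambda>x. x \<in> carrier G \<and> x \<otimes> inv (rep x) \<in> generate G U)"
  have good_step: "good (x \<otimes> s)" if x: "good x" and s: "s \<in> S'" for x s
  proof -
    have c: "x \<in> carrier G" "s \<in> carrier G" "rep x \<in> carrier G" "x \<otimes> s \<in> carrier G"
      using x s S'(2) rep(1) by (auto simp: good_def)
    have "step (rep x, s) \<in> generate G U" using s c by (intro generate.incl) (auto simp: U_def)
    then have "(x \<otimes> inv (rep x)) \<otimes> step (rep x, s) \<in> generate G U"
      using x subgroup.m_closed[OF gen] by (auto simp: good_def)
    moreover have "(x \<otimes> inv (rep x)) \<otimes> step (rep x, s) = x \<otimes> s \<otimes> inv (rep (x \<otimes> s))"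
    proof -
      have "rep (x \<otimes> s) \<in> carrier G" using rep(1) c(4) by auto
      moreover have "inv (rep x) \<otimes> (rep x \<otimes> y) = y" if "y \<in> carrier G" for y
        using that c(3) by (simp add: m_assoc[symmetric])
      ultimately show ?thesis
        using c rep_mult_right[OF c(1,2)] by (simp add: step_def m_assoc)
    qed
    ultimately show ?thesis using c(4) by (simp add: good_def)
  qed
  have "\<forall>x. good x \<longrightarrow> good (x \<otimes> g)" if "g \<in> generate G S" for g
    using that
  proof (induction rule: generate.induct)
    case one
    show ?case by (simp add: good_def)
  next
    case (incl s)
    then show ?case using good_step by (simp add: S'_def)
  next
    case (inv s)
    then show ?case using good_step by (simp add: S'_def)
  next
    case (eng g h)
    have "g \<in> carrier G" "h \<in> carrier G" using eng.hyps S(3) by auto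
    then have "x \<otimes> (g \<otimes> h) = x \<otimes> g \<otimes> h" if "good x" for x
      using that by (simp add: good_def m_assoc)
    then show ?case using eng.IH by simp
  qed
  moreover have "inv (rep \<one>) \<in> generate G U"
    by (rule subgroup.m_inv_closed[OF gen generate.incl]) (simp add: U_def)
  then have "good \<one>" unfolding good_def using rep(1)[of \<one>] by simp
  ultimately have good: "good g" if "g \<in> carrier G" for g
    using that S(3) \<open>good \<one>\<close> l_one[OF that] by metis
  have "K \<subseteq> generate G U"
  proof
    fix k assume k: "k \<in> K"
    then have kG: "k \<in> carrier G" using KG by auto
    have "rep k = rep \<one>" using rep_mult[OF one_closed k] kG by simp
    then have "k \<otimes> inv (rep \<one>) \<in> generate G U" "rep \<one> \<in> generate G U"
      using good[OF kG] generate.incl[of "rep \<one>" U G] by (auto simp: good_def U_def)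
    then have "k \<otimes> inv (rep \<one>) \<otimes> rep \<one> \<in> generate G U" using subgroup.m_closed[OF gen] by blast
    then show "k \<in> generate G U" using kG rep(1)[of \<one>] by (simp add: m_assoc)
  qed
  moreover have "generate G U \<subseteq> K" by (rule generate_subgroup_incl[OF UK subgroup])
  ultimately have "generate (G\<lparr>carrier := K\<rparr>) U = K"
    using generate_consistent[OF UK subgroup] by simp
  then show ?thesis using that \<open>finite U\<close> UK by blast
qed

end

context group
begin

definition ab :: "'a \<Rightarrow> 'a set"
  where "ab g = derived G (carrier G) #> g"

lemma derived_normal: "derived G (carrier G) \<lhd> G"
  by (rule derived_is_normal) (rule normal_self)

lemma comm_group_abelianisation: "comm_group (abelianisation G)"
  unfolding abelianisation_def by (rule derived_quot_is_comm_group)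

lemma ab_hom: "ab \<in> hom G (abelianisation G)"
  unfolding abelianisation_def ab_def using normal.r_coset_hom_Mod[OF derived_normal] .

lemma ab_onto: "ab ` carrier G = carrier (abelianisation G)"
  by (auto simp: abelianisation_def FactGroup_def RCOSETS_def ab_def)

lemma ab_eqD:
  assumes "g \<in> carrier G" "h \<in> carrier G" "ab g = ab h"
  obtains d where "d \<in> derived G (carrier G)" "g = d \<otimes> h"
proof -
  have "g \<in> ab g" unfolding ab_def
    using rcos_self[OF assms(1) normal_imp_subgroup[OF derived_normal]] .
  then show ?thesis using that assms(3) unfolding ab_def r_coset_def by auto
qed

lemma ab_pow: "g \<in> carrier G \<Longrightarrow> ab (g [^] (k::nat)) = ab g [^]\<^bsub>abelianisation G\<^esub> k"
proof -
  interpret H: comm_group "abelianisation G" by (rule comm_group_abelianisation)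
  interpret group_hom G "abelianisation G" ab by unfold_locales (rule ab_hom)
  show "g \<in> carrier G \<Longrightarrow> ab (g [^] (k::nat)) = ab g [^]\<^bsub>abelianisation G\<^esub> k"
    by (rule hom_nat_pow)
qed

lemma generate_abelianisation:
  assumes "S \<subseteq> carrier G" "generate G S = carrier G"
  shows "generate (abelianisation G) (ab ` S) = carrier (abelianisation G)"
proof -
  interpret H: comm_group "abelianisation G" by (rule comm_group_abelianisation)
  interpret group_hom G "abelianisation G" ab by unfold_locales (rule ab_hom)
  show ?thesis using generate_img[OF assms(1)] assms(2) ab_onto by simp
qed

end

context real_character
begin

lemma derived_zero: "d \<in> derived G (carrier G) \<Longrightarrow> d \<in> carrier G \<and> \<xi> d = 0"
  unfolding derived_def
proof (induction rule: generate.induct)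
  case (inv h)
  then show ?case by (auto simp: char_mult char_inv)
qed (auto simp: char_one char_mult char_inv)

lemma ab_eq_imp_eq:
  assumes "g \<in> carrier G" "h \<in> carrier G" "ab g = ab h" shows "\<xi> g = \<xi> h"
  using ab_eqD[OF assms] derived_zero assms(2) char_mult by (metis add_0)

definition on_ab :: "'a set \<Rightarrow> real"
  where "on_ab C = \<xi> (SOME h. h \<in> carrier G \<and> ab h = C)"

lemma on_ab: "h \<in> carrier G \<Longrightarrow> on_ab (ab h) = \<xi> h"
  unfolding on_ab_def by (rule someI2[of _ h]) (auto intro: ab_eq_imp_eq)

text \<open>The extension of \<open>a \<otimes> q \<mapsto> q \<xi> a\<close> to formal combinations.  It vanishes on the relations of the tensor
  product, so that \<open>\<xi>\<close> can be computed there.\<close>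

definition on_tensor :: "('a set \<times> rat \<Rightarrow>\<^sub>0 int) \<Rightarrow> real"
  where "on_tensor x = (\<Sum>i\<in>Poly_Mapping.keys x. of_int (poly_mapping.lookup x i) * (real_of_rat (snd i) * on_ab (fst i)))"

lemma on_tensor_superset:
  assumes "finite U" "Poly_Mapping.keys x \<subseteq> U"
  shows "on_tensor x = (\<Sum>i\<in>U. of_int (poly_mapping.lookup x i) * (real_of_rat (snd i) * on_ab (fst i)))"
  unfolding on_tensor_def by (rule sum.mono_neutral_left) (use assms in \<open>auto simp: in_keys_iff\<close>)

lemma on_tensor_add: "on_tensor (x + y) = on_tensor x + on_tensor y"
proof -
  let ?U = "Poly_Mapping.keys x \<union> Poly_Mapping.keys y"
  have "Poly_Mapping.keys (x + y) \<subseteq> ?U" by (rule keys_add)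
  then show ?thesis
    using on_tensor_superset[of ?U x] on_tensor_superset[of ?U y] on_tensor_superset[of ?U "x + y"]
    by (simp add: lookup_add sum.distrib distrib_right)
qed

lemma on_tensor_uminus: "on_tensor (- x) = - on_tensor x"
  using on_tensor_add[of x "- x"] by (simp add: on_tensor_def[of 0])

lemma on_tensor_diff: "on_tensor (x - y) = on_tensor x - on_tensor y"
  using on_tensor_add[of x "- y"] by (simp add: on_tensor_uminus)

lemma on_tensor_frag_of: "h \<in> carrier G \<Longrightarrow> on_tensor (frag_of (ab h, q)) = real_of_rat q * \<xi> h"
  by (simp add: on_tensor_def on_ab)

lemma on_tensor_kernel: "x \<in> tensor_rat_kernel (abelianisation G) \<Longrightarrow> on_tensor x = 0"
proof -
  interpret A: rational_tensor "abelianisation G" by (rule rational_tensor.intro[OF comm_group_abelianisation])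
  show "x \<in> tensor_rat_kernel (abelianisation G) \<Longrightarrow> on_tensor x = 0"
  proof (induction rule: A.kernel_induct)
    case (mult a b q)
    then obtain g h where gh: "g \<in> carrier G" "h \<in> carrier G" "a = ab g" "b = ab h"
      unfolding ab_onto[symmetric] by auto
    then have "a \<otimes>\<^bsub>abelianisation G\<^esub> b = ab (g \<otimes> h)" using hom_mult[OF ab_hom] by simp
    then show ?case using gh by (simp only: on_tensor_diff on_tensor_frag_of char_mult m_closed) (simp add: algebra_simps)
  next
    case (plus a q r)
    then obtain g where g: "g \<in> carrier G" "a = ab g" unfolding ab_onto[symmetric] by auto
    then show ?case by (simp only: on_tensor_diff on_tensor_frag_of of_rat_add) (simp add: algebra_simps)
  qed (auto simp: on_tensor_add on_tensor_uminus on_tensor_def[of 0])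
qed

end

context finite_index
begin

definition exponent :: "'a \<Rightarrow> nat"
  where "exponent g = (SOME k. k > 0 \<and> g [^] k \<in> K)"

lemma exponent:
  assumes "g \<in> carrier G" shows "exponent g > 0" "g [^] exponent g \<in> K"
proof -
  have "\<exists>k::nat. k > 0 \<and> g [^] k \<in> K" using pow_mem[OF assms] by metis
  then show "exponent g > 0" "g [^] exponent g \<in> K"
    unfolding exponent_def by (metis (mono_tags, lifting) someI_ex)+
qed

text \<open>The only candidate for a character of \<open>G\<close> that extends a character \<open>\<eta>\<close> of \<open>K\<close>.\<close>

definition root_extension :: "('a \<Rightarrow> real) \<Rightarrow> 'a \<Rightarrow> real"
  where "root_extension \<eta> = (\<lambda>g\<in>carrier G. \<eta> (g [^] exponent g) / real (exponent g))"

text \<open>The inclusion of \<open>K\<close> induces a map \<open>f\<close> of abelianisations, and \<open>f \<otimes> \<rat>\<close> is injective because of the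
  hypothesis on the ranks.  If the \<open>k\<close>-th powers of \<open>g\<close>, \<open>h\<close> and \<open>g \<otimes> h\<close> are in \<open>K\<close>, then
  \<open>(g \<otimes> h) [^] k\<close> and \<open>g [^] k \<otimes> h [^] k\<close> have the same image in the abelianisation of \<open>G\<close>, hence also in the
  tensor product of the abelianisation of \<open>K\<close> with the rationals, and \<open>\<eta>\<close> does not distinguish them.
  The quotient \<open>\<eta> (g [^] m) / m\<close> does not depend on \<open>m\<close>, so that a common exponent can be used.\<close>

theorem root_extension_character:
  fixes \<eta> :: "'a \<Rightarrow> real"
  assumes fg: "finitely_generated_group G"
    and rank: "torsion_free_rank (abelianisation G) = torsion_free_rank (abelianisation (G\<lparr>carrier := K\<rparr>))"
    and \<eta>: "\<And>g h. g \<in> K \<Longrightarrow> h \<in> K \<Longrightarrow> \<eta> (g \<otimes> h) = \<eta> g + \<eta> h"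
  shows "\<And>g h. g \<in> carrier G \<Longrightarrow> h \<in> carrier G \<Longrightarrow>
      root_extension \<eta> (g \<otimes> h) = root_extension \<eta> g + root_extension \<eta> h"
    and "\<And>h. h \<in> K \<Longrightarrow> root_extension \<eta> h = \<eta> h"
proof -
  let ?K = "G\<lparr>carrier := K\<rparr>"
  interpret K: group ?K using subgroup_imp_group[OF subgroup] .
  interpret \<eta>: real_character ?K \<eta> by unfold_locales (use \<eta> in auto)
  have KG: "k \<in> carrier G" if "k \<in> K" for k using subgroup.subset[OF subgroup] that by auto
  obtain S where "finite S" "S \<subseteq> carrier G" "generate G S = carrier G"
    using fg unfolding finitely_generated_group_def by auto
  then obtain U where U: "finite U" "U \<subseteq> K" "generate ?K U = K"
    using finitely_generated_subgroup by blast
  have derived: "derived ?K K \<subseteq> derived G (carrier G)"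
    using derived_consistent[OF order_refl subgroup] mono_derived[of K "carrier G"] subgroup.subset[OF subgroup] by simp
  have ab_eq: "ab g = ab h" if gh: "g \<in> K" "h \<in> K" "K.ab g = K.ab h" for g h
  proof -
    obtain d where d: "d \<in> derived ?K K" "g = d \<otimes> h" using K.ab_eqD[of g h] gh by auto
    then have "g \<in> derived G (carrier G) #> h" using derived unfolding r_coset_def by auto
    from repr_independence[OF this KG[OF gh(2)] normal_imp_subgroup[OF derived_normal]]
    show ?thesis unfolding ab_def by (rule sym)
  qed
  define f where "f = (\<lambda>C. ab (SOME h. h \<in> K \<and> K.ab h = C))"
  have f: "f (K.ab h) = ab h" if "h \<in> K" for h
    unfolding f_def
  proof (rule someI2[of _ h])
    show "ab h' = ab h" if "h' \<in> K \<and> K.ab h' = K.ab h" for h' using ab_eq that \<open>h \<in> K\<close> by blast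
  qed (simp add: that)
  have K_onto: "K.ab ` K = carrier (abelianisation ?K)" using K.ab_onto by simp
  have fhom: "f \<in> hom (abelianisation ?K) (abelianisation G)"
  proof (rule homI)
    fix C assume "C \<in> carrier (abelianisation ?K)"
    then show "f C \<in> carrier (abelianisation G)"
      unfolding K_onto[symmetric] ab_onto[symmetric] using f KG by auto
  next
    fix C D assume "C \<in> carrier (abelianisation ?K)" "D \<in> carrier (abelianisation ?K)"
    then obtain g h where gh: "g \<in> K" "h \<in> K" "C = K.ab g" "D = K.ab h" unfolding K_onto[symmetric] by auto
    have "C \<otimes>\<^bsub>abelianisation ?K\<^esub> D = K.ab (g \<otimes> h)" using hom_mult[OF K.ab_hom, of g h] gh by simp
    then show "f (C \<otimes>\<^bsub>abelianisation ?K\<^esub> D) = f C \<otimes>\<^bsub>abelianisation G\<^esub> f D"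
      using gh f subgroup.m_closed[OF subgroup] hom_mult[OF ab_hom KG[OF gh(1)] KG[OF gh(2)]] by simp
  qed
  have powers: "\<exists>k>0. C [^]\<^bsub>abelianisation G\<^esub> (k::nat) \<in> f ` carrier (abelianisation ?K)"
    if C: "C \<in> carrier (abelianisation G)" for C
  proof -
    obtain g where g: "g \<in> carrier G" "C = ab g" using C unfolding ab_onto[symmetric] by auto
    obtain k :: nat where k: "k > 0" "g [^] k \<in> K" using pow_mem[OF g(1)] .
    have "C [^]\<^bsub>abelianisation G\<^esub> k = f (K.ab (g [^] k))"
      unfolding f[OF k(2)] g(2) ab_pow[OF g(1)] by (rule refl)
    then show ?thesis using k K_onto by blast
  qed
  interpret AG: rational_tensor "abelianisation G" by (rule rational_tensor.intro[OF comm_group_abelianisation])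
  have key: "\<eta> ((g \<otimes> h) [^] k) = \<eta> (g [^] k) + \<eta> (h [^] k)"
    if gh: "g \<in> carrier G" "h \<in> carrier G" and k: "g [^] k \<in> K" "h [^] k \<in> K" "(g \<otimes> h) [^] k \<in> K" for g h and k :: nat
  proof -
    let ?u = "frag_of (K.ab ((g \<otimes> h) [^] k), 1) - frag_of (K.ab (g [^] k), 1) - frag_of (K.ab (h [^] k), 1)"
    have keys: "Poly_Mapping.keys ?u \<subseteq> carrier (abelianisation ?K) \<times> UNIV"
      unfolding K_onto[symmetric] using k by (auto dest!: subsetD[OF keys_diff])
    have abG: "ab g \<in> carrier (abelianisation G)" "ab h \<in> carrier (abelianisation G)" using gh ab_onto by auto
    have "ab ((g \<otimes> h) [^] k) = ab (g [^] k) \<otimes>\<^bsub>abelianisation G\<^esub> ab (h [^] k)"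
      using gh abG ab_pow hom_mult[OF ab_hom gh] AG.nat_pow_distrib[OF abG] by simp
    moreover have "ab (g [^] k) \<in> carrier (abelianisation G)" "ab (h [^] k) \<in> carrier (abelianisation G)"
      using gh ab_onto by auto
    ultimately have ker: "tensor_map f ?u \<in> tensor_rat_kernel (abelianisation G)"
      using AG.kernel_mult[of "ab (g [^] k)" "ab (h [^] k)" 1] k f by (simp add: tensor_map_def frag_extend_diff)
    have "?u \<in> tensor_rat_kernel (abelianisation ?K)"
      by (rule mem_kernel_of_tensor_map[OF K.comm_group_abelianisation comm_group_abelianisation fhom
            _ _ _ rank[symmetric] powers keys ker, of "K.ab ` U"])
        (use U K.generate_abelianisation[of U] image_mono[OF U(2), of K.ab, unfolded K_onto] in simp_all)
    then have "\<eta>.on_tensor ?u = 0" by (rule \<eta>.on_tensor_kernel)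
    then show ?thesis using k by (simp add: \<eta>.on_tensor_diff \<eta>.on_tensor_frag_of)
  qed
  have \<eta>_pow: "\<eta> (h [^] (k::nat)) = real k * \<eta> h" if "h \<in> K" for h k
    using \<eta>.char_pow[of h k] that by (simp add: nat_pow_consistent[symmetric])
  have K_pow: "h [^] (k::nat) \<in> K" if "h \<in> K" for h k
    using K.nat_pow_closed[of h k] that by (simp add: nat_pow_consistent[symmetric])
  have root: "root_extension \<eta> g = \<eta> (g [^] m) / real m" if g: "g \<in> carrier G" and m: "m > 0" "g [^] m \<in> K" for g and m :: nat
  proof -
    have "(g [^] exponent g) [^] m = (g [^] m) [^] exponent g" using g by (simp add: nat_pow_pow mult.commute)
    then have "real m * \<eta> (g [^] exponent g) = real (exponent g) * \<eta> (g [^] m)"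
      using \<eta>_pow[OF exponent(2)[OF g], of m] \<eta>_pow[OF m(2), of "exponent g"] by simp
    then show ?thesis using exponent(1)[OF g] m(1) g by (simp add: root_extension_def field_simps)
  qed
  show "root_extension \<eta> (g \<otimes> h) = root_extension \<eta> g + root_extension \<eta> h" if gh: "g \<in> carrier G" "h \<in> carrier G" for g h
  proof -
    let ?gh = "g \<otimes> h"
    define m where "m = exponent g * exponent h * exponent ?gh"
    have c: "?gh \<in> carrier G" using gh by simp
    have "m > 0" using exponent(1) gh c by (simp add: m_def)
    have "m = exponent g * (exponent h * exponent ?gh)" "m = exponent h * (exponent g * exponent ?gh)" "m = exponent ?gh * (exponent g * exponent h)" by (auto simp: m_def)
    then have "g [^] m = (g [^] exponent g) [^] (exponent h * exponent ?gh)" "h [^] m = (h [^] exponent h) [^] (exponent g * exponent ?gh)"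
      "?gh [^] m = (?gh [^] exponent ?gh) [^] (exponent g * exponent h)"
      using gh c by (metis nat_pow_pow)+
    then have mK: "g [^] m \<in> K" "h [^] m \<in> K" "?gh [^] m \<in> K"
      using K_pow exponent(2) gh c by metis+
    show ?thesis
      using root[OF gh(1) \<open>m > 0\<close> mK(1)] root[OF gh(2) \<open>m > 0\<close> mK(2)] root[OF c \<open>m > 0\<close> mK(3)] key[OF gh mK]
      by (simp add: add_divide_distrib)
  qed
  show "root_extension \<eta> h = \<eta> h" if "h \<in> K" for h
    using root[of h 1] that KG by simp
qed

end

section \<open>Restriction on the character sphere\<close>

lemma characters_iff:
  "\<xi> \<in> characters G \<longleftrightarrow> \<xi> \<in> extensional (carrier G) \<and>
     (\<forall>g\<in>carrier G. \<forall>h\<in>carrier G. \<xi> (g \<otimes>\<^bsub>G\<^esub> h) = \<xi> g + \<xi> h)"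
  by (auto simp: characters_def hom_def real_group_def)

lemma character_class_eq_iff:
  assumes "\<xi> \<in> nonzero_characters G" "\<xi>' \<in> nonzero_characters G"
  shows "character_class G \<xi> = character_class G \<xi>' \<longleftrightarrow> (\<exists>a>0. \<forall>g\<in>carrier G. \<xi> g = a * \<xi>' g)"
proof
  assume "character_class G \<xi> = character_class G \<xi>'"
  have "\<xi>' \<in> character_class G \<xi>'" using assms(2) by (auto simp: character_class_def intro!: exI[of _ 1])
  then show "\<exists>a>0. \<forall>g\<in>carrier G. \<xi> g = a * \<xi>' g" 
    unfolding \<open>character_class G \<xi> = character_class G \<xi>'\<close>[symmetric] by (simp add: character_class_def)
next
  assume "\<exists>a>0. \<forall>g\<in>carrier G. \<xi> g = a * \<xi>' g"
  then obtain a where a: "a > 0" "\<And>g. g \<in> carrier G \<Longrightarrow> \<xi> g = a * \<xi>' g" by auto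
  have "(\<exists>b>0. \<forall>g\<in>carrier G. \<xi> g = b * \<zeta> g) \<longleftrightarrow> (\<exists>b>0. \<forall>g\<in>carrier G. \<xi>' g = b * \<zeta> g)" for \<zeta>
  proof
    assume "\<exists>b>0. \<forall>g\<in>carrier G. \<xi> g = b * \<zeta> g"
    then obtain b where "b > 0" "\<forall>g\<in>carrier G. \<xi> g = b * \<zeta> g" by auto
    then show "\<exists>b>0. \<forall>g\<in>carrier G. \<xi>' g = b * \<zeta> g"
      using a by (intro exI[of _ "b / a"]) (auto simp: field_simps)
  next
    assume "\<exists>b>0. \<forall>g\<in>carrier G. \<xi>' g = b * \<zeta> g"
    then obtain b where "b > 0" "\<forall>g\<in>carrier G. \<xi>' g = b * \<zeta> g" by auto
    then show "\<exists>b>0. \<forall>g\<in>carrier G. \<xi> g = b * \<zeta> g"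
      using a by (intro exI[of _ "a * b"]) auto
  qed
  then show "character_class G \<xi> = character_class G \<xi>'" unfolding character_class_def by simp
qed

context finite_index
begin

abbreviation K_group ("G\<^sub>K") where "G\<^sub>K \<equiv> G\<lparr>carrier := K\<rparr>"

lemma K_subset: "K \<subseteq> carrier G"
  using subgroup.subset[OF subgroup] .

lemma restrict_character: "\<xi> \<in> characters G \<Longrightarrow> restrict \<xi> K \<in> characters G\<^sub>K"
  using K_subset subgroup.m_closed[OF subgroup] by (auto simp: characters_iff subset_iff)

lemma character_pow: "\<xi> \<in> characters G \<Longrightarrow> g \<in> carrier G \<Longrightarrow> \<xi> (g [^] (k::nat)) = real k * \<xi> g"
proof -
  assume "\<xi> \<in> characters G" "g \<in> carrier G"
  moreover from this interpret real_character G \<xi> by unfold_locales (auto simp: characters_iff)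
  show ?thesis using char_pow[OF \<open>g \<in> carrier G\<close>] .
qed

lemma character_determined:
  assumes "\<xi> \<in> characters G" "g \<in> carrier G"
  shows "\<xi> g = restrict \<xi> K (g [^] exponent g) / real (exponent g)"
  using character_pow[OF assms, of "exponent g"] exponent[OF assms(2)] by simp

lemma restrict_nonzero:
  assumes "\<xi> \<in> nonzero_characters G" shows "restrict \<xi> K \<in> nonzero_characters G\<^sub>K"
proof -
  have \<xi>: "\<xi> \<in> characters G" using assms by (simp add: nonzero_characters_def)
  obtain g where g: "g \<in> carrier G" "\<xi> g \<noteq> 0" using assms by (auto simp: nonzero_characters_def)
  then have "restrict \<xi> K (g [^] exponent g) \<noteq> 0" using character_determined[OF \<xi> g(1)] by auto
  then show ?thesis
    using restrict_character[OF \<xi>] exponent(2)[OF g(1)]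
    unfolding nonzero_characters_def by (auto intro!: bexI[of _ "g [^] exponent g"])
qed

lemma restrict_proportional_iff:
  assumes "\<xi> \<in> characters G" "\<xi>' \<in> characters G"
  shows "(\<forall>g\<in>K. restrict \<xi> K g = a * restrict \<xi>' K g) \<longleftrightarrow> (\<forall>g\<in>carrier G. \<xi> g = a * \<xi>' g)"
proof
  assume *: "\<forall>g\<in>K. restrict \<xi> K g = a * restrict \<xi>' K g"
  show "\<forall>g\<in>carrier G. \<xi> g = a * \<xi>' g"
  proof
    fix g assume g: "g \<in> carrier G"
    show "\<xi> g = a * \<xi>' g"
      unfolding character_determined[OF assms(1) g] character_determined[OF assms(2) g]
      using * exponent(2)[OF g] by (simp del: restrict_apply)
  qed
qed (use K_subset in auto)

lemma class_restrict_eq_iff: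
  assumes "\<xi> \<in> nonzero_characters G" "\<xi>' \<in> nonzero_characters G"
  shows "character_class G\<^sub>K (restrict \<xi> K) = character_class G\<^sub>K (restrict \<xi>' K) \<longleftrightarrow>
    character_class G \<xi> = character_class G \<xi>'"
proof -
  have "\<xi> \<in> characters G" "\<xi>' \<in> characters G" using assms by (auto simp: nonzero_characters_def)
  then show ?thesis
    using character_class_eq_iff[OF assms] character_class_eq_iff[OF restrict_nonzero[OF assms(1)] restrict_nonzero[OF assms(2)]]
      restrict_proportional_iff by simp
qed

lemma sphere_restriction_class:
  assumes "\<xi> \<in> nonzero_characters G"
  shows "sphere_restriction G K (character_class G \<xi>) = character_class G\<^sub>K (restrict \<xi> K)"
proof -
  have self: "\<xi> \<in> character_class G \<xi>" using assms by (auto simp: character_class_def intro!: exI[of _ 1])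
  have "character_class G\<^sub>K (restrict \<xi>' K) = character_class G\<^sub>K (restrict \<xi> K)"
    if "\<xi>' \<in> character_class G \<xi>" for \<xi>'
  proof -
    have \<xi>': "\<xi>' \<in> nonzero_characters G" using that by (simp add: character_class_def)
    then have "character_class G \<xi> = character_class G \<xi>'"
      using that character_class_eq_iff[OF assms \<xi>'] by (simp add: character_class_def)
    then show ?thesis using class_restrict_eq_iff[OF \<xi>' assms] by simp
  qed
  then have "(\<lambda>\<xi>'. character_class G\<^sub>K (restrict \<xi>' K)) ` character_class G \<xi> = {character_class G\<^sub>K (restrict \<xi> K)}"
    using self by blast
  then show ?thesis unfolding sphere_restriction_def by simp
qed

lemma root_extension_restrict:
  assumes "\<xi> \<in> characters G" shows "root_extension (restrict \<xi> K) = \<xi>"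
proof
  fix g
  have "\<xi> g = undefined" if "g \<notin> carrier G"
    using assms that extensional_arb[of \<xi> "carrier G" g] unfolding characters_iff by blast
  moreover have "root_extension (restrict \<xi> K) g = \<xi> g" if "g \<in> carrier G"
    unfolding character_determined[OF assms that] root_extension_def restrict_apply'[OF that] by (rule refl)
  ultimately show "root_extension (restrict \<xi> K) g = \<xi> g"
    by (cases "g \<in> carrier G") (auto simp: root_extension_def)
qed

end

locale equal_rank = finite_index +
  assumes fg: "finitely_generated_group G"
    and rank: "torsion_free_rank (abelianisation G) = torsion_free_rank (abelianisation (G\<lparr>carrier := K\<rparr>))"
begin

lemma nonzero_character_extends:
  assumes "\<eta> \<in> nonzero_characters G\<^sub>K"
  shows "root_extension \<eta> \<in> nonzero_characters G" "restrict (root_extension \<eta>) K = \<eta>"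
proof -
  have \<eta>: "\<eta> \<in> characters G\<^sub>K" using assms by (simp add: nonzero_characters_def)
  obtain h where h: "h \<in> K" "\<eta> h \<noteq> 0" using assms by (auto simp: nonzero_characters_def)
  have mult: "\<eta> (g \<otimes> h) = \<eta> g + \<eta> h" if "g \<in> K" "h \<in> K" for g h
    using that \<eta> by (simp add: characters_iff)
  note ext = root_extension_character[where \<eta> = \<eta>, OF fg rank mult]
  have "root_extension \<eta> \<in> characters G"
    using ext(1) by (auto simp: characters_iff) (simp add: root_extension_def)
  then show "root_extension \<eta> \<in> nonzero_characters G"
    using h K_subset ext(2) by (auto simp: nonzero_characters_def intro!: bexI[of _ h])
  show "restrict (root_extension \<eta>) K = \<eta>"
    using \<eta> ext(2) by (auto simp: characters_iff extensional_def fun_eq_iff)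
qed

abbreviation top_G where "top_G \<equiv> subtopology (character_topology G) (nonzero_characters G)"
abbreviation top_K where "top_K \<equiv> subtopology (character_topology G\<^sub>K) (nonzero_characters G\<^sub>K)"

lemma topspace_top: "topspace top_G = nonzero_characters G" "topspace top_K = nonzero_characters G\<^sub>K"
  by (auto simp: character_topology_def nonzero_characters_def characters_def PiE_def)

lemma continuous_eval:
  "g \<in> carrier H \<Longrightarrow> continuous_map (subtopology (character_topology H) X) euclideanreal (\<lambda>\<xi>. \<xi> g)"
  unfolding character_topology_def
  by (intro continuous_map_from_subtopology continuous_map_product_projection)

lemma continuous_into_characters:
  assumes "\<And>g. g \<in> carrier H \<Longrightarrow> continuous_map X euclideanreal (\<lambda>x. f x g)"
    "f ` topspace X \<subseteq> nonzero_characters H"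
  shows "continuous_map X (subtopology (character_topology H) (nonzero_characters H)) f"
  unfolding character_topology_def continuous_map_in_subtopology continuous_map_componentwise
  using assms by (auto simp: nonzero_characters_def characters_def)

text \<open>Both topologies are those of pointwise convergence, and the inverse evaluates \<open>\<eta>\<close> at the fixed
  element \<open>g [^] exponent g\<close> and divides by a constant.\<close>

lemma homeomorphic_restrict: "homeomorphic_map top_G top_K (\<lambda>\<xi>. restrict \<xi> K)"
proof -
  have "continuous_map top_G top_K (\<lambda>\<xi>. restrict \<xi> K)"
  proof (rule continuous_into_characters)
    fix g assume "g \<in> carrier G\<^sub>K"
    then show "continuous_map top_G euclideanreal (\<lambda>\<xi>. restrict \<xi> K g)"
      using K_subset continuous_eval[of g G] by (auto simp: subset_iff)
  qed (use restrict_nonzero topspace_top in auto)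
  moreover have "continuous_map top_K top_G root_extension"
  proof (rule continuous_into_characters)
    fix g assume g: "g \<in> carrier G"
    then show "continuous_map top_K euclideanreal (\<lambda>\<eta>. root_extension \<eta> g)"
      using continuous_eval[of "g [^] exponent g" G\<^sub>K] exponent[OF g]
      by (auto simp: root_extension_def intro!: continuous_map_real_divide)
  qed (use nonzero_character_extends topspace_top in auto)
  ultimately have "homeomorphic_maps top_G top_K (\<lambda>\<xi>. restrict \<xi> K) root_extension"
    unfolding homeomorphic_maps_def topspace_top
    using nonzero_character_extends restrict_nonzero root_extension_restrict by (auto simp: nonzero_characters_def)
  then show ?thesis using homeomorphic_maps_map by blast
qed

text \<open>The composition of the homeomorphism on characters with the projection onto the sphere is a
  quotient map which factors through the sphere of \<open>G\<close>; the factor is again a quotient map, and it is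
  injective because restriction reflects positive proportionality.\<close>

theorem homeomorphic_sphere_restriction:
  "homeomorphic_map (sphere_topology G) (sphere_topology G\<^sub>K) (sphere_restriction G K)"
proof -
  let ?r = "sphere_restriction G K"
  have qG: "quotient_map top_G (sphere_topology G) (character_class G)" by (rule quotient_map_character_class)
  have "quotient_map top_G (sphere_topology G\<^sub>K) (character_class G\<^sub>K \<circ> (\<lambda>\<xi>. restrict \<xi> K))"
    by (intro quotient_map_compose[OF homeomorphic_restrict[unfolded homeomorphic_map_def, THEN conjunct1]]
        quotient_map_character_class)
  then have q: "quotient_map top_G (sphere_topology G\<^sub>K) (?r \<circ> character_class G)"
    by (rule quotient_map_eq) (simp add: topspace_top sphere_restriction_class)
  have cont: "continuous_map (sphere_topology G) (sphere_topology G\<^sub>K) ?r"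
    using continuous_compose_quotient_map[OF qG quotient_imp_continuous_map[OF q]] .
  have "quotient_map (sphere_topology G) (sphere_topology G\<^sub>K) ?r"
    using quotient_map_from_composition[OF quotient_imp_continuous_map[OF qG] cont q] .
  moreover have "topspace (sphere_topology G) = character_class G ` nonzero_characters G"
    using quotient_imp_surjective_map[OF qG] topspace_top by simp
  then have "inj_on ?r (topspace (sphere_topology G))"
    by (auto simp: inj_on_def sphere_restriction_class class_restrict_eq_iff)
  ultimately show ?thesis unfolding homeomorphic_map_def by blast
qed

end

theorem theorem1p6:
  fixes G :: "('g, 'b) monoid_scheme"
    and H :: "'g set"
    and A :: "('g \<Rightarrow>\<^sub>0 int, 'm) module"
    and n :: nat
  assumes "finitely_generated_group G"
    and "fp_type n (monoid_ring G) A"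
    and "subgroup H G"
    and "finite (rcosets\<^bsub>G\<^esub> H)"
    and "torsion_free_rank (abelianisation G) =
         torsion_free_rank (abelianisation (G\<lparr>carrier := H\<rparr>))"
  shows "(\<forall>\<xi>\<in>nonzero_characters G.
            restrict \<xi> H \<in> nonzero_characters (G\<lparr>carrier := H\<rparr>) \<and>
            sphere_restriction G H (character_class G \<xi>) =
              character_class (G\<lparr>carrier := H\<rparr>) (restrict \<xi> H))
       \<and> homeomorphic_map (sphere_topology G) (sphere_topology (G\<lparr>carrier := H\<rparr>))
           (sphere_restriction G H)
       \<and> sphere_restriction G H ` Sigma_invariant n G A =
           Sigma_invariant n (G\<lparr>carrier := H\<rparr>) A"
proof -
  have G: "group G" using assms(1) unfolding finitely_generated_group_def by simp
  interpret equal_rank G H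
    by (intro equal_rank.intro equal_rank_axioms.intro finite_index.intro finite_index_axioms.intro
        group_ring.intro G assms(1,3,4,5))
  have fp: "fp_type n (monoid_ring (nonneg_submonoid (G\<lparr>carrier := H\<rparr>) (restrict \<xi> H))) A \<longleftrightarrow>
      fp_type n (monoid_ring (nonneg_submonoid G \<xi>)) A" if "\<xi> \<in> nonzero_characters G" for \<xi>
  proof -
    have "{g \<in> H. restrict \<xi> H g \<ge> 0} = {g \<in> H. \<xi> g \<ge> 0}" by auto
    then show ?thesis
      using fp_type_nonneg_finite_index[OF G assms(3,4) _ _ assms(2), of \<xi>] that
      by (simp add: nonneg_submonoid_def nonzero_characters_def characters_iff cong: conj_cong)
  qed
  have "sphere_restriction G H ` Sigma_invariant n G A = Sigma_invariant n (G\<lparr>carrier := H\<rparr>) A"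
  proof
    show "sphere_restriction G H ` Sigma_invariant n G A \<subseteq> Sigma_invariant n (G\<lparr>carrier := H\<rparr>) A"
      unfolding Sigma_invariant_def using sphere_restriction_class restrict_nonzero fp by fastforce
    show "Sigma_invariant n (G\<lparr>carrier := H\<rparr>) A \<subseteq> sphere_restriction G H ` Sigma_invariant n G A"
    proof
      fix c assume "c \<in> Sigma_invariant n (G\<lparr>carrier := H\<rparr>) A"
      then obtain \<eta> where \<eta>: "c = character_class (G\<lparr>carrier := H\<rparr>) \<eta>" "\<eta> \<in> nonzero_characters (G\<lparr>carrier := H\<rparr>)"
        "fp_type n (monoid_ring (nonneg_submonoid (G\<lparr>carrier := H\<rparr>) \<eta>)) A"
        unfolding Sigma_invariant_def by auto
      define \<xi> where "\<xi> = root_extension \<eta>"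
      have \<xi>: "\<xi> \<in> nonzero_characters G" "restrict \<xi> H = \<eta>"
        unfolding \<xi>_def using nonzero_character_extends[OF \<eta>(2)] .
      then have "c = sphere_restriction G H (character_class G \<xi>)" "character_class G \<xi> \<in> Sigma_invariant n G A"
        using sphere_restriction_class[OF \<xi>(1)] fp[OF \<xi>(1)] \<eta> unfolding Sigma_invariant_def by auto
      then show "c \<in> sphere_restriction G H ` Sigma_invariant n G A" by blast
    qed
  qed
  then show ?thesis using restrict_nonzero sphere_restriction_class homeomorphic_sphere_restriction by blast
qed

end
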